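(* Let $\mathbb{K}=\mathbb{R}$ or $\mathbb{C}$, and let $(\Pi,X)$ be a formal homogeneous Poisson structure on $\mathbb{K}^n$ (with $\Pi(0)=0$ and $X(0)=0$) such that the linear part $\Pi_1$ of $\Pi$ at $0$ corresponds to a semisimple Lie algebra $\mathfrak{g}$ over $\mathbb{K}$. Suppose that its linear part $(\Pi_1,X^{(1)})$ is semisimple nonresonant. Then there exists a formal diffeomorphism of $(\mathbb{K}^n,0)$ which sends $(\Pi,X)$ to $(\Pi_1,X^{(1)})$.
   Context: A homogeneous Poisson structure is a couple $(\Pi,X)$ where $\Pi$ is a Poisson bivector field and $X$ is a vector field with $[X,\Pi]=\mathcal{L}_X\Pi=-\Pi$ (Schouten bracket); "formal" means that the coefficients are formal power series at $0$. $\Pi_1$ and $X^{(1)}$ denote the linear parts of $\Pi$ and $X$ at $0$; $(\Pi_1,X^{(1)})$ is again a homogeneous Poisson structure. The linear Poisson structure $\Pi_1=\frac12\sum_{i,j,k}c_{ij}^k x_k\,\partial_{x_i}\wedge\partial_{x_j}$, i.e. $\{x_i,x_j\}=\sum_k c_{ij}^kx_k$, corresponds to the Lie algebra $\mathfrak{g}$ with structure constants $c_{ij}^k$, which is identified with the space of linear functions on $\mathbb{K}^n$ with the bracket $\{\cdot,\cdot\}$ of $\Pi_1$. For a function $h$, $X_h=\{h,\cdot\}$ is its Hamiltonian vector field with respect to $\Pi_1$. Let $I=\sum_i x_i\partial_{x_i}$. Since $\mathfrak{g}$ is semisimple, $X^{(1)}=I+X_{h_1}$ for a unique $h_1\in\mathfrak{g}$.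 Definition (semisimple nonresonant). If $\mathbb{K}=\mathbb{R}$, replace $\mathfrak{g}$ by its complexification in what follows. Suppose $h_1$ is a semisimple element of $\mathfrak{g}$, let $\mathfrak{h}$ be a Cartan subalgebra containing $h_1$, and let $(x_1,\dots,x_n)$ be a basis of $\mathfrak{g}$ and $\alpha_1,\dots,\alpha_n\in\mathfrak{h}^*$ (each $\alpha_i$ is $0$ or a root) such that $[y,x_i]=\langle\alpha_i,y\rangle x_i$ for all $y\in\mathfrak{h}$ and all $i$. The couple $(\Pi_1,X^{(1)})$ is called semisimple nonresonant if $h_1$ is semisimple and for every $r\ge2$ and every $(\lambda_1,\dots,\lambda_n)\in\mathbb{Z}_+^n$ with $\sum_i\lambda_i=r$ one has $r-1+\sum_{i=1}^n\lambda_i\langle\alpha_i,h_1\rangle\neq0$. *)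

theory Defs
  imports "HOL-Analysis.Analysis"
begin

text \<open>
  A formal power series in the variables \<open>x\<^sub>i\<close>, \<open>i :: 'n\<close>, is the family of its coefficients, indexed
  by the exponents \<open>m :: 'n \<Rightarrow> nat\<close>; the number of variables is \<open>CARD('n)\<close>.
\<close>

typedef ('k, 'n) mfps = "UNIV :: (('n \<Rightarrow> nat) \<Rightarrow> 'k) set"
  morphisms mcoeff Abs_mfps ..

setup_lifting type_definition_mfps

lemma mfps_eqI: "(\<And>m. mcoeff f m = mcoeff g m) \<Longrightarrow> f = g"
  by (metis ext mcoeff_inject)

lemma finite_exponents_le: "finite {a. a \<le> (m :: 'n::finite \<Rightarrow> nat)}"
proof (rule finite_subset)
  show "{a. a \<le> m} \<subseteq> (\<Pi>\<^sub>E i\<in>UNIV. {..m i})"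
    by (auto simp: le_fun_def)
qed (auto intro: finite_PiE)

instantiation mfps :: (comm_ring_1, finite) comm_ring_1
begin

lift_definition zero_mfps :: "('a, 'b) mfps" is "\<lambda>_. 0" .

lift_definition one_mfps :: "('a, 'b) mfps" is "\<lambda>m. if m = (\<lambda>_. 0) then 1 else 0" .

lift_definition plus_mfps :: "('a, 'b) mfps \<Rightarrow> ('a, 'b) mfps \<Rightarrow> ('a, 'b) mfps"
  is "\<lambda>f g m. f m + g m" .

lift_definition minus_mfps :: "('a, 'b) mfps \<Rightarrow> ('a, 'b) mfps \<Rightarrow> ('a, 'b) mfps"
  is "\<lambda>f g m. f m - g m" .

lift_definition uminus_mfps :: "('a, 'b) mfps \<Rightarrow> ('a, 'b) mfps"
  is "\<lambda>f m. - f m" .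

lift_definition times_mfps :: "('a, 'b) mfps \<Rightarrow> ('a, 'b) mfps \<Rightarrow> ('a, 'b) mfps"
  is "\<lambda>f g m. \<Sum>a | a \<le> m. f a * g (\<lambda>i. m i - a i)" .

instance
proof
  fix f g h :: "('a, 'b) mfps"
  show "f * g * h = f * (g * h)"
  proof (transfer, rule ext)
    fix f g h :: "('b \<Rightarrow> nat) \<Rightarrow> 'a" and m :: "'b \<Rightarrow> nat"
    have "(\<Sum>a | a \<le> m. (\<Sum>b | b \<le> a. f b * g (\<lambda>i. a i - b i)) * h (\<lambda>i. m i - a i))
        = (\<Sum>(a, b)\<in>(SIGMA a:{a. a \<le> m}. {b. b \<le> a}). f b * g (\<lambda>i. a i - b i) * h (\<lambda>i. m i - a i))"
      by (simp add: sum_distrib_right sum.Sigma finite_exponents_le)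
    also have "\<dots> = (\<Sum>(b, c)\<in>(SIGMA b:{b. b \<le> m}. {c. c \<le> (\<lambda>i. m i - b i)}).
        f b * (g c * h (\<lambda>i. m i - b i - c i)))"
      by (rule sum.reindex_bij_witness
          [of _ "\<lambda>(b, c). (\<lambda>i. b i + c i, b)" "\<lambda>(a, b). (b, \<lambda>i. a i - b i)"])
        (auto simp: le_fun_def fun_eq_iff mult.assoc intro: le_trans diff_le_mono,
          metis add.commute le_diff_conv2)
    also have "\<dots> = (\<Sum>a | a \<le> m. f a * (\<Sum>b | b \<le> (\<lambda>i. m i - a i).
        g b * h (\<lambda>i. m i - a i - b i)))"
      by (simp add: sum_distrib_left sum.Sigma finite_exponents_le)
    finally show "(\<Sum>a | a \<le> m. (\<Sum>b | b \<le> a. f b * g (\<lambda>i. a i - b i)) * h (\<lambda>i. m i - a i))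
        = (\<Sum>a | a \<le> m. f a * (\<Sum>b | b \<le> (\<lambda>i. m i - a i). g b * h (\<lambda>i. m i - a i - b i)))" .
  qed
  show "f * g = g * f"
  proof (transfer, rule ext)
    fix f g :: "('b \<Rightarrow> nat) \<Rightarrow> 'a" and m :: "'b \<Rightarrow> nat"
    show "(\<Sum>a | a \<le> m. f a * g (\<lambda>i. m i - a i)) = (\<Sum>a | a \<le> m. g a * f (\<lambda>i. m i - a i))"
      by (rule sum.reindex_bij_witness
          [of _ "\<lambda>a i. m i - a i" "\<lambda>a i. m i - a i"])
        (auto simp: le_fun_def fun_eq_iff mult.commute)
  qed
  show "1 * f = f"
  proof (transfer, rule ext)
    fix f :: "('b \<Rightarrow> nat) \<Rightarrow> 'a" and m :: "'b \<Rightarrow> nat"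
    have "(\<Sum>a | a \<le> m. (if a = (\<lambda>_. 0) then 1 else 0) * f (\<lambda>i. m i - a i))
        = (\<Sum>a | a \<le> m. if a = (\<lambda>_. 0) then f m else 0)"
      by (rule sum.cong) auto
    also have "\<dots> = f m"
      using sum.delta[OF finite_exponents_le[of m], of "\<lambda>_. 0" "\<lambda>_. f m"] by (simp add: le_funI)
    finally show "(\<Sum>a | a \<le> m. (if a = (\<lambda>_. 0) then 1 else 0) * f (\<lambda>i. m i - a i)) = f m" .
  qed
  show "(f + g) * h = f * h + g * h"
    by transfer (simp add: distrib_right sum.distrib)
  show "(0 :: ('a, 'b) mfps) \<noteq> 1"
    by transfer (auto simp: fun_eq_iff)
qed (transfer; simp add: fun_eq_iff algebra_simps)+

end

lift_definition mconst :: "'k::zero \<Rightarrow> ('k, 'n) mfps"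
  is "\<lambda>c m. if m = (\<lambda>_. 0) then c else 0" .

definition unit_exp :: "'n \<Rightarrow> 'n \<Rightarrow> nat"
  where "unit_exp i = (\<lambda>j. if j = i then 1 else 0)"

lift_definition mvar :: "'n \<Rightarrow> ('k::zero_neq_one, 'n) mfps"
  is "\<lambda>i m. if m = unit_exp i then 1 else 0" .

lift_definition mderiv :: "'n \<Rightarrow> ('k::comm_ring_1, 'n) mfps \<Rightarrow> ('k, 'n) mfps"
  is "\<lambda>i f m. of_nat (m i + 1) * f (m(i := m i + 1))" .

lift_definition linear_part :: "('k::zero, 'n::finite) mfps \<Rightarrow> ('k, 'n) mfps"
  is "\<lambda>f m. if (\<Sum>i\<in>UNIV. m i) = 1 then f m else 0" .

abbreviation value0 :: "('k, 'n) mfps \<Rightarrow> 'k"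
  where "value0 f \<equiv> mcoeff f (\<lambda>_. 0)"

text \<open>
  The substitution \<open>f(\<phi>\<^sub>1, \<dots>, \<phi>\<^sub>n)\<close>, meaningful when all \<open>\<phi>\<^sub>i\<close> vanish at \<open>0\<close>. In this case
  \<open>\<Prod>i. \<phi>\<^sub>i ^ k\<^sub>i\<close> has no term of degree less than \<open>\<Sum>i. k\<^sub>i\<close>, so that only the finitely many \<open>k\<close> with
  \<open>\<Sum>i. k\<^sub>i \<le> \<Sum>i. m\<^sub>i\<close> contribute to the coefficient at \<open>m\<close>.
\<close>

definition mcompose ::
    "('k::comm_ring_1, 'n::finite) mfps \<Rightarrow> ('n \<Rightarrow> ('k, 'n) mfps) \<Rightarrow> ('k, 'n) mfps"
  where "mcompose f \<phi> = Abs_mfps (\<lambda>m.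
    \<Sum>k | (\<Sum>i\<in>UNIV. k i) \<le> (\<Sum>i\<in>UNIV. m i). mcoeff f k * mcoeff (\<Prod>i\<in>UNIV. \<phi> i ^ k i) m)"

text \<open>
  A formal vector field \<open>\<Sum>i. X\<^sub>i \<partial>\<^sub>i\<close> is the family of its components, and a formal bivector field
  \<open>1/2 \<Sum>i j. \<Pi>\<^sub>i\<^sub>j \<partial>\<^sub>i \<and> \<partial>\<^sub>j\<close> is the skew-symmetric family of its components \<open>\<Pi>\<^sub>i\<^sub>j = {x\<^sub>i, x\<^sub>j}\<close>.
\<close>

type_synonym ('k, 'n) vfield = "'n \<Rightarrow> ('k, 'n) mfps"
type_synonym ('k, 'n) bivfield = "'n \<Rightarrow> 'n \<Rightarrow> ('k, 'n) mfps"

definition vf_apply :: "('k::comm_ring_1, 'n::finite) vfield \<Rightarrow> ('k, 'n) mfps \<Rightarrow> ('k, 'n) mfps"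
  where "vf_apply X f = (\<Sum>i\<in>UNIV. X i * mderiv i f)"

definition poisson_bracket ::
    "('k::comm_ring_1, 'n::finite) bivfield \<Rightarrow> ('k, 'n) mfps \<Rightarrow> ('k, 'n) mfps \<Rightarrow> ('k, 'n) mfps"
  where "poisson_bracket P f g = (\<Sum>i\<in>UNIV. \<Sum>j\<in>UNIV. P i j * mderiv i f * mderiv j g)"

definition poisson_structure :: "('k::comm_ring_1, 'n::finite) bivfield \<Rightarrow> bool"
  where "poisson_structure P \<longleftrightarrow>
    (\<forall>i j. P i j = - P j i) \<and>
    (\<forall>f g h. poisson_bracket P f (poisson_bracket P g h)
           + poisson_bracket P g (poisson_bracket P h f)
           + poisson_bracket P h (poisson_bracket P f g) = 0)"

text \<open>The components of the Lie derivative (Schouten bracket) \<open>[X, \<Pi>] = L\<^sub>X \<Pi>\<close>:\<close>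

definition lie_derivative ::
    "('k::comm_ring_1, 'n::finite) vfield \<Rightarrow> ('k, 'n) bivfield \<Rightarrow> ('k, 'n) bivfield"
  where "lie_derivative X P i j =
    vf_apply X (P i j) - (\<Sum>l\<in>UNIV. P l j * mderiv l (X i)) - (\<Sum>l\<in>UNIV. P i l * mderiv l (X j))"

definition homogeneous_poisson ::
    "('k::comm_ring_1, 'n::finite) bivfield \<Rightarrow> ('k, 'n) vfield \<Rightarrow> bool"
  where "homogeneous_poisson P X \<longleftrightarrow>
    poisson_structure P \<and> (\<forall>i j. lie_derivative X P i j = - P i j)"

definition hamiltonian_vf ::
    "('k::comm_ring_1, 'n::finite) bivfield \<Rightarrow> ('k, 'n) mfps \<Rightarrow> ('k, 'n) vfield"
  where "hamiltonian_vf P h = (\<lambda>j. poisson_bracket P h (mvar j))"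

definition euler_vf :: "('k::comm_ring_1, 'n::finite) vfield"
  where "euler_vf = (\<lambda>i. mvar i)"

abbreviation vf_linear_part :: "('k::comm_ring_1, 'n::finite) vfield \<Rightarrow> ('k, 'n) vfield"
  where "vf_linear_part X \<equiv> (\<lambda>i. linear_part (X i))"

abbreviation biv_linear_part :: "('k::comm_ring_1, 'n::finite) bivfield \<Rightarrow> ('k, 'n) bivfield"
  where "biv_linear_part P \<equiv> (\<lambda>i j. linear_part (P i j))"

definition formal_diffeo :: "('k::field, 'n::finite) vfield \<Rightarrow> bool"
  where "formal_diffeo \<phi> \<longleftrightarrow>
    (\<forall>i. value0 (\<phi> i) = 0) \<and>
    invertible ((\<chi> i j. mcoeff (\<phi> i) (unit_exp j)) :: 'k ^ 'n ^ 'n)"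

text \<open>
  The push-forward of a vector field or bivector field by the map with components \<open>\<phi>\<^sub>i\<close> equals \<open>Y\<close>
  resp. \<open>Q\<close> iff \<open>X(\<phi>\<^sub>i) = Y\<^sub>i \<circ> \<phi>\<close> resp. \<open>{\<phi>\<^sub>i, \<phi>\<^sub>j}\<^sub>P = Q\<^sub>i\<^sub>j \<circ> \<phi>\<close>.
\<close>

definition sends_vf ::
    "('k::field, 'n::finite) vfield \<Rightarrow> ('k, 'n) vfield \<Rightarrow> ('k, 'n) vfield \<Rightarrow> bool"
  where "sends_vf \<phi> X Y \<longleftrightarrow> (\<forall>i. vf_apply X (\<phi> i) = mcompose (Y i) \<phi>)"

definition sends_biv ::
    "('k::field, 'n::finite) vfield \<Rightarrow> ('k, 'n) bivfield \<Rightarrow> ('k, 'n) bivfield \<Rightarrow> bool"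
  where "sends_biv \<phi> P Q \<longleftrightarrow> (\<forall>i j. poisson_bracket P (\<phi> i) (\<phi> j) = mcompose (Q i j) \<phi>)"

type_synonym ('k, 'n) bracket = "'k ^ 'n \<Rightarrow> 'k ^ 'n \<Rightarrow> 'k ^ 'n"

definition lie_bracket :: "('n \<Rightarrow> 'n \<Rightarrow> 'n \<Rightarrow> 'k::field) \<Rightarrow> ('k, 'n::finite) bracket"
  where "lie_bracket c u v = (\<chi> k. \<Sum>i\<in>UNIV. \<Sum>j\<in>UNIV. c i j k * u $ i * v $ j)"

definition bracket_span :: "('k::field, 'n::finite) bracket \<Rightarrow> ('k ^ 'n) set \<Rightarrow> ('k ^ 'n) set \<Rightarrow> ('k ^ 'n) set"
  where "bracket_span br A B = vec.span {br u v | u v. u \<in> A \<and> v \<in> B}"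

definition lie_ideal :: "('k::field, 'n::finite) bracket \<Rightarrow> ('k ^ 'n) set \<Rightarrow> bool"
  where "lie_ideal br A \<longleftrightarrow> vec.subspace A \<and> (\<forall>u. \<forall>v\<in>A. br u v \<in> A)"

definition lie_solvable :: "('k::field, 'n::finite) bracket \<Rightarrow> ('k ^ 'n) set \<Rightarrow> bool"
  where "lie_solvable br A \<longleftrightarrow> (\<exists>m. ((\<lambda>B. bracket_span br B B) ^^ m) A = {0})"

definition lie_semisimple :: "('k::field, 'n::finite) bracket \<Rightarrow> bool"
  where "lie_semisimple br \<longleftrightarrow> (\<forall>A. lie_ideal br A \<and> lie_solvable br A \<longrightarrow> A = {0})"

definition lie_subalgebra :: "('k::field, 'n::finite) bracket \<Rightarrow> ('k ^ 'n) set \<Rightarrow> bool"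
  where "lie_subalgebra br A \<longleftrightarrow> vec.subspace A \<and> (\<forall>u\<in>A. \<forall>v\<in>A. br u v \<in> A)"

definition lie_nilpotent :: "('k::field, 'n::finite) bracket \<Rightarrow> ('k ^ 'n) set \<Rightarrow> bool"
  where "lie_nilpotent br A \<longleftrightarrow> (\<exists>m. ((\<lambda>B. bracket_span br A B) ^^ m) A = {0})"

definition cartan_subalgebra :: "('k::field, 'n::finite) bracket \<Rightarrow> ('k ^ 'n) set \<Rightarrow> bool"
  where "cartan_subalgebra br H \<longleftrightarrow>
    lie_subalgebra br H \<and> lie_nilpotent br H \<and> {u. \<forall>v\<in>H. br u v \<in> H} = H"

definition vec_basis :: "('n \<Rightarrow> 'k::field ^ 'n::finite) \<Rightarrow> bool"
  where "vec_basis b \<longleftrightarrow> inj b \<and> vec.independent (range b) \<and> vec.span (range b) = UNIV"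

text \<open>Semisimplicity of \<open>ad h\<close> over the algebraically closed field \<open>\<complex>\<close> is diagonalizability.\<close>

definition semisimple_element :: "(complex, 'n::finite) bracket \<Rightarrow> complex ^ 'n \<Rightarrow> bool"
  where "semisimple_element br h \<longleftrightarrow> (\<exists>b \<mu>. vec_basis b \<and> (\<forall>i. br h (b i) = \<mu> i *s b i))"

definition linear_form_on :: "('k::field ^ 'n::finite) set \<Rightarrow> ('k ^ 'n \<Rightarrow> 'k) \<Rightarrow> bool"
  where "linear_form_on H \<alpha> \<longleftrightarrow>
    (\<forall>u\<in>H. \<forall>v\<in>H. \<alpha> (u + v) = \<alpha> u + \<alpha> v) \<and> (\<forall>a. \<forall>u\<in>H. \<alpha> (a *s u) = a * \<alpha> u)"

text \<open>Each \<open>\<alpha>\<^sub>i\<close> is then \<open>0\<close> or a root on \<open>H\<close>, because \<open>b\<^sub>i \<noteq> 0\<close>.\<close>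

definition weight_basis ::
    "('k::field, 'n::finite) bracket \<Rightarrow> ('k ^ 'n) set \<Rightarrow> ('n \<Rightarrow> 'k ^ 'n) \<Rightarrow> ('n \<Rightarrow> 'k ^ 'n \<Rightarrow> 'k) \<Rightarrow> bool"
  where "weight_basis br H b \<alpha> \<longleftrightarrow>
    vec_basis b \<and> (\<forall>i. linear_form_on H (\<alpha> i)) \<and> (\<forall>i. \<forall>y\<in>H. br y (b i) = \<alpha> i y *s b i)"

text \<open>The structure constants \<open>c\<^sub>i\<^sub>j\<^sup>k\<close> of \<open>{x\<^sub>i, x\<^sub>j} = \<Sum>k. c\<^sub>i\<^sub>j\<^sup>k x\<^sub>k\<close> for linear \<open>P\<close>:\<close>

definition structure_const :: "('k, 'n) bivfield \<Rightarrow> 'n \<Rightarrow> 'n \<Rightarrow> 'n \<Rightarrow> 'k"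
  where "structure_const P i j k = mcoeff (P i j) (unit_exp k)"

text \<open>
  The linear function with coefficient vector \<open>u\<close>. Under this identification of \<open>\<K>\<^sup>n\<close> with the linear
  functions, \<open>lie_bracket (structure_const P)\<close> is the bracket of the linear Poisson structure \<open>P\<close>.
\<close>

definition linear_function :: "'k::comm_ring_1 ^ 'n::finite \<Rightarrow> ('k, 'n) mfps"
  where "linear_function u = (\<Sum>i\<in>UNIV. mconst (u $ i) * mvar i)"

text \<open>
  The element \<open>h\<^sub>1\<close> with \<open>X = I + X\<^bsub>h\<^sub>1\<^esub>\<close>. It exists and is unique when \<open>(P, X)\<close> is a linear homogeneous
  Poisson structure whose Lie algebra is semisimple: \<open>X - I\<close> is then a derivation of the Lie algebra,
  derivations are inner, and the centre is trivial.
\<close>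

definition hamiltonian_element ::
    "('k::comm_ring_1, 'n::finite) bivfield \<Rightarrow> ('k, 'n) vfield \<Rightarrow> 'k ^ 'n"
  where "hamiltonian_element P X =
    (THE h. \<forall>i. X i = euler_vf i + hamiltonian_vf P (linear_function h) i)"

text \<open>
  The parameter \<open>\<iota>\<close> is the embedding of the ground field into \<open>\<complex>\<close> (inclusion of \<open>\<real>\<close>, or identity
  of \<open>\<complex>\<close>): the Lie algebra with structure constants \<open>\<iota> c\<^sub>i\<^sub>j\<^sup>k\<close> on \<open>\<complex>\<^sup>n\<close> is the complexification in the
  real case and the algebra itself in the complex case. The numbers \<open>\<alpha>\<^sub>i h\<close> are the eigenvalues of
  \<open>ad h\<close> with multiplicity, so the condition does not depend on the choice of \<open>H\<close>, \<open>b\<close>, \<open>\<alpha>\<close>.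
\<close>

definition semisimple_nonresonant ::
    "('k::comm_ring_1 \<Rightarrow> complex) \<Rightarrow> ('k, 'n::finite) bivfield \<Rightarrow> ('k, 'n) vfield \<Rightarrow> bool"
  where "semisimple_nonresonant \<iota> P X \<longleftrightarrow>
    (let br = lie_bracket (\<lambda>i j k. \<iota> (structure_const P i j k));
         h = (\<chi> i. \<iota> (hamiltonian_element P X $ i))
     in semisimple_element br h \<and>
        (\<exists>H b \<alpha>. cartan_subalgebra br H \<and> h \<in> H \<and> weight_basis br H b \<alpha> \<and>
          (\<forall>r\<ge>2. \<forall>l :: 'n \<Rightarrow> nat. (\<Sum>i\<in>UNIV. l i) = r \<longrightarrow>
            of_nat r - 1 + (\<Sum>i\<in>UNIV. of_nat (l i) * \<alpha> i h) \<noteq> 0)))"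

end

theory Submission
  imports Defs "HOL-Computational_Algebra.Fundamental_Theorem_Algebra"
begin

text \<open>
  Nonresonance says that \<open>X\<^sup>(\<^sup>1\<^sup>) - 1\<close>, which is diagonalizable on the polynomials of degree \<open>r \<ge> 2\<close>
  with the eigenvalues \<open>r - 1 + \<Sum>\<lambda>\<^sub>i\<langle>\<alpha>\<^sub>i, h\<^sub>1\<rangle>\<close>, is invertible there. Solving degree by degree gives a
  function \<open>H = h\<^sub>1 + \<dots>\<close> with \<open>X H = H\<close>. The field \<open>Z = X - X\<^sub>H\<close> has the Euler field as its linear part,
  so there are unique functions \<open>\<phi>\<^sub>i = x\<^sub>i + \<dots>\<close> with \<open>Z \<phi>\<^sub>i = \<phi>\<^sub>i\<close>. Since
  \<open>Z{f, g} = {Z f, g} + {f, Z g} - {f, g}\<close>, uniqueness yields \<open>{\<phi>\<^sub>i, \<phi>\<^sub>j} = \<Sum>c\<^sub>i\<^sub>j\<^sup>k \<phi>\<^sub>k\<close>, and similarly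
  \<open>H\<close> is the linear combination of the \<open>\<phi>\<^sub>i\<close> given by \<open>h\<^sub>1\<close>; both structures become linear in the \<open>\<phi>\<^sub>i\<close>.
  Semisimplicity is needed only for the existence and uniqueness of \<open>h\<^sub>1\<close>: the Killing form is nondegenerate
  by Cartan's criterion, hence derivations are inner and the centre is trivial.
\<close>

text \<open>Two obstacles shape the proof. The weights of h_1 are complex even over the real field.
  With the linear part h_1 prescribed, \<open>X H = H\<close> is a linear problem in each degree, so
  it is solved over the complex numbers in a basis of weight vectors and projected back by a linear
  retraction such as \<open>Re\<close>; the construction of Z and of the \<phi>_i then stays over
  the ground field. Eigenvalues are also missing in Cartan's criterion over the reals, so nilpotency
  is tested after extension of scalars, where complex conjugation is available. The point of passing
  from X to Z is rigidity: the Euler field has the eigenvalue r in degree r, and r = 1 only for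
  linear functions, so a solution of Z f = f with f(0) = 0 is determined by its linear part. The
  term -{f, g} turns the eigenvalue 1 + 1 of a bracket back into 1, so the solutions are closed
  under the bracket and form a copy of the Lie algebra. This takes the place of the cohomology
  vanishing by which Poisson structures with semisimple linear part are usually linearized.\<close>

abbreviation lin :: "('k::field ^ 'n \<Rightarrow> 'k ^ 'm) \<Rightarrow> bool"
  where "lin \<equiv> Vector_Spaces.linear (*s) (*s)"

lemmas lin_add = vec.linear_add and lin_scale = vec.linear_scale and lin_0 = vec.linear_0
  and lin_diff = vec.linear_diff and lin_neg = vec.linear_neg

lemma lin_iff:
  "lin f \<longleftrightarrow> (\<forall>u v. f (u + v) = f u + f v) \<and> (\<forall>a v. f (a *s v) = a *s f v)"
  by (simp add: Vector_Spaces.linear_iff vec.vector_space_axioms)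

lemma subspace_contains_axes:
  fixes S :: "('k::field ^ 'n::finite) set"
  assumes "vec.subspace S" "\<And>i. axis i 1 \<in> S"
  shows "v \<in> S"
proof -
  have "(\<Sum>i\<in>UNIV. v $ i *s axis i 1) \<in> S"
    using assms by (intro vec.subspace_sum vec.subspace_scale) auto
  then show ?thesis by (simp add: basis_expansion)
qed

section \<open>Polynomials in a linear operator\<close>

text \<open>Horner evaluation of p(T)v. \<open>poly\<close> expects its argument in the coefficient
  ring, which an operator is not.\<close>

definition op_poly :: "('k::field ^ 'n \<Rightarrow> 'k ^ 'n) \<Rightarrow> 'k poly \<Rightarrow> 'k ^ 'n \<Rightarrow> 'k ^ 'n"
  where "op_poly T p v = fold_coeffs (\<lambda>a w. a *s v + T w) p 0"

context
  fixes T :: "'k::field ^ 'n::finite \<Rightarrow> 'k ^ 'n"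
  assumes T: "lin T"
begin

lemma op_poly_0 [simp]: "op_poly T 0 v = 0"
  by (simp add: op_poly_def)

lemma op_poly_pCons [simp]: "op_poly T (pCons a p) v = a *s v + T (op_poly T p v)"
  by (cases "p = 0 \<and> a = 0") (auto simp: op_poly_def lin_0[OF T])

lemma op_poly_const: "op_poly T [:a:] v = a *s v"
  by (simp add: lin_0[OF T])

lemma op_poly_1 [simp]: "op_poly T 1 v = v"
  using op_poly_const[of 1] by (simp add: one_pCons)

lemma op_poly_add: "op_poly T (p + q) v = op_poly T p v + op_poly T q v"
  by (induction p q rule: poly_induct2) (auto simp: lin_add[OF T] vec.scale_left_distrib)

lemma op_poly_smult: "op_poly T (smult a p) v = a *s op_poly T p v"
  by (induction p) (auto simp: lin_scale[OF T] vec.scale_right_distrib)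

lemma op_poly_diff: "op_poly T (p - q) v = op_poly T p v - op_poly T q v"
  using op_poly_add[of "p - q" q v] by simp

lemma lin_op_poly: "lin (op_poly T p)"
proof (induction p)
  case 0
  show ?case by (simp add: lin_iff)
next
  case (pCons a p)
  then show ?case
    using T by (simp add: lin_iff vec.scale_right_distrib vector_add_ldistrib)
qed

lemma op_poly_mult: "op_poly T (p * q) v = op_poly T p (op_poly T q v)"
  by (induction p) (auto simp: op_poly_add op_poly_smult)

lemma op_poly_dvd:
  assumes "p dvd q" "op_poly T p v = 0"
  shows "op_poly T q v = 0"
proof -
  obtain r where "q = r * p" using assms(1) by (metis dvdE mult.commute)
  then show ?thesis using assms(2) by (simp add: op_poly_mult lin_0[OF lin_op_poly])
qed

lemma op_poly_root: "op_poly T [:-l, 1:] v = T v - l *s v"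
  by (simp add: lin_0[OF T])

text \<open>The n + 1 vectors v, Tv, ..., T^n v of an n-dimensional space are linearly
  dependent.\<close>

lemma op_poly_annihilator:
  obtains q where "q \<noteq> 0" "op_poly T q v = 0"
proof -
  define f where "f = (\<lambda>i. op_poly T (monom 1 i) v)"
  let ?n = "CARD('n)"
  show ?thesis
  \<comment> \<open>\<open>vec.dependent\<close> speaks of a set and does not see repeated vectors;
    two equal powers give the annihilator \<open>monom 1 i - monom 1 j\<close> directly.\<close>
  proof (cases "inj_on f {..?n}")
    case False
    then obtain i j where ij: "i \<noteq> j" "f i = f j" by (auto simp: inj_on_def)
    show ?thesis
    proof
      show "monom 1 i - monom (1::'k) j \<noteq> 0"
        using ij(1) by (metis eq_iff_diff_eq_0 monom_eq_iff' one_neq_zero)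
      show "op_poly T (monom 1 i - monom 1 j) v = 0"
        using ij(2) by (simp add: op_poly_diff f_def)
    qed
  next
    case True
    have "vec.dependent (f ` {..?n})"
    proof (rule ccontr)
      assume "vec.independent (f ` {..?n})"
      then have "card (f ` {..?n}) \<le> ?n"
        using vec.independent_card_le_dim[of "f ` {..?n}" UNIV] by (simp add: vec.dim_UNIV card_cart_basis)
      then show False using True by (simp add: card_image)
    qed
    then obtain u b where u: "(\<Sum>w\<in>f ` {..?n}. u w *s w) = 0" "b \<in> f ` {..?n}" "u b \<noteq> 0"
      by (auto simp: vec.dependent_finite)
    define q where "q = (\<Sum>i\<le>?n. monom (u (f i)) i)"
    have sum: "op_poly T (\<Sum>i\<in>A. monom (u (f i)) i) v = (\<Sum>i\<in>A. u (f i) *s f i)" if "finite A" for A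
      using that
    proof induction
      case (insert i A)
      have "monom (u (f i)) i = smult (u (f i)) (monom 1 i)" by (simp add: smult_monom)
      then have "op_poly T (monom (u (f i)) i) v = u (f i) *s f i"
        by (simp only: op_poly_smult f_def)
      then show ?case using insert by (simp add: op_poly_add)
    qed simp
    obtain i where i: "i \<le> ?n" "b = f i" using u(2) by auto
    have "coeff q i = u (f i)"
      using i by (simp add: q_def coeff_sum)
    then have "q \<noteq> 0" using u(3) i by auto
    moreover have "op_poly T q v = 0"
      using u(1) sum[of "{..?n}"] sum.reindex[OF True, of "\<lambda>w. u w *s w"] by (simp add: q_def)
    ultimately show ?thesis using that by blast
  qed
qed

end

section \<open>Congruences modulo powers of linear factors\<close>

text \<open>Hensel lifting: if \<open>a * Q - 1\<close> equals (x - l)^N s, subtracting (x - l)^N c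
  from \<open>a\<close> replaces s by s - cQ, and the constant c = s(l)/Q(l) makes this vanish at
  l.\<close>

lemma inverse_mod_linear_power:
  fixes Q :: "'k::field poly"
  assumes "poly Q l \<noteq> 0"
  shows "\<exists>a. [:-l, 1:] ^ N dvd a * Q - 1"
proof (induction N)
  case (Suc N)
  then obtain a s where s: "a * Q - 1 = [:-l, 1:] ^ N * s" by (auto elim: dvdE)
  define c where "c = [:poly s l / poly Q l:]"
  have "poly (s - c * Q) l = 0" using assms by (simp add: c_def)
  then have "[:-l, 1:] dvd s - c * Q" using poly_eq_0_iff_dvd by blast
  moreover have "(a - [:-l, 1:] ^ N * c) * Q - 1 = [:-l, 1:] ^ N * (s - c * Q)"
    using s by (simp add: algebra_simps)
  ultimately have "[:-l, 1:] ^ Suc N dvd (a - [:-l, 1:] ^ N * c) * Q - 1"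
    by (simp add: mult.commute mult_dvd_mono del: mult_pCons_left mult_pCons_right)
  then show ?case by blast
qed auto

lemma poly_prod_linear_neq_0:
  fixes S :: "'k::field set"
  assumes "finite S" "l \<notin> S"
  shows "poly (\<Prod>\<nu>\<in>S. [:-\<nu>, 1:] ^ M) l \<noteq> 0"
  using assms by (auto simp: poly_prod)

text \<open>Chinese remaindering, one node at a time. Q vanishes to order M at the old nodes and
  \<open>a * Q\<close> is 1 to order M at the new node l, so the correction
  \<open>a * Q * ([:f l:] - p)\<close> repairs p at l and disturbs nothing else. The order M makes
  p(T) a scalar on generalized eigenspaces, not only on eigenvectors.\<close>

lemma hermite_interpolation:
  fixes S :: "'k::field set"
  assumes "finite S"
  shows "\<exists>p. \<forall>\<nu>\<in>S. [:-\<nu>, 1:] ^ M dvd p - [:f \<nu>:]"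
  using assms
proof induction
  case (insert l S)
  then obtain p where p: "\<forall>\<nu>\<in>S. [:-\<nu>, 1:] ^ M dvd p - [:f \<nu>:]" by auto
  define Q where "Q = (\<Prod>\<nu>\<in>S. [:-\<nu>, 1:] ^ M)"
  obtain a where a: "[:-l, 1:] ^ M dvd a * Q - 1"
    using inverse_mod_linear_power poly_prod_linear_neq_0[OF insert(1,2)] unfolding Q_def by blast
  define p' where "p' = p + a * Q * ([:f l:] - p)"
  have "p' - [:f l:] = (a * Q - 1) * ([:f l:] - p)"
    unfolding p'_def by (simp only: algebra_simps mult_1_left)
  then have "[:-l, 1:] ^ M dvd p' - [:f l:]" using a by (metis dvd_mult2)
  moreover have "[:-\<nu>, 1:] ^ M dvd p' - [:f \<nu>:]" if "\<nu> \<in> S" for \<nu>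
  proof -
    have "[:-\<nu>, 1:] ^ M dvd Q" unfolding Q_def using that insert(1) by (rule dvd_prodI[rotated])
    then have "[:-\<nu>, 1:] ^ M dvd a * Q * ([:f l:] - p)" by (metis dvd_mult dvd_mult2)
    moreover have "p' - [:f \<nu>:] = (p - [:f \<nu>:]) + a * Q * ([:f l:] - p)"
      unfolding p'_def by (simp only: algebra_simps)
    ultimately show ?thesis using p that by (metis dvd_add)
  qed
  ultimately show ?case by (intro exI[of _ p']) auto
qed auto

text \<open>The exponent is kept as a parameter because exponents add up under a Lie
  bracket.\<close>

definition gen_eigenspace :: "('k::field ^ 'n \<Rightarrow> 'k ^ 'n) \<Rightarrow> nat \<Rightarrow> 'k \<Rightarrow> ('k ^ 'n) set"
  where "gen_eigenspace T N l = {v. op_poly T ([:-l, 1:] ^ N) v = 0}"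

text \<open>Primary decomposition. With \<open>a * Q\<close> congruent to 1 modulo (x - l)^N, the
  component w = (aQ)(T)v is killed by (T - l)^N, while w - v is killed by Q(T) and falls under the
  induction hypothesis.\<close>

lemma gen_eigenspace_span:
  fixes T :: "'k::field ^ 'n::finite \<Rightarrow> 'k ^ 'n"
  assumes T: "lin T" and "finite S" "op_poly T (\<Prod>l\<in>S. [:-l, 1:] ^ N) v = 0"
  shows "v \<in> vec.span (\<Union>l\<in>S. gen_eigenspace T N l)"
  using assms(2,3)
proof (induction S arbitrary: v)
  case empty
  then show ?case by (simp add: T)
next
  case (insert l S)
  define Q where "Q = (\<Prod>l\<in>S. [:-l, 1:] ^ N)"
  obtain a where a: "[:-l, 1:] ^ N dvd a * Q - 1"
    using inverse_mod_linear_power poly_prod_linear_neq_0[OF insert(1,2)] unfolding Q_def by blast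
  define w where "w = op_poly T (a * Q) v"
  have v: "op_poly T ([:-l, 1:] ^ N * Q) v = 0"
    using insert by (simp add: Q_def)
  have "op_poly T ([:-l, 1:] ^ N * (a * Q)) v = 0"
    by (rule op_poly_dvd[OF T _ v]) (simp add: mult.left_commute)
  then have "w \<in> gen_eigenspace T N l"
    by (simp add: gen_eigenspace_def w_def op_poly_mult[OF T])
  then have w: "w \<in> vec.span (\<Union>l\<in>insert l S. gen_eigenspace T N l)"
    by (intro vec.span_base) auto
  have "op_poly T (Q * (a * Q - 1)) v = 0"
    by (rule op_poly_dvd[OF T _ v]) (use a in \<open>simp add: mult.commute mult_dvd_mono\<close>)
  then have "op_poly T Q (w - v) = 0"
    by (simp add: w_def op_poly_mult[OF T] op_poly_diff[OF T] T)
  then have wv: "w - v \<in> vec.span (\<Union>l\<in>S. gen_eigenspace T N l)"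
    using insert.IH by (simp add: Q_def)
  have "vec.span (\<Union>l\<in>S. gen_eigenspace T N l)
      \<subseteq> vec.span (\<Union>l\<in>insert l S. gen_eigenspace T N l)"
    by (rule vec.span_mono) auto
  then have "w - (w - v) \<in> vec.span (\<Union>l\<in>insert l S. gen_eigenspace T N l)"
    using vec.span_diff[OF w] wv by blast
  then show ?case by simp
qed

section \<open>Triangular bases and traces\<close>

definition tr :: "('k::field ^ 'n::finite \<Rightarrow> 'k ^ 'n) \<Rightarrow> 'k"
  where "tr f = (\<Sum>i\<in>UNIV. f (axis i 1) $ i)"

lemma tr_matrix: "tr f = trace (matrix f)"
  by (simp add: tr_def trace_def matrix_def)

lemma tr_comp_commute:
  assumes "lin f" "lin g"
  shows "tr (\<lambda>v. f (g v)) = tr (\<lambda>v. g (f v))"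
  using matrix_compose_gen[OF assms] matrix_compose_gen[OF assms(2,1)] 
  by (simp add: tr_matrix o_def) (metis trace_mul_sym)

lemma tr_add: "tr (\<lambda>v. f v + g v) = tr f + tr g"
  by (simp add: tr_def sum.distrib)

lemma tr_diff: "tr (\<lambda>v. f v - g v) = tr f - tr g"
  by (simp add: tr_def sum_subtractf)

lemma tr_neg: "tr (\<lambda>v. - f v) = - tr f"
  by (simp add: tr_def sum_negf)

lemma tr_scale: "tr (\<lambda>v. a *s f v) = a * tr f"
  by (simp add: tr_def sum_distrib_left)

text \<open>The trace does not depend on the basis, and only diagonal coefficients enter it. They
  are given modulo the span of the other basis vectors, which is what a triangular form
  supplies.\<close>

lemma tr_basis:
  fixes f :: "'k::field ^ 'n::finite \<Rightarrow> 'k ^ 'n"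
  assumes f: "lin f" and b: "vec_basis b"
    and d: "\<And>i. f (b i) - d i *s b i \<in> vec.span (b ` (UNIV - {i}))"
  shows "tr f = (\<Sum>i\<in>UNIV. d i)"
proof -
  have "\<exists>c. f (b i) = (\<Sum>j\<in>UNIV. c j *s b j) \<and> c i = d i" for i
  proof -
    have "inj_on b (UNIV - {i})" using b by (auto simp: vec_basis_def inj_def inj_on_def)
    moreover obtain u where "f (b i) - d i *s b i = (\<Sum>v\<in>b ` (UNIV - {i}). u v *s v)"
      using d[of i] by (auto simp: vec.span_finite)
    ultimately have "f (b i) = d i *s b i + (\<Sum>j\<in>UNIV - {i}. u (b j) *s b j)"
      by (simp add: sum.reindex algebra_simps)
    also have "\<dots> = (\<Sum>j\<in>UNIV. (if j = i then d i else u (b j)) *s b j)"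
      by (subst (2) sum.remove[of _ i]) (auto intro!: sum.cong)
    finally show ?thesis by (intro exI[of _ "\<lambda>j. if j = i then d i else u (b j)"]) simp
  qed
  then obtain c where c: "\<And>i. f (b i) = (\<Sum>j\<in>UNIV. c i j *s b j)" "\<And>i. c i i = d i"
    by metis
  \<comment> \<open>Q has the basis vectors as columns and R is the matrix of f in the basis, so
    \<open>matrix f\<close> is conjugate to R.\<close>
  define Q where "Q = (\<chi> i j. b j $ i)"
  define R where "R = (\<chi> i j. c j i)"
  have cols: "columns Q = range b"
    by (auto simp: columns_def column_def Q_def)
  then have "invertible Q"
    using b by (simp add: invertible_right_inverse matrix_right_invertible_span_columns vec_basis_def)
  then obtain Q' where Q': "Q ** Q' = mat 1" "Q' ** Q = mat 1"
    by (auto simp: invertible_def)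
  have "matrix f ** Q = Q ** R"
  proof (simp add: vec_eq_iff, intro allI)
    fix i j
    have "(matrix f ** Q) $ i $ j = (matrix f *v b j) $ i"
      by (simp add: matrix_matrix_mult_def matrix_vector_mult_def Q_def)
    also have "\<dots> = f (b j) $ i" by (simp add: matrix_works[OF f])
    also have "\<dots> = (Q ** R) $ i $ j"
      by (simp add: c(1) matrix_matrix_mult_def Q_def R_def mult.commute)
    finally show "(matrix f ** Q) $ i $ j = (Q ** R) $ i $ j" .
  qed
  then have "matrix f = Q ** R ** Q'"
    by (metis Q'(1) matrix_mul_assoc matrix_mul_rid)
  then have "tr f = trace (Q' ** (Q ** R))"
    by (metis tr_matrix trace_mul_sym)
  also have "\<dots> = trace R" by (simp add: matrix_mul_assoc Q')
  also have "\<dots> = (\<Sum>i\<in>UNIV. d i)" by (simp add: trace_def R_def c)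
  finally show ?thesis .
qed

text \<open>A flag written as a list: each head is an eigenvector modulo the span of its tail, so
  the spans of the tails are invariant subspaces. The second components are the diagonal entries,
  that is, eigenvalues with multiplicity.\<close>

fun triangular :: "('k::field ^ 'n \<Rightarrow> 'k ^ 'n) \<Rightarrow> (('k ^ 'n) \<times> 'k) list \<Rightarrow> bool" where
  "triangular T [] \<longleftrightarrow> True"
| "triangular T ((v, l) # vs) \<longleftrightarrow> triangular T vs \<and> v \<notin> vec.span (fst ` set vs) \<and>
     T v - l *s v \<in> vec.span (fst ` set vs)"

lemma triangular_independent:
  assumes "triangular T vs"
  shows "vec.independent (fst ` set vs) \<and> distinct (map fst vs)"
  using assms
proof (induction vs)
  case (Cons p vs)
  obtain v l where "p = (v, l)" by force
  then show ?case
    using Cons by (auto simp: vec.independent_insert intro: vec.span_base)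
qed (auto simp: vec.independent_empty)

lemma triangular_invariant:
  assumes "lin T" "triangular T vs" "w \<in> vec.span (fst ` set vs)"
  shows "T w \<in> vec.span (fst ` set vs)"
  using assms(2,3)
proof (induction vs arbitrary: w)
  case Nil
  then show ?case by (simp add: lin_0[OF assms(1)])
next
  case (Cons p vs)
  obtain v l where p: "p = (v, l)" by force
  let ?U = "vec.span (fst ` set vs)" and ?W = "vec.span (insert v (fst ` set vs))"
  have sub: "?U \<subseteq> ?W" by (rule vec.span_mono) auto
  obtain k where "w - k *s v \<in> ?U"
    using Cons.prems(2) by (auto simp: p vec.span_insert)
  then have "T (w - k *s v) \<in> ?W" using Cons sub p by auto
  moreover have "T v \<in> ?W"
  proof -
    have "T v - l *s v \<in> ?W" using Cons sub p by auto
    moreover have "l *s v \<in> ?W" by (simp add: vec.span_base vec.span_scale)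
    ultimately show ?thesis by (metis vec.span_add diff_add_cancel)
  qed
  ultimately have "T (w - k *s v) + k *s T v \<in> ?W"
    by (intro vec.span_add vec.span_scale)
  then show ?case
    by (simp add: p lin_diff[OF assms(1)] lin_scale[OF assms(1)])
qed

lemma op_poly_invariant:
  assumes "lin T" "vec.subspace W" "\<And>w. w \<in> W \<Longrightarrow> T w \<in> W" "v \<in> W"
  shows "op_poly T p v \<in> W"
  using assms by (induction p) (auto simp: vec.subspace_0 intro: vec.subspace_add vec.subspace_scale)

text \<open>p - p(l) is divisible by x - l, so the difference is q(T) applied to T v - l v, and W is
  invariant under T.\<close>

lemma op_poly_eigen_mod:
  assumes "lin T" "vec.subspace W" "\<And>w. w \<in> W \<Longrightarrow> T w \<in> W" "T v - l *s v \<in> W"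
  shows "op_poly T p v - poly p l *s v \<in> W"
proof -
  obtain q where q: "p - [:poly p l:] = [:-l, 1:] * q"
    using poly_eq_0_iff_dvd[of "p - [:poly p l:]" l] by (auto elim: dvdE)
  have "op_poly T p v - poly p l *s v = op_poly T (p - [:poly p l:]) v"
    by (simp add: op_poly_diff[OF assms(1)] op_poly_const[OF assms(1)] assms(1) lin_0[OF assms(1)])
  also have "\<dots> = op_poly T q (T v - l *s v)"
    unfolding q by (simp only: mult.commute[of _ q] op_poly_mult[OF assms(1)] op_poly_root[OF assms(1)])
  also have "\<dots> \<in> W" using op_poly_invariant assms by blast
  finally show ?thesis .
qed

lemma triangular_op_poly:
  assumes "lin T" "triangular T vs"
  shows "triangular (op_poly T p) (map (\<lambda>(v, l). (v, poly p l)) vs)"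
  using assms(2)
proof (induction vs)
  case (Cons a vs)
  obtain v l where a: "a = (v, l)" by force
  have im: "fst ` set (map (\<lambda>(v, l). (v, poly p l)) vs) = fst ` set vs"
    by force
  have "op_poly T p v - poly p l *s v \<in> vec.span (fst ` set vs)"
    using Cons.prems a triangular_invariant[OF assms(1)]
    by (intro op_poly_eigen_mod[OF assms(1)]) (auto simp: vec.subspace_span)
  then show ?case using Cons a im by (auto simp del: set_map)
qed simp

lemma triangular_tr:
  fixes f :: "'k::field ^ 'n::finite \<Rightarrow> 'k ^ 'n"
  assumes f: "lin f" and t: "triangular f vs" and span: "vec.span (fst ` set vs) = UNIV"
  shows "tr f = (\<Sum>p\<leftarrow>vs. snd p)"
proof -
  have ind: "vec.independent (fst ` set vs)" and dist: "distinct (map fst vs)"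
    using triangular_independent[OF t] by auto
  have "card (fst ` set vs) = vec.dim (UNIV :: ('k ^ 'n) set)"
    using vec.dim_eq_card[of "fst ` set vs" UNIV] span ind by simp
  then have len: "length vs = CARD('n)"
    using dist by (metis vec.dim_UNIV card_cart_basis distinct_card length_map set_map)
  obtain e :: "'n \<Rightarrow> nat" where e: "bij_betw e UNIV {..<CARD('n)}"
    using ex_bij_betw_finite_nat[OF finite_class.finite_UNIV] by (metis atLeast0LessThan)
  define b where "b = (\<lambda>i. fst (vs ! e i))"
  have elt: "e i < length vs" for i using e len by (auto simp: bij_betw_def)
  have b_eq: "b i = map fst vs ! e i" for i by (simp add: b_def elt)
  have rb: "range b = fst ` set vs"
  proof -
    have "range b = (!) (map fst vs) ` range e" by (auto simp: b_eq)
    also have "range e = {..<length vs}" using e len by (simp add: bij_betw_def)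
    also have "(!) (map fst vs) ` {..<length vs} = set (map fst vs)"
      unfolding set_conv_nth[of "map fst vs"] by (auto simp del: nth_map)
    finally show ?thesis by simp
  qed
  have inj: "inj b"
    using dist e elt by (auto simp: inj_def b_eq nth_eq_iff_index_eq bij_betw_def simp del: nth_map)
  have "tr f = (\<Sum>i\<in>UNIV. snd (vs ! e i))"
  proof (rule tr_basis[OF f])
    show "vec_basis b" using inj rb ind span by (simp add: vec_basis_def)
    fix i
    \<comment> \<open>The entry at position \<open>e i\<close> is an eigenvector modulo the entries
      behind it, and these are among the other basis vectors.\<close>
    have drop: "triangular f (drop k vs)" for k
      using t
    proof (induction vs arbitrary: k)
      case (Cons p vs)
      then show ?case by (cases p; cases k) auto
    qed simp
    have "drop (e i) vs = vs ! e i # drop (Suc (e i)) vs"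
      using elt by (simp add: Cons_nth_drop_Suc)
    moreover obtain v l where vl: "vs ! e i = (v, l)" by force
    ultimately have "f v - l *s v \<in> vec.span (fst ` set (drop (Suc (e i)) vs))"
      using drop[of "e i"] by simp
    moreover have "fst ` set (drop (Suc (e i)) vs) \<subseteq> b ` (UNIV - {i})"
    proof -
      have "set (drop (Suc (e i)) vs) \<subseteq> set vs" by (rule set_drop_subset)
      moreover have "b i \<notin> fst ` set (drop (Suc (e i)) vs)"
      proof -
        have "distinct (map fst (drop (e i) vs))" using dist by (simp flip: drop_map)
        then show ?thesis
          using \<open>drop (e i) vs = _\<close> by (simp add: b_def)
      qed
      ultimately show ?thesis
      proof (intro subsetI)
        fix w assume w: "w \<in> fst ` set (drop (Suc (e i)) vs)"
        then have "w \<in> range b" using rb \<open>set (drop (Suc (e i)) vs) \<subseteq> set vs\<close> by blast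
        then show "w \<in> b ` (UNIV - {i})" using w \<open>b i \<notin> _\<close> by blast
      qed
    qed
    ultimately have "f v - l *s v \<in> vec.span (b ` (UNIV - {i}))"
      by (meson vec.span_mono subsetD)
    then show "f (b i) - snd (vs ! e i) *s b i \<in> vec.span (b ` (UNIV - {i}))"
      by (simp add: b_def vl)
  qed
  also have "\<dots> = (\<Sum>k<length vs. snd (vs ! k))"
    using sum.reindex_bij_betw[OF e, of "\<lambda>k. snd (vs ! k)"] len by simp
  also have "\<dots> = (\<Sum>p\<leftarrow>vs. snd p)"
    by (simp add: sum_list_sum_nth atLeast0LessThan)
  finally show ?thesis .
qed

text \<open>An eigenvector in the quotient by W, found without forming the quotient. Choose q of
  least degree with q(T)v in W for some v outside W; it has a complex root l. Writing q = (x - l) r,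
  minimality puts r(T)v outside W, and this is the eigenvector.\<close>

lemma eigenvector_mod_subspace:
  fixes T :: "complex ^ 'n::finite \<Rightarrow> complex ^ 'n"
  assumes T: "lin T" and W: "vec.subspace W" "W \<noteq> UNIV"
  obtains v l where "v \<notin> W" "T v - l *s v \<in> W"
proof -
  define Q where "Q = (\<lambda>d. \<exists>q v. q \<noteq> 0 \<and> degree q = d \<and> v \<notin> W \<and> op_poly T q v \<in> W)"
  obtain v0 where v0: "v0 \<notin> W" using W by auto
  obtain q0 where "q0 \<noteq> 0" "op_poly T q0 v0 = 0" by (rule op_poly_annihilator[OF T])
  then have "Q (degree q0)" unfolding Q_def using v0 vec.subspace_0[OF W(1)] by metis
  then have "Q (LEAST d. Q d)" by (rule LeastI)
  then obtain q v where q: "q \<noteq> 0" "degree q = (LEAST d. Q d)" "v \<notin> W" "op_poly T q v \<in> W"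
    unfolding Q_def by blast
  have "degree q \<noteq> 0"
  proof
    assume "degree q = 0"
    then obtain c where "q = [:c:]" by (metis degree_eq_zeroE)
    then have "c *s v \<in> W" "c \<noteq> 0" using q by (auto simp: T lin_0[OF T])
    then have "inverse c *s (c *s v) \<in> W" using vec.subspace_scale W by blast
    then show False using q(3) \<open>c \<noteq> 0\<close> by simp
  qed
  then have "\<not> constant (poly q)" by (simp add: constant_degree)
  then obtain l where "poly q l = 0" using fundamental_theorem_of_algebra by blast
  then obtain r where r: "q = [:-l, 1:] * r" by (auto simp: poly_eq_0_iff_dvd elim: dvdE)
  have r0: "r \<noteq> 0" using q r by auto
  have "degree q = Suc (degree r)" using r0 degree_mult_eq[of "[:-l, 1:]" r] by (simp only: r) simp
  then have "\<not> Q (degree r)" using q(2) not_less_Least by (metis lessI)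
  then have "op_poly T r v \<notin> W" using r0 q(3) unfolding Q_def by blast
  moreover have "T (op_poly T r v) - l *s op_poly T r v \<in> W"
    using q(4) unfolding r by (simp only: op_poly_mult[OF T] op_poly_root[OF T])
  ultimately show ?thesis using that by blast
qed

text \<open>A longest triangular list exists because its vectors are independent; if it did not
  span, an eigenvector modulo its span could be put in front.\<close>

lemma triangular_exists:
  fixes T :: "complex ^ 'n::finite \<Rightarrow> complex ^ 'n"
  assumes T: "lin T"
  obtains vs where "triangular T vs" "vec.span (fst ` set vs) = UNIV"
proof -
  have bound: "length vs \<le> CARD('n)" if "triangular T vs" for vs
  proof -
    have "card (fst ` set vs) \<le> CARD('n)"
      using triangular_independent[OF that] vec.independent_card_le_dim[of "fst ` set vs" UNIV]
      by (simp add: vec.dim_UNIV card_cart_basis)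
    then show ?thesis
      using triangular_independent[OF that] by (metis distinct_card length_map set_map)
  qed
  define L where "L = length ` {vs. triangular T vs}"
  have "finite L" "0 \<in> L"
    using bound by (auto simp: L_def finite_nat_set_iff_bounded_le intro!: image_eqI[of _ _ "[]"])
  then have "Max L \<in> L" by (intro Max_in) auto
  then obtain vs where vs: "triangular T vs" "length vs = Max L" by (auto simp: L_def)
  have "vec.span (fst ` set vs) = UNIV"
  proof (rule ccontr)
    assume "vec.span (fst ` set vs) \<noteq> UNIV"
    then obtain v l where "v \<notin> vec.span (fst ` set vs)" "T v - l *s v \<in> vec.span (fst ` set vs)"
      using eigenvector_mod_subspace[OF T vec.subspace_span] by blast
    then have "triangular T ((v, l) # vs)" using vs by simp
    then have "Suc (length vs) \<in> L" unfolding L_def by (intro image_eqI[of _ _ "(v, l) # vs"]) auto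
    then show False using vs(2) \<open>finite L\<close> Max_ge Suc_n_not_le_n by metis
  qed
  then show ?thesis using that vs by blast
qed

text \<open>Cayley-Hamilton for a flag: T - l maps the span of the list into the span of its
  tail.\<close>

lemma triangular_annihilator:
  assumes T: "lin T" and "triangular T vs" "w \<in> vec.span (fst ` set vs)"
  shows "op_poly T (\<Prod>p\<leftarrow>vs. [:- snd p, 1:]) w = 0"
  using assms(2,3)
proof (induction vs arbitrary: w)
  case (Cons a vs)
  obtain v l where a: "a = (v, l)" by force
  have "T w - l *s w \<in> vec.span (fst ` set vs)"
  proof -
    obtain k where k: "w - k *s v \<in> vec.span (fst ` set vs)"
      using Cons.prems(2) by (auto simp: a vec.span_insert)
    have "T (w - k *s v) \<in> vec.span (fst ` set vs)"
      using triangular_invariant[OF T _ k] Cons a by simp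
    moreover have "T w - l *s w = T (w - k *s v) - l *s (w - k *s v) + k *s (T v - l *s v)"
      by (simp add: lin_diff[OF T] lin_scale[OF T] vec.scale_right_diff_distrib mult.commute)
    moreover have "T v - l *s v \<in> vec.span (fst ` set vs)" using Cons.prems a by simp
    ultimately show ?thesis using k by (metis vec.span_add vec.span_diff vec.span_scale)
  qed
  then have "op_poly T (\<Prod>p\<leftarrow>vs. [:- snd p, 1:]) (op_poly T [:-l, 1:] w) = 0"
    using Cons a op_poly_root[OF T] by (simp only: triangular.simps)
  moreover have "(\<Prod>p\<leftarrow>a # vs. [:- snd p, 1:]) = (\<Prod>p\<leftarrow>vs. [:- snd p, 1:]) * [:-l, 1:]"
    unfolding a list.map prod_list.Cons snd_conv by (rule mult.commute)
  ultimately show ?case by (simp only: op_poly_mult[OF T])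
qed (simp add: T)

section \<open>Lie algebras\<close>

definition nilpotent_op :: "('k::field ^ 'n \<Rightarrow> 'k ^ 'n) \<Rightarrow> bool"
  where "nilpotent_op T \<longleftrightarrow> (\<exists>N. \<forall>v. (T ^^ N) v = 0)"

locale lie_algebra =
  fixes br :: "('k::field, 'n::finite) bracket"
  assumes lin_br: "lin (br x)"
    and lin_br_left: "lin (\<lambda>x. br x y)"
    and alternating: "br x x = 0"
    and jacobi: "br x (br y z) = br (br x y) z + br y (br x z)"
begin

lemma br_right:
  "br x (u + v) = br x u + br x v" "br x (a *s u) = a *s br x u" "br x 0 = 0"
  "br x (u - v) = br x u - br x v" "br x (- u) = - br x u"
  using lin_br[of x] by (auto simp: lin_add lin_scale lin_0 lin_diff lin_neg)

lemma br_left: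
  "br (u + v) x = br u x + br v x" "br (a *s u) x = a *s br u x" "br 0 x = 0"
  "br (u - v) x = br u x - br v x" "br (- u) x = - br u x"
  using lin_add[OF lin_br_left[of x]] lin_scale[OF lin_br_left[of x]] lin_0[OF lin_br_left[of x]]
    lin_diff[OF lin_br_left[of x]] lin_neg[OF lin_br_left[of x]] by auto

lemma skew: "br x y = - br y x"
proof -
  have "br x y + br y x = br (x + y) (x + y)"
    by (simp add: br_left(1) br_right(1) alternating[of x] alternating[of y])
  then show ?thesis by (simp add: alternating eq_neg_iff_add_eq_0)
qed

lemma br_br: "br (br x y) z = br x (br y z) - br y (br x z)"
  by (simp add: jacobi[of x y z])

definition derivation :: "('k ^ 'n \<Rightarrow> 'k ^ 'n) \<Rightarrow> bool"
  where "derivation D \<longleftrightarrow> lin D \<and> (\<forall>u v. D (br u v) = br (D u) v + br u (D v))"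

lemma derivation_ad: "derivation (br x)"
  unfolding derivation_def using jacobi lin_br by blast

definition killing :: "'k ^ 'n \<Rightarrow> 'k ^ 'n \<Rightarrow> 'k"
  where "killing x y = tr (\<lambda>v. br x (br y v))"

definition killing_radical :: "('k ^ 'n) set"
  where "killing_radical = {x. \<forall>z. killing x z = 0}"

lemma killing_linear:
  "killing (x + y) z = killing x z + killing y z" "killing (a *s x) z = a * killing x z"
  "killing z (x + y) = killing z x + killing z y" "killing z (a *s x) = a * killing z x"
  "killing 0 z = 0" "killing z 0 = 0"
  by (simp_all add: killing_def br_left br_right tr_add tr_scale) (simp_all add: tr_def)

lemma lin_br_br: "lin (\<lambda>v. br x (br y v))"
  by (simp add: lin_iff br_right)

text \<open>The Killing form is invariant, K([u,v], z) = K(v, [z,u]), by expanding ad [u,v] and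
  rotating one trace.\<close>

lemma lie_ideal_killing_radical: "lie_ideal br killing_radical"
proof -
  have "killing (br u v) z = killing v (br z u)" for u v z
  proof -
    have "killing (br u v) z = tr (\<lambda>w. br u (br v (br z w))) - tr (\<lambda>w. br v (br u (br z w)))"
      by (simp add: killing_def br_br tr_diff)
    also have "tr (\<lambda>w. br u (br v (br z w))) = tr (\<lambda>w. br v (br z (br u w)))"
      by (rule tr_comp_commute[OF lin_br lin_br_br])
    also have "\<dots> - tr (\<lambda>w. br v (br u (br z w))) = killing v (br z u)"
      by (simp add: killing_def br_br br_right flip: tr_diff)
    finally show ?thesis .
  qed
  then show ?thesis
    by (auto simp: lie_ideal_def killing_radical_def vec.subspace_def killing_linear)
qed

text \<open>For a derivation, (T - l - m)[u,v] = [(T - l)u, v] + [u, (T - m)v], and each summand has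
  a smaller exponent sum. Exponent 0 forces the vector to be 0, which starts the induction.\<close>

lemma gen_eigenspace_bracket:
  assumes T: "derivation T"
    and "u \<in> gen_eigenspace T M l" "v \<in> gen_eigenspace T N m"
  shows "br u v \<in> gen_eigenspace T (M + N) (l + m)"
  using assms(2,3)
proof (induction "M + N" arbitrary: M N u v)
  case 0
  then show ?case using T by (simp add: gen_eigenspace_def derivation_def br_left)
next
  case (Suc n)
  have lin: "lin T" using T by (simp add: derivation_def)
  have step: "w \<in> gen_eigenspace T (Suc k) a \<longleftrightarrow> T w - a *s w \<in> gen_eigenspace T k a" for w k a
    unfolding gen_eigenspace_def mem_Collect_eq power_Suc2
    by (simp only: op_poly_mult[OF lin] op_poly_root[OF lin])
  have zero: "w \<in> gen_eigenspace T 0 a \<longleftrightarrow> w = 0" for w a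
    by (simp add: gen_eigenspace_def lin)
  show ?case
  proof (cases "M = 0 \<or> N = 0")
    case True
    then have "br u v = 0" using Suc.prems zero br_left(3) br_right(3) by metis
    then show ?thesis by (simp add: gen_eigenspace_def lin_0[OF lin_op_poly[OF lin]])
  next
    case False
    then obtain M' N' where MN: "M = Suc M'" "N = Suc N'" by (metis not0_implies_Suc)
    have "br (T u - l *s u) v \<in> gen_eigenspace T (M' + N) (l + m)"
      using Suc.hyps(2) Suc.prems step MN by (intro Suc.hyps(1)) auto
    moreover have "br u (T v - m *s v) \<in> gen_eigenspace T (M + N') (l + m)"
      using Suc.hyps(2) Suc.prems step MN by (intro Suc.hyps(1)) auto
    ultimately have "br (T u - l *s u) v + br u (T v - m *s v) \<in> gen_eigenspace T n (l + m)"
      using Suc.hyps(2) MN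
      by (simp add: gen_eigenspace_def lin_add[OF lin_op_poly[OF lin]])
    moreover have "T (br u v) - (l + m) *s br u v = br (T u - l *s u) v + br u (T v - m *s v)"
      using T by (simp add: derivation_def br_left br_right vec.scale_left_distrib)
    ultimately have "br u v \<in> gen_eigenspace T (Suc n) (l + m)" by (simp add: step)
    then show ?thesis using Suc.hyps(2) by simp
  qed
qed

end

section \<open>Nilpotency from vanishing traces\<close>

text \<open>Each linear factor divides the product over A, so one copy of that product per list
  entry is enough. This brings the annihilator of a flag into the form with distinct nodes and a
  common exponent that \<open>gen_eigenspace_span\<close> expects.\<close>

lemma prod_list_linear_dvd:
  fixes A :: "'k::field set"
  assumes "finite A" "snd ` set vs \<subseteq> A"
  shows "(\<Prod>p\<leftarrow>vs. [:- snd p, 1:]) dvd (\<Prod>l\<in>A. [:-l, 1:] ^ length vs)"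
  using assms(2)
proof (induction vs)
  case (Cons p vs)
  have "[:- snd p, 1:] dvd (\<Prod>l\<in>A. [:-l, 1:])"
    using Cons.prems assms(1) by (intro dvd_prodI) auto
  then have "[:- snd p, 1:] * (\<Prod>p\<leftarrow>vs. [:- snd p, 1:])
      dvd (\<Prod>l\<in>A. [:-l, 1:]) * (\<Prod>l\<in>A. [:-l, 1:] ^ length vs)"
    using Cons by (intro mult_dvd_mono) auto
  then show ?case by (simp only: list.map prod_list.Cons list.size power_Suc prod.distrib Suc_eq_plus1[symmetric] add_Suc_right add_0_right)
qed simp

text \<open>
  With \<open>p\<close> interpolating \<open>cnj\<close> on the spectrum (with multiplicities), \<open>y = p(T)\<close> acts as \<open>cnj \<lambda>\<close> on the
  generalized eigenspace of \<open>\<lambda>\<close>. It is a derivation since \<open>cnj\<close> is additive, and the trace of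
  \<open>T y\<close> is \<open>\<Sum>\<bar>\<lambda>\<bar>\<^sup>2\<close>.
\<close>

lemma (in lie_algebra) derivation_op_poly:
  assumes T: "derivation T" and fin: "finite S"
    and span: "\<And>v. v \<in> vec.span (\<Union>l\<in>S. gen_eigenspace T N l)"
    and p: "\<And>\<nu>. \<nu> \<in> S \<union> (\<lambda>(a, b). a + b) ` (S \<times> S) \<Longrightarrow> [:-\<nu>, 1:] ^ (N + N) dvd p - [:f \<nu>:]"
    and f: "\<And>a b. f (a + b) = f a + f b"
  shows "derivation (op_poly T p)"
proof -
  have lin: "lin T" using T by (simp add: derivation_def)
  define y where "y = op_poly T p"
  have liny: "lin y" unfolding y_def by (rule lin_op_poly[OF lin])
  have y: "y w = f \<nu> *s w"
    if "\<nu> \<in> S \<union> (\<lambda>(a, b). a + b) ` (S \<times> S)" "M \<le> N + N" "w \<in> gen_eigenspace T M \<nu>" for w \<nu> M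
  proof -
    have "[:-\<nu>, 1:] ^ M dvd p - [:f \<nu>:]"
      by (rule dvd_trans[OF le_imp_power_dvd[OF that(2)] p[OF that(1)]])
    then have "op_poly T (p - [:f \<nu>:]) w = 0"
      by (rule op_poly_dvd[OF lin _ that(3)[unfolded gen_eigenspace_def mem_Collect_eq]])
    then show ?thesis
      by (simp add: op_poly_diff[OF lin] y_def lin lin_0[OF lin])
  qed
  have "y (br u v) = br (y u) v + br u (y v)" for u v
  proof -
    define P where "P = (\<lambda>u v. y (br u v) = br (y u) v + br u (y v))"
    \<comment> \<open>The bracket lies in the generalized eigenspace of l + m with exponent N + N.
      Hence p must interpolate at sums of eigenvalues as well and to that order; sums that are not
      eigenvalues call for no separate case.\<close>
    have 1: "P u v" if "l \<in> S" "m \<in> S" "u \<in> gen_eigenspace T N l" "v \<in> gen_eigenspace T N m" for u v l m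
    proof -
      have "y (br u v) = f (l + m) *s br u v"
        using that by (intro y[OF _ _ gen_eigenspace_bracket[OF T]]) auto
      moreover have "y u = f l *s u" "y v = f m *s v" using that y[of l N u] y[of m N v] by auto
      ultimately show ?thesis by (simp add: P_def f br_left br_right vec.scale_left_distrib)
    qed
    have "vec.subspace {u. P u v}" for v
      by (auto simp: vec.subspace_def P_def lin_add[OF liny] lin_scale[OF liny] lin_0[OF liny]
          br_left br_right vec.scale_right_distrib)
    then have 2: "P u v" if "m \<in> S" "v \<in> gen_eigenspace T N m" for u v m
      using vec.span_induct[OF span[of u], of "\<lambda>u. P u v"] 1 that by blast
    have "vec.subspace {v. P u v}"
      by (auto simp: vec.subspace_def P_def lin_add[OF liny] lin_scale[OF liny] lin_0[OF liny]
          br_left br_right vec.scale_right_distrib)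
    then have "P u v"
      using vec.span_induct[OF span[of v], of "P u"] 2 by blast
    then show ?thesis by (simp add: P_def)
  qed
  then show ?thesis using liny by (simp add: derivation_def y_def)
qed

lemma op_poly_X_power:
  assumes "lin T"
  shows "op_poly T ([:0, 1:] ^ N) v = (T ^^ N) v"
  by (induction N arbitrary: v) (auto simp: assms lin_0[OF assms])

text \<open>The test derivation y = p(T) turns the hypothesis into a vanishing sum of squared
  moduli, so every eigenvalue is 0 and the annihilator of the flag is a power of x. Conjugation
  plays the part of the rational linear functional on eigenvalues in the usual proof of Cartan's
  criterion.\<close>

lemma nilpotent_of_trace_derivations:
  fixes br :: "(complex, 'n::finite) bracket"
  assumes "lie_algebra br" and T: "lie_algebra.derivation br T"
    and tr0: "\<And>y. lie_algebra.derivation br y \<Longrightarrow> tr (\<lambda>v. T (y v)) = 0"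
  shows "nilpotent_op T"
proof -
  interpret lie_algebra br by fact
  have lin: "lin T" using T by (simp add: derivation_def)
  obtain vs where vs: "triangular T vs" "vec.span (fst ` set vs) = UNIV"
    by (rule triangular_exists[OF lin])
  define N where "N = length vs"
  define S where "S = snd ` set vs"
  have finS: "finite (S \<union> (\<lambda>(a, b). a + b) ` (S \<times> S))" by (simp add: S_def)
  have ann: "op_poly T (\<Prod>p\<leftarrow>vs. [:- snd p, 1:]) v = 0" for v
    using triangular_annihilator[OF lin vs(1)] vs(2) by simp
  have span: "v \<in> vec.span (\<Union>l\<in>S. gen_eigenspace T N l)" for v
    unfolding N_def
    by (rule gen_eigenspace_span[OF lin _ op_poly_dvd[OF lin prod_list_linear_dvd ann]])
      (auto simp: S_def)
  obtain p where p: "\<forall>\<nu>\<in>S \<union> (\<lambda>(a, b). a + b) ` (S \<times> S). [:-\<nu>, 1:] ^ (N + N) dvd p - [:cnj \<nu>:]"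
    using hermite_interpolation[of "S \<union> (\<lambda>(a, b). a + b) ` (S \<times> S)" "N + N" cnj] finS by blast
  have "derivation (op_poly T p)"
    by (rule derivation_op_poly[OF T _ span, where f = cnj]) (use p in \<open>auto simp: S_def\<close>)
  then have "tr (\<lambda>v. T (op_poly T p v)) = 0" by (rule tr0)
  \<comment> \<open>T p(T) is the polynomial x p(x) in T, so its trace is the sum of l p(l) along
    the same flag.\<close>
  moreover have "(\<lambda>v. T (op_poly T p v)) = op_poly T ([:0, 1:] * p)"
    by (simp add: op_poly_mult[OF lin] lin_0[OF lin] lin fun_eq_iff)
  moreover have "tr (op_poly T ([:0, 1:] * p)) = (\<Sum>q\<leftarrow>map (\<lambda>(v, l). (v, poly ([:0, 1:] * p) l)) vs. snd q)"
    by (rule triangular_tr[OF lin_op_poly[OF lin] triangular_op_poly[OF lin vs(1)]])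
      (use vs(2) in \<open>simp add: image_image case_prod_beta\<close>)
  ultimately have "(\<Sum>q\<leftarrow>vs. snd q * poly p (snd q)) = 0"
    by (simp add: o_def case_prod_beta)
  moreover have "poly p l = cnj l" if "l \<in> S" for l
  proof -
    have "N \<noteq> 0" using that by (auto simp: N_def S_def)
    then have "[:-l, 1:] dvd p - [:cnj l:]"
      using dvd_trans[OF dvd_power[of "N + N" "[:-l, 1:]"]] p that by auto
    then have "poly (p - [:cnj l:]) l = 0" using poly_eq_0_iff_dvd by blast
    then show ?thesis by simp
  qed
  then have "(\<Sum>q\<leftarrow>vs. snd q * poly p (snd q)) = (\<Sum>q\<leftarrow>vs. complex_of_real ((cmod (snd q))\<^sup>2))"
    by (intro arg_cong[of _ _ sum_list] map_cong) (auto simp: S_def complex_norm_square[symmetric] simp del: of_real_power)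
  also have "\<dots> = complex_of_real (\<Sum>q\<leftarrow>vs. (cmod (snd q))\<^sup>2)"
    by (induction vs) auto
  ultimately have "(\<Sum>q\<leftarrow>vs. (cmod (snd q))\<^sup>2) = 0" by (metis of_real_eq_0_iff)
  then have "\<forall>q\<in>set vs. snd q = 0"
    by (subst (asm) sum_list_nonneg_eq_0_iff) auto
  then have "map (\<lambda>p. [:- snd p, 1:]) vs = map (\<lambda>p. [:0, 1:]) vs" by simp
  then have "(\<Prod>p\<leftarrow>vs. [:- snd p, 1:]) = [:0, 1:] ^ N"
    by (simp add: map_replicate_const N_def del: map_eq_conv)
  then have "(T ^^ N) v = 0" for v using ann[of v] op_poly_X_power[OF lin] by metis
  then show ?thesis by (auto simp: nilpotent_op_def)
qed

subsection \<open>Engel's theorem\<close>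

lemma max_dim_exists:
  fixes S :: "('k::field ^ 'n::finite) set"
  assumes "P S"
  obtains M where "P M" "\<And>S'. P S' \<Longrightarrow> vec.dim S' \<le> vec.dim M"
proof -
  have "vec.dim S' \<le> CARD('n)" for S' :: "('k ^ 'n) set"
    using vec.dim_subset[of S' UNIV] by (simp add: vec.dim_UNIV card_cart_basis)
  then have "\<exists>M. P M \<and> (\<forall>S'. P S' \<longrightarrow> vec.dim S' \<le> vec.dim M)"
    using ex_has_greatest_nat[of P S vec.dim "Suc CARD('n)"] assms by (simp add: less_Suc_eq_le)
  then show ?thesis using that by blast
qed

lemma dim_insert_gt:
  fixes N :: "('k::field ^ 'n::finite) set"
  assumes "vec.subspace N" "x \<notin> N"
  shows "vec.dim N < vec.dim (vec.span (insert x N))"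
proof -
  have "x \<notin> vec.span N" using assms by (metis vec.span_eq_iff)
  then show ?thesis by (simp add: vec.dim_insert)
qed

lemma span_insert_subspace:
  fixes N :: "('k::field ^ 'n::finite) set"
  assumes "vec.subspace N"
  shows "v \<in> vec.span (insert x N) \<longleftrightarrow> (\<exists>a. v - a *s x \<in> N)"
  unfolding vec.span_insert vec.span_eq_iff[THEN iffD2, OF assms] by simp

context lie_algebra
begin

lemma lie_subalgebraD:
  assumes "lie_subalgebra br L"
  shows "vec.subspace L" "\<And>u v. u \<in> L \<Longrightarrow> v \<in> L \<Longrightarrow> br u v \<in> L"
  using assms by (auto simp: lie_subalgebra_def)

text \<open>The pair W, U stands for the module U/W, with both spaces inside the Lie algebra. This
  form lets the induction hypothesis be used twice for a maximal proper subalgebra N: on L/N, to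
  find x normalizing N with L = N + Kx, and on U/W, to find vectors that N sends into W. The latter
  form an x-invariant space, and nilpotency of ad x finds one there that x also sends into
  W.\<close>

lemma engel:
  assumes "lie_subalgebra br L" "\<And>x. x \<in> L \<Longrightarrow> nilpotent_op (br x)"
    and "vec.subspace U" "vec.subspace W" "W \<subset> U"
    and "\<And>x u. x \<in> L \<Longrightarrow> u \<in> U \<Longrightarrow> br x u \<in> U" "\<And>x w. x \<in> L \<Longrightarrow> w \<in> W \<Longrightarrow> br x w \<in> W"
  shows "\<exists>u\<in>U - W. \<forall>x\<in>L. br x u \<in> W"
  using assms
proof (induction "vec.dim L" arbitrary: L U W rule: less_induct)
  case less
  note L = lie_subalgebraD[OF less.prems(1)]
  show ?case
  proof (cases "L = {0}")
    case True
    obtain u where "u \<in> U - W" using less.prems(5) by blast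
    moreover have "\<forall>x\<in>L. br x u \<in> W" using True br_left(3) vec.subspace_0[OF less.prems(4)] by simp
    ultimately show ?thesis by blast
  next
    case False
    have "lie_subalgebra br {0} \<and> {0} \<subset> L"
    proof
      show "lie_subalgebra br {0}"
        unfolding lie_subalgebra_def using br_left(3)[of 0] vec.subspace_single_0 by simp
      show "{0} \<subset> L" using False vec.subspace_0[OF L(1)] by blast
    qed
    then obtain N where N: "lie_subalgebra br N" "N \<subset> L"
      and max: "\<And>N'. lie_subalgebra br N' \<and> N' \<subset> L \<Longrightarrow> vec.dim N' \<le> vec.dim N"
    proof -
      assume *: "\<And>N. lie_subalgebra br N \<Longrightarrow> N \<subset> L
        \<Longrightarrow> (\<And>N'. lie_subalgebra br N' \<and> N' \<subset> L \<Longrightarrow> vec.dim N' \<le> vec.dim N) \<Longrightarrow> thesis"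
      show thesis
        by (rule max_dim_exists[of "\<lambda>N. lie_subalgebra br N \<and> N \<subset> L" "{0}", OF \<open>_ \<and> _\<close>])
          (elim conjE, rule *)
    qed
    note sN = lie_subalgebraD[OF N(1)]
    have dim: "vec.dim N < vec.dim L"
      using N(2) L(1) sN(1) by (intro vec.dim_psubset) (metis vec.span_eq_iff)
    have NL: "x \<in> L" if "x \<in> N" for x using that N by blast
    obtain x where x: "x \<in> L" "x \<notin> N" "\<And>n. n \<in> N \<Longrightarrow> br n x \<in> N"
    proof -
      have "\<exists>u\<in>L - N. \<forall>x\<in>N. br x u \<in> N"
        by (rule less.hyps[OF dim N(1) less.prems(2) L(1) sN(1) N(2)]) (auto intro: NL L sN)
      then show ?thesis using that by blast
    qed
    let ?N' = "vec.span (insert x N)"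
    have sub: "lie_subalgebra br ?N'"
      unfolding lie_subalgebra_def
    proof (intro conjI ballI)
      fix u v assume "u \<in> ?N'" "v \<in> ?N'"
      then obtain a b where ab: "u - a *s x \<in> N" "v - b *s x \<in> N"
        by (auto simp: span_insert_subspace[OF sN(1)])
      have "br u v = br (u - a *s x) (v - b *s x) + b *s br (u - a *s x) x - a *s br (v - b *s x) x"
        by (simp add: br_left br_right alternating skew[of x v])
      also have "\<dots> \<in> N"
        by (rule vec.subspace_diff[OF sN(1) vec.subspace_add[OF sN(1) sN(2)[OF ab]]])
          (rule vec.subspace_scale[OF sN(1) x(3)], fact)+
      finally show "br u v \<in> ?N'" by (simp add: vec.span_base)
    qed (rule vec.subspace_span)
    have "?N' \<subseteq> L" using N x L by (intro vec.span_minimal) auto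
    then have N'L: "?N' = L"
      using max[of ?N'] sub dim_insert_gt[OF sN(1) x(2)] by (auto simp: psubset_eq)
    let ?U' = "{u\<in>U. \<forall>n\<in>N. br n u \<in> W}"
    obtain u0 where u0: "u0 \<in> ?U'" "u0 \<notin> W"
    proof -
      have "\<exists>u\<in>U - W. \<forall>x\<in>N. br x u \<in> W"
        by (rule less.hyps[OF dim N(1) less.prems(2-5)]) (auto intro: NL less.prems(6,7))
      then show ?thesis using that by blast
    qed
    have inv: "br x u \<in> ?U'" if "u \<in> ?U'" for u
    proof -
      have "br n (br x u) \<in> W" if "n \<in> N" for n
      proof -
        have "br (br n x) u \<in> W" using x(3)[OF that] \<open>u \<in> ?U'\<close> by blast
        moreover have "br x (br n u) \<in> W" using less.prems(7)[OF x(1)] that \<open>u \<in> ?U'\<close> by blast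
        ultimately show ?thesis unfolding jacobi[of n x u] by (rule vec.subspace_add[OF less.prems(4)])
      qed
      moreover have "br x u \<in> U" using that less.prems(6)[OF x(1)] by blast
      ultimately show ?thesis by blast
    qed
    have iter: "(br x ^^ k) u0 \<in> ?U'" for k
    proof (induction k)
      case 0
      show ?case using u0(1) by (simp only: funpow_0)
    next
      case (Suc k)
      show ?case using inv[OF Suc] by (simp only: funpow.simps o_apply)
    qed
    obtain K where "(br x ^^ K) u0 = 0" using less.prems(2)[OF x(1)] unfolding nilpotent_op_def by blast
    then have "(br x ^^ K) u0 \<in> W" using vec.subspace_0[OF less.prems(4)] by (simp only:)
    \<comment> \<open>The last iterate of ad x outside W is the desired vector: x sends it into W,
      and N does so because it stays in \<open>?U'\<close>.\<close>
    then obtain k where k: "(br x ^^ k) u0 \<in> W" "\<And>j. j < k \<Longrightarrow> (br x ^^ j) u0 \<notin> W"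
      using exists_least_iff[of "\<lambda>k. (br x ^^ k) u0 \<in> W"] by metis
    have "k \<noteq> 0" using k(1) u0(2) by (metis funpow_0)
    then obtain j where j: "k = Suc j" by (metis not0_implies_Suc)
    define u where "u = (br x ^^ j) u0"
    have u: "u \<notin> W" "br x u \<in> W" "u \<in> ?U'"
      using k(2)[of j] k(1) iter[of j] by (simp_all only: j u_def funpow.simps o_apply lessI simp_thms)
    have "br y u \<in> W" if "y \<in> L" for y
    proof -
      have "y \<in> ?N'" using that N'L by (simp only:)
      then obtain a where "y - a *s x \<in> N" unfolding span_insert_subspace[OF sN(1)] by (rule exE)
      then have "br (y - a *s x) u \<in> W" using u(3) by blast
      then have "br (y - a *s x) u + a *s br x u \<in> W"
        by (rule vec.subspace_add[OF less.prems(4) _ vec.subspace_scale[OF less.prems(4) u(2)]])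
      then show ?thesis by (simp add: br_left)
    qed
    moreover have "u \<in> U - W" using u by blast
    ultimately show ?thesis by blast
  qed
qed

text \<open>Take a maximal proper ad N-invariant subspace W. Engel's theorem on N/W gives u with
  [N,u] in W; then W + Ku is invariant, hence all of N by maximality, and [N,N] lies in W, contrary
  to perfectness.\<close>

lemma perfect_ad_nilpotent_trivial:
  assumes N: "lie_subalgebra br N" and perfect: "bracket_span br N N = N"
    and nil: "\<And>x. x \<in> N \<Longrightarrow> nilpotent_op (br x)"
  shows "N = {0}"
proof (rule ccontr)
  assume "N \<noteq> {0}"
  note sN = lie_subalgebraD[OF N]
  define P where "P = (\<lambda>W. vec.subspace W \<and> W \<subset> N \<and> (\<forall>x\<in>N. \<forall>w\<in>W. br x w \<in> W))"
  have "P {0}"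
    unfolding P_def
  proof (intro conjI)
    show "{0} \<subset> N" using \<open>N \<noteq> {0}\<close> vec.subspace_0[OF sN(1)] by blast
    show "\<forall>x\<in>N. \<forall>w\<in>{0}. br x w \<in> {0}" using br_right(3) by simp
  qed (rule vec.subspace_single_0)
  then obtain W where W: "P W" and max: "\<And>W'. P W' \<Longrightarrow> vec.dim W' \<le> vec.dim W"
    by (rule max_dim_exists) iprover
  have sW: "vec.subspace W" "W \<subset> N" and invW: "\<And>x w. x \<in> N \<Longrightarrow> w \<in> W \<Longrightarrow> br x w \<in> W"
    using W by (auto simp: P_def)
  obtain u where u: "u \<in> N" "u \<notin> W" "\<And>x. x \<in> N \<Longrightarrow> br x u \<in> W"
    using engel[OF N nil sN(1) sW sN(2) invW] by (metis DiffE)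
  have br_W: "br x v \<in> W" if x: "x \<in> N" and v: "v \<in> vec.span (insert u W)" for x v
  proof -
    obtain a where "v - a *s u \<in> W" using v unfolding span_insert_subspace[OF sW(1)] by (rule exE)
    then have "br x (v - a *s u) + a *s br x u \<in> W"
      by (rule vec.subspace_add[OF sW(1) invW[OF x] vec.subspace_scale[OF sW(1) u(3)[OF x]]])
    then show ?thesis by (simp add: br_right)
  qed
  have "vec.span (insert u W) \<subseteq> N"
    using sW u by (intro vec.span_minimal sN) auto
  moreover have "\<not> P (vec.span (insert u W))"
    using max dim_insert_gt[OF sW(1) u(2)] by (metis not_le)
  ultimately have "vec.span (insert u W) = N"
  proof -
    have "br x w \<in> vec.span (insert u W)" if "x \<in> N" "w \<in> vec.span (insert u W)" for x w
      by (rule vec.span_base) (use br_W[OF that] in blast)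
    then show ?thesis
      using \<open>_ \<subseteq> N\<close> \<open>\<not> P _\<close> vec.subspace_span[of "insert u W"] unfolding P_def by blast
  qed
  then have "bracket_span br N N \<subseteq> W"
    unfolding bracket_span_def by (intro vec.span_minimal sW) (use br_W in blast)
  then show False using perfect sW by auto
qed

end

subsection \<open>Structure constants and extension of scalars\<close>

text \<open>The Lie algebra axioms as polynomial identities in the structure constants, so that a
  field embedding carries them over to the complexification.\<close>

definition lie_constants :: "('n::finite \<Rightarrow> 'n \<Rightarrow> 'n \<Rightarrow> 'k::field) \<Rightarrow> bool"
  where "lie_constants c \<longleftrightarrow> (\<forall>i k. c i i k = 0) \<and> (\<forall>i j k. c i j k = - c j i k) \<and>
    (\<forall>i j k m. (\<Sum>l\<in>UNIV. c j k l * c i l m) =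
      (\<Sum>l\<in>UNIV. c i j l * c l k m) + (\<Sum>l\<in>UNIV. c i k l * c j l m))"

lemma lin_lie_bracket:
  "lin (lie_bracket c x)" "lin (\<lambda>x. lie_bracket c x y)"
  by (simp_all add: lin_iff lie_bracket_def vec_eq_iff algebra_simps sum.distrib sum_distrib_left)

lemma sum_axis:
  fixes g :: "'n::finite \<Rightarrow> 'k::field"
  shows "(\<Sum>i\<in>UNIV. g i * axis a 1 $ i) = g a" "(\<Sum>i\<in>UNIV. axis a 1 $ i * g i) = g a"
proof -
  have "(\<Sum>i\<in>UNIV. g i * axis a 1 $ i) = (\<Sum>i\<in>UNIV. if i = a then g i else 0)"
    by (rule sum.cong) (auto simp: axis_def)
  then show "(\<Sum>i\<in>UNIV. g i * axis a 1 $ i) = g a" by simp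
  then show "(\<Sum>i\<in>UNIV. axis a 1 $ i * g i) = g a" by (simp add: mult.commute)
qed

lemma lie_bracket_axis:
  "lie_bracket c (axis i 1) v = (\<chi> k. \<Sum>j\<in>UNIV. c i j k * v $ j)"
  "lie_bracket c v (axis j 1) = (\<chi> k. \<Sum>i\<in>UNIV. c i j k * v $ i)"
proof -
  have "(\<Sum>a\<in>UNIV. \<Sum>j\<in>UNIV. c a j k * axis i 1 $ a * v $ j) = (\<Sum>j\<in>UNIV. c i j k * v $ j)" for k
  proof -
    have "(\<Sum>a\<in>UNIV. \<Sum>j\<in>UNIV. c a j k * axis i 1 $ a * v $ j)
        = (\<Sum>a\<in>UNIV. (\<Sum>j\<in>UNIV. c a j k * v $ j) * axis i 1 $ a)"
      by (simp add: sum_distrib_left mult_ac)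
    then show ?thesis by (simp only: sum_axis)
  qed
  then show "lie_bracket c (axis i 1) v = (\<chi> k. \<Sum>j\<in>UNIV. c i j k * v $ j)"
    by (simp add: lie_bracket_def)
  show "lie_bracket c v (axis j 1) = (\<chi> k. \<Sum>i\<in>UNIV. c i j k * v $ i)"
    by (simp add: lie_bracket_def sum_axis(1))
qed

lemma lie_bracket_axis_axis: "lie_bracket c (axis i 1) (axis j 1) = (\<chi> k. c i j k)"
  by (simp add: lie_bracket_axis sum_axis)

text \<open>The Jacobi identity is linear in each argument and is extended from the standard basis
  one argument at a time. Alternation is quadratic; skew symmetry makes its solutions a
  subspace.\<close>

lemma lie_algebra_lie_bracket:
  assumes c: "lie_constants c"
  shows "lie_algebra (lie_bracket c)"
proof (rule lie_algebra.intro)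
  let ?br = "lie_bracket c"
  note R = lin_add[OF lin_lie_bracket(1)] lin_scale[OF lin_lie_bracket(1)] lin_0[OF lin_lie_bracket(1)]
    lin_add[OF lin_lie_bracket(2)] lin_scale[OF lin_lie_bracket(2)] lin_0[OF lin_lie_bracket(2)]
  show "lin (?br x)" for x by (rule lin_lie_bracket)
  show "lin (\<lambda>x. ?br x y)" for y by (rule lin_lie_bracket)
  have skew: "?br x y = - ?br y x" for x y
  proof -
    have "(\<Sum>i\<in>UNIV. \<Sum>j\<in>UNIV. c i j k * x $ i * y $ j) = - (\<Sum>j\<in>UNIV. \<Sum>i\<in>UNIV. c j i k * y $ j * x $ i)" for k
    proof (subst sum.swap, unfold sum_negf[symmetric], intro sum.cong refl)
      fix i j
      have "c i j k = - c j i k" using c unfolding lie_constants_def by blast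
      then show "c i j k * x $ i * y $ j = - (c j i k * y $ j * x $ i)" by simp
    qed
    then show ?thesis by (simp add: lie_bracket_def vec_eq_iff)
  qed
  show "?br x x = 0" for x
  proof -
    have "vec.subspace {x. ?br x x = 0}"
      unfolding vec.subspace_def
    proof (intro conjI allI ballI; clarsimp simp: R)
      fix x y assume "?br x x = 0" "?br y y = 0"
      then show "?br x y + ?br y x = 0" using skew[of x y] by (metis add.left_inverse)
    qed
    moreover have "?br (axis i 1) (axis i 1) = 0" for i
    proof -
      have "c i i k = 0" for k using c unfolding lie_constants_def by blast
      then show ?thesis unfolding lie_bracket_axis_axis by (simp add: vec_eq_iff)
    qed
    ultimately show ?thesis using subspace_contains_axes[of "{x. ?br x x = 0}" x] by blast
  qed
  show "?br x (?br y z) = ?br (?br x y) z + ?br y (?br x z)" for x y z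
  proof -
    define P where "P = (\<lambda>x y z. ?br x (?br y z) = ?br (?br x y) z + ?br y (?br x z))"
    have 1: "P (axis i 1) (axis j 1) (axis k 1)" for i j k
    proof -
      have "(\<Sum>l\<in>UNIV. c j k l * c i l m) =
          (\<Sum>l\<in>UNIV. c i j l * c l k m) + (\<Sum>l\<in>UNIV. c i k l * c j l m)" for m
        using c unfolding lie_constants_def by blast
      then show ?thesis
        unfolding P_def lie_bracket_axis by (simp add: vec_eq_iff sum_axis mult.commute)
    qed
    have "vec.subspace {z. P x y z}" "vec.subspace {y. P x y z}" "vec.subspace {x. P x y z}" for x y z
      by (auto simp: vec.subspace_def P_def R vec.scale_right_distrib)
    note sub = this
    have 2: "P (axis i 1) (axis j 1) z" for i j z
      using subspace_contains_axes[OF sub(1), of "axis i 1" "axis j 1" z] 1 by blast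
    have 3: "P (axis i 1) y z" for i y z
      using subspace_contains_axes[OF sub(2), of "axis i 1" z y] 2 by blast
    have "P x y z" using subspace_contains_axes[OF sub(3), of y z x] 3 by blast
    then show ?thesis by (simp only: P_def)
  qed
qed

text \<open>One setting for both ground fields: the inclusion of the reals, or the identity. A
  homomorphism of fields is automatically injective, so vanishing can be checked after
  extension.\<close>

locale scalar_extension =
  fixes \<iota> :: "'k::field \<Rightarrow> complex"
  assumes one: "\<iota> 1 = 1" and add: "\<iota> (a + b) = \<iota> a + \<iota> b" and mult: "\<iota> (a * b) = \<iota> a * \<iota> b"
begin

lemma zero: "\<iota> 0 = 0"
  using add[of 0 0] by simp

lemma neg: "\<iota> (- a) = - \<iota> a"
  using add[of a "- a"] zero by (simp add: eq_neg_iff_add_eq_0 add.commute)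

lemma eq_0_iff: "\<iota> a = 0 \<longleftrightarrow> a = 0"
proof
  assume "\<iota> a = 0"
  show "a = 0"
  proof (rule ccontr)
    assume "a \<noteq> 0"
    then have "\<iota> a * \<iota> (inverse a) = 1" by (simp add: one flip: mult)
    then show False using \<open>\<iota> a = 0\<close> by simp
  qed
qed (simp add: zero)

lemma sum: "\<iota> (\<Sum>i\<in>A. f i) = (\<Sum>i\<in>A. \<iota> (f i))"
  by (induction A rule: infinite_finite_induct) (auto simp: zero add)

lemma of_nat: "\<iota> (of_nat n) = of_nat n"
  by (induction n) (auto simp: zero add one)

definition vec_ext :: "'k ^ 'n \<Rightarrow> complex ^ 'n"
  where "vec_ext v = (\<chi> i. \<iota> (v $ i))"

lemma vec_ext_eq_0: "vec_ext v = 0 \<longleftrightarrow> v = 0"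
  by (simp add: vec_ext_def vec_eq_iff eq_0_iff)

lemma vec_ext_add: "vec_ext (u + v) = vec_ext u + vec_ext v"
  by (simp add: vec_ext_def vec_eq_iff add)

lemma vec_ext_scale: "vec_ext (a *s v) = \<iota> a *s vec_ext v"
  by (simp add: vec_ext_def vec_eq_iff mult)

lemma vec_ext_axis: "vec_ext (axis i 1) = axis i 1"
  by (simp add: vec_ext_def vec_eq_iff axis_def one zero)

lemma vec_ext_lie_bracket:
  "vec_ext (lie_bracket c u v) = lie_bracket (\<lambda>i j k. \<iota> (c i j k)) (vec_ext u) (vec_ext v)"
  by (simp add: vec_ext_def lie_bracket_def vec_eq_iff sum mult)

lemma lie_constants_ext:
  assumes "lie_constants c"
  shows "lie_constants (\<lambda>i j k. \<iota> (c i j k))"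
  unfolding lie_constants_def
proof (intro conjI allI)
  fix i j k m
  have "c i i k = 0" using assms unfolding lie_constants_def by blast
  then show "\<iota> (c i i k) = 0" by (simp add: zero)
  show "\<iota> (c i j k) = - \<iota> (c j i k)" using assms unfolding lie_constants_def by (metis neg)
  have "(\<Sum>l\<in>UNIV. c j k l * c i l m) =
      (\<Sum>l\<in>UNIV. c i j l * c l k m) + (\<Sum>l\<in>UNIV. c i k l * c j l m)"
    using assms unfolding lie_constants_def by blast
  then have "\<iota> (\<Sum>l\<in>UNIV. c j k l * c i l m) =
      \<iota> ((\<Sum>l\<in>UNIV. c i j l * c l k m) + (\<Sum>l\<in>UNIV. c i k l * c j l m))" by simp
  then show "(\<Sum>l\<in>UNIV. \<iota> (c j k l) * \<iota> (c i l m)) =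
      (\<Sum>l\<in>UNIV. \<iota> (c i j l) * \<iota> (c l k m)) + (\<Sum>l\<in>UNIV. \<iota> (c i k l) * \<iota> (c j l m))"
    by (simp add: sum mult add)
qed

lemma nilpotent_ext:
  assumes "nilpotent_op (lie_bracket (\<lambda>i j k. \<iota> (c i j k)) (vec_ext x))"
  shows "nilpotent_op (lie_bracket c x)"
proof -
  let ?brC = "lie_bracket (\<lambda>i j k. \<iota> (c i j k))"
  obtain N where N: "\<And>v. (?brC (vec_ext x) ^^ N) v = 0"
    using assms unfolding nilpotent_op_def by blast
  have "vec_ext ((lie_bracket c x ^^ N) v) = (?brC (vec_ext x) ^^ N) (vec_ext v)" for v
    by (induction N) (simp_all add: vec_ext_lie_bracket)
  then have "(lie_bracket c x ^^ N) v = 0" for v using N by (metis vec_ext_eq_0)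
  then show ?thesis unfolding nilpotent_op_def by blast
qed

section \<open>The Killing form under extension of scalars, and Cartan's criterion\<close>

lemma killing_ext:
  assumes "lie_constants c"
  shows "lie_algebra.killing (lie_bracket (\<lambda>i j k. \<iota> (c i j k))) (vec_ext a) (vec_ext b)
    = \<iota> (lie_algebra.killing (lie_bracket c) a b)"
proof -
  let ?brC = "lie_bracket (\<lambda>i j k. \<iota> (c i j k))"
  interpret lie_algebra "lie_bracket c" using assms by (rule lie_algebra_lie_bracket)
  interpret C: lie_algebra ?brC using lie_constants_ext[OF assms] by (rule lie_algebra_lie_bracket)
  have "?brC (vec_ext a) (?brC (vec_ext b) (axis i 1)) $ i
      = \<iota> (lie_bracket c a (lie_bracket c b (axis i 1)) $ i)" for i
    by (subst vec_ext_axis[symmetric]) (simp add: vec_ext_lie_bracket[symmetric], simp add: vec_ext_def)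
  then show ?thesis by (simp add: killing_def C.killing_def tr_def sum)
qed

text \<open>For a derivation y of the complexification, tr(ad [a,b] y) = -K(a, y b) by rotating a
  trace, and this is 0 for a in the radical. The trace criterion then gives nilpotency over the
  complex numbers, which descends.\<close>

lemma killing_radical_commutator_nilpotent:
  fixes c :: "'n::finite \<Rightarrow> 'n \<Rightarrow> 'n \<Rightarrow> 'k"
  assumes c: "lie_constants c"
    and x: "x \<in> bracket_span (lie_bracket c) (lie_algebra.killing_radical (lie_bracket c))
      (lie_algebra.killing_radical (lie_bracket c))"
  shows "nilpotent_op (lie_bracket c x)"
proof (rule nilpotent_ext)
  let ?brC = "lie_bracket (\<lambda>i j k. \<iota> (c i j k))"
  interpret lie_algebra "lie_bracket c" using c by (rule lie_algebra_lie_bracket)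
  interpret C: lie_algebra ?brC using lie_constants_ext[OF c] by (rule lie_algebra_lie_bracket)
  \<comment> \<open>y b is an arbitrary complex vector, so orthogonality of a is extended from the
    standard basis to all complex vectors.\<close>
  have rad: "C.killing (vec_ext a) w = 0" if "a \<in> killing_radical" for a w
  proof -
    have "vec.subspace {w. C.killing (vec_ext a) w = 0}"
      by (simp add: vec.subspace_def C.killing_linear)
    moreover have "C.killing (vec_ext a) (axis i 1) = 0" for i
      using that killing_ext[OF c, of a "axis i 1"]
      by (simp add: vec_ext_axis killing_radical_def zero)
    ultimately show ?thesis using subspace_contains_axes[of "{w. C.killing (vec_ext a) w = 0}" w] by blast
  qed
  show "nilpotent_op (?brC (vec_ext x))"
  proof (rule nilpotent_of_trace_derivations[OF C.lie_algebra_axioms C.derivation_ad])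
    fix y assume y: "C.derivation y"
    then have lin_y: "lin y" and der_y: "\<And>u v. y (?brC u v) = ?brC (y u) v + ?brC u (y v)"
      unfolding C.derivation_def by blast+
    have comm: "tr (\<lambda>v. ?brC (?brC a b) (y v)) = - C.killing a (y b)" for a b
    proof -
      have "lin (\<lambda>v. ?brC a (y v))"
        by (simp add: lin_iff C.br_right lin_add[OF lin_y] lin_scale[OF lin_y])
      then have "tr (\<lambda>v. ?brC b (?brC a (y v))) = tr (\<lambda>v. ?brC a (y (?brC b v)))"
        by (rule tr_comp_commute[OF C.lin_br])
      then have "tr (\<lambda>v. ?brC (?brC a b) (y v))
          = tr (\<lambda>v. ?brC a (?brC b (y v)) - ?brC a (y (?brC b v)))"
        by (simp only: C.br_br tr_diff)
      also have "(\<lambda>v. ?brC a (?brC b (y v)) - ?brC a (y (?brC b v))) = (\<lambda>v. - ?brC a (?brC (y b) v))"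
        by (simp add: der_y C.br_right)
      finally show ?thesis by (simp only: tr_neg C.killing_def)
    qed
    define S where "S = {z. tr (\<lambda>v. ?brC (vec_ext z) (y v)) = 0}"
    have "tr (\<lambda>v. 0 :: complex ^ 'n) = 0" by (simp add: tr_def)
    moreover have "vec_ext (0 :: 'k ^ 'n) = 0" by (simp add: vec_ext_eq_0)
    ultimately have "vec.subspace S"
      by (simp add: vec.subspace_def S_def vec_ext_add vec_ext_scale C.br_left tr_add tr_scale)
    moreover have "{lie_bracket c u v |u v. u \<in> killing_radical \<and> v \<in> killing_radical} \<subseteq> S"
      by (auto simp: S_def vec_ext_lie_bracket comm rad)
    ultimately have "bracket_span (lie_bracket c) killing_radical killing_radical \<subseteq> S"
      unfolding bracket_span_def by (intro vec.span_minimal)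
    then show "tr (\<lambda>v. ?brC (vec_ext x) (y v)) = 0" using x unfolding S_def by blast
  qed
qed

text \<open>The derived series of the radical decreases and its dimensions attain a minimum, so some
  D m is perfect. Then D m = [D m, D m] lies in the commutator of the radical and consists of
  ad-nilpotent elements, which forces D m = 0. Thus the radical is a solvable ideal.\<close>

lemma killing_radical_trivial:
  fixes c :: "'n::finite \<Rightarrow> 'n \<Rightarrow> 'n \<Rightarrow> 'k"
  assumes c: "lie_constants c" and ss: "lie_semisimple (lie_bracket c)"
  shows "lie_algebra.killing_radical (lie_bracket c) = {0}"
proof -
  let ?br = "lie_bracket c"
  interpret lie_algebra ?br using c by (rule lie_algebra_lie_bracket)
  define D where "D = (\<lambda>m. ((\<lambda>B. bracket_span ?br B B) ^^ m) killing_radical)"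
  have D_0: "D 0 = killing_radical" by (simp add: D_def)
  have D_Suc: "D (Suc m) = bracket_span ?br (D m) (D m)" for m by (simp add: D_def)
  have mono: "bracket_span ?br A A \<subseteq> bracket_span ?br B B" if "A \<subseteq> B" for A B
    unfolding bracket_span_def using that by (intro vec.span_mono) blast
  have rad: "vec.subspace killing_radical" "\<And>u v. v \<in> killing_radical \<Longrightarrow> ?br u v \<in> killing_radical"
    using lie_ideal_killing_radical unfolding lie_ideal_def by blast+
  have sub: "vec.subspace (D m)" for m
    by (cases m) (simp_all add: D_0 D_Suc rad(1) bracket_span_def)
  have dec: "D (Suc m) \<subseteq> D m" for m
  proof (induction m)
    case 0
    show ?case unfolding D_Suc D_0 bracket_span_def by (intro vec.span_minimal rad(1)) (use rad(2) in blast)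
  next
    case (Suc m)
    then show ?case unfolding D_Suc[of "Suc m"] D_Suc[of m] by (rule mono)
  qed
  have le_rad: "D m \<subseteq> killing_radical" for m
  proof (induction m)
    case (Suc m)
    then show ?case using dec[of m] by (rule order_trans[rotated])
  qed (simp add: D_0)
  obtain m where m: "\<And>k. vec.dim (D m) \<le> vec.dim (D k)"
    using ex_has_least_nat[of "\<lambda>_. True" 0 "\<lambda>m. vec.dim (D m)"] by auto
  have perfect: "D (Suc m) = D m"
    by (rule vec.subspace_dim_equal[OF sub sub dec m])
  have "D m = {0}"
  proof (rule perfect_ad_nilpotent_trivial)
    show p: "bracket_span ?br (D m) (D m) = D m" using perfect by (simp only: D_Suc)
    show "lie_subalgebra ?br (D m)"
      unfolding lie_subalgebra_def
    proof (intro conjI ballI sub)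
      fix u v assume "u \<in> D m" "v \<in> D m"
      then have "?br u v \<in> bracket_span ?br (D m) (D m)"
        unfolding bracket_span_def by (intro vec.span_base) blast
      then show "?br u v \<in> D m" by (simp only: p)
    qed
    fix x assume "x \<in> D m"
    then have "x \<in> bracket_span ?br killing_radical killing_radical"
      using p mono[OF le_rad[of m]] by blast
    then show "nilpotent_op (?br x)" by (rule killing_radical_commutator_nilpotent[OF c])
  qed
  then have "lie_solvable ?br killing_radical" unfolding lie_solvable_def D_def by blast
  then show ?thesis using ss lie_ideal_killing_radical unfolding lie_semisimple_def by blast
qed

end

section \<open>Consequences of a nondegenerate Killing form\<close>

context lie_algebra
begin

lemma ad_inj_of_killing:
  assumes "killing_radical = {0}" "\<And>v. br h v = 0"
  shows "h = 0"
proof -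
  have "killing h z = 0" for z by (simp add: killing_def assms(2) tr_def)
  then show ?thesis using assms(1) by (auto simp: killing_radical_def)
qed

text \<open>Nondegeneracy represents z \<mapsto> tr(D ad z) as K(h, z). The derivation E = D - ad h
  then satisfies tr(E ad z) = 0 for all z, and K(E u, v) = tr(E ad [u,v]) = 0 gives E = 0.\<close>

lemma derivation_inner:
  assumes nondeg: "killing_radical = {0}" and D: "derivation D"
  obtains h where "D = br h"
proof -
  have linD: "lin D" and derD: "\<And>u v. D (br u v) = br (D u) v + br u (D v)"
    using D unfolding derivation_def by blast+
  define F where "F = (\<lambda>x. \<chi> j. killing x (axis j 1))"
  have linF: "lin F" by (simp add: lin_iff F_def vec_eq_iff killing_linear)
  have zero: "killing x z = 0" if "\<And>j. killing x (axis j 1) = 0" for x z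
  proof -
    have "vec.subspace {z. killing x z = 0}" by (simp add: vec.subspace_def killing_linear)
    then show ?thesis using subspace_contains_axes[of "{z. killing x z = 0}" z] that by blast
  qed
  have "inj F"
  proof (rule vec.linear_inj_iff_eq_0[OF linF, THEN iffD2], intro allI impI)
    fix x assume "F x = 0"
    then have "killing x z = 0" for z using zero by (simp add: F_def vec_eq_iff)
    then show "x = 0" using nondeg by (auto simp: killing_radical_def)
  qed
  then have "surj F" by (rule vec.linear_inj_imp_surj[OF linF])
  then obtain h where h: "F h = (\<chi> j. tr (\<lambda>v. D (br (axis j 1) v)))" by (metis surjD)
  define E where "E = (\<lambda>v. D v - br h v)"
  have linE: "lin E" by (simp add: lin_iff E_def br_right lin_add[OF linD] lin_scale[OF linD] vec.scale_right_diff_distrib)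
  have derE: "E (br u v) = br (E u) v + br u (E v)" for u v
    by (simp add: E_def derD jacobi[of h u v] br_left br_right)
  have trE: "tr (\<lambda>v. E (br z v)) = 0" for z
  proof -
    define S where "S = {z. tr (\<lambda>v. E (br z v)) = 0}"
    have "vec.subspace S"
      by (simp add: vec.subspace_def S_def br_left lin_add[OF linE] lin_scale[OF linE] lin_0[OF linE]
          tr_add tr_scale) (simp add: tr_def)
    moreover have "axis j 1 \<in> S" for j
      using h by (simp add: S_def E_def tr_diff F_def vec_eq_iff killing_def)
    ultimately show ?thesis using subspace_contains_axes[of S z] unfolding S_def by blast
  qed
  have "E u = 0" for u
  proof -
    have "killing (E u) v = 0" for v
    proof -
      have "tr (\<lambda>w. br u (E (br v w))) = tr (\<lambda>w. E (br v (br u w)))"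
        by (rule tr_comp_commute[OF lin_br])
          (simp add: lin_iff br_right lin_add[OF linE] lin_scale[OF linE])
      then have "killing (E u) v = tr (\<lambda>w. E (br u (br v w)) - E (br v (br u w)))"
        by (simp add: killing_def derE tr_diff tr_add)
      also have "\<dots> = tr (\<lambda>w. E (br (br u v) w))"
        by (simp add: br_br lin_diff[OF linE])
      finally show ?thesis by (simp only: trE)
    qed
    then show ?thesis using nondeg by (auto simp: killing_radical_def)
  qed
  then have "D = br h" by (simp add: E_def fun_eq_iff)
  then show ?thesis by (rule that)
qed

end

section \<open>Formal power series\<close>

abbreviation deg :: "('n::finite \<Rightarrow> nat) \<Rightarrow> nat"
  where "deg m \<equiv> \<Sum>i\<in>UNIV. m i"

lemma mcoeff_simps [simp]:
  "mcoeff 0 m = 0" "mcoeff (f + g) m = mcoeff f m + mcoeff g m"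
  "mcoeff (f - g) m = mcoeff f m - mcoeff g m" "mcoeff (- f) m = - mcoeff f m"
  by (simp_all add: zero_mfps.rep_eq plus_mfps.rep_eq minus_mfps.rep_eq uminus_mfps.rep_eq)

lemma mcoeff_sum [simp]: "mcoeff (\<Sum>i\<in>A. f i) m = (\<Sum>i\<in>A. mcoeff (f i) m)"
  by (induction A rule: infinite_finite_induct) auto

lemma mcoeff_mconst_mult [simp]: "mcoeff (mconst c * f) m = c * mcoeff f m"
proof -
  have "mcoeff (mconst c * f) m = (\<Sum>a | a \<le> m. if a = (\<lambda>_. 0) then c * mcoeff f m else 0)"
    unfolding times_mfps.rep_eq mconst.rep_eq by (rule sum.cong) auto
  also have "\<dots> = c * mcoeff f m"
    using sum.delta[OF finite_exponents_le[of m], of "\<lambda>_. 0" "\<lambda>_. c * mcoeff f m"]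
    by (simp add: le_funI)
  finally show ?thesis .
qed

lemma mcoeff_mvar_mult:
  "mcoeff (mvar i * f) m = (if m i = 0 then 0 else mcoeff f (m(i := m i - 1)))"
proof -
  have "mcoeff (mvar i * f) m = (\<Sum>a | a \<le> m. if a = unit_exp i then mcoeff f (m(i := m i - 1)) else 0)"
    unfolding times_mfps.rep_eq mvar.rep_eq
    by (rule sum.cong) (auto simp: unit_exp_def fun_upd_def intro!: arg_cong[of _ _ "mcoeff f"])
  also have "\<dots> = (if unit_exp i \<le> m then mcoeff f (m(i := m i - 1)) else 0)"
    using sum.delta[OF finite_exponents_le[of m], of "unit_exp i" "\<lambda>_. mcoeff f (m(i := m i - 1))"]
    by simp
  also have "unit_exp i \<le> m \<longleftrightarrow> m i \<noteq> 0"
    by (auto simp: unit_exp_def le_fun_def)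
  finally show ?thesis by simp
qed

lemma mconst_simps:
  "mconst 0 = 0" "mconst 1 = 1" "mconst (a + b) = mconst a + mconst b"
  "mconst (a * b) = mconst a * mconst b" "mconst (- a) = - mconst a"
  "mconst (a - b) = mconst a - mconst b"
proof -
  show "mconst (a * b) = mconst a * mconst b"
    by (rule mfps_eqI) (simp add: mconst.rep_eq)
qed (rule mfps_eqI; simp add: mconst.rep_eq one_mfps.rep_eq)+

lemma mcoeff_mderiv: "mcoeff (mderiv i f) m = of_nat (m i + 1) * mcoeff f (m(i := m i + 1))"
  by (simp add: mderiv.rep_eq)

lemma mderiv_add [simp]: "mderiv i (f + g) = mderiv i f + mderiv i g"
  by (rule mfps_eqI) (simp add: mcoeff_mderiv algebra_simps)

lemma mderiv_diff [simp]: "mderiv i (f - g) = mderiv i f - mderiv i g"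
  by (rule mfps_eqI) (simp add: mcoeff_mderiv algebra_simps)

lemma mderiv_minus [simp]: "mderiv i (- f) = - mderiv i f"
  by (rule mfps_eqI) (simp add: mcoeff_mderiv algebra_simps)

lemma mderiv_0 [simp]: "mderiv i 0 = 0"
  by (rule mfps_eqI) (simp add: mcoeff_mderiv)

lemma mderiv_sum [simp]: "mderiv i (\<Sum>j\<in>A. f j) = (\<Sum>j\<in>A. mderiv i (f j))"
  by (induction A rule: infinite_finite_induct) auto

lemma mderiv_mconst_mult [simp]: "mderiv i (mconst c * f) = mconst c * mderiv i f"
  by (rule mfps_eqI) (simp only: mcoeff_mderiv mcoeff_mconst_mult mult.left_commute)

lemma mderiv_mvar: "mderiv i (mvar j) = (if i = j then 1 else 0)"
proof (rule mfps_eqI)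
  fix m
  have "m(i := m i + 1) = unit_exp j \<longleftrightarrow> i = j \<and> m = (\<lambda>_. 0)"
    by (auto simp: unit_exp_def fun_eq_iff split: if_splits)
  then show "mcoeff (mderiv i (mvar j)) m = mcoeff (if i = j then 1 else 0) m"
    by (auto simp: mcoeff_mderiv mvar.rep_eq one_mfps.rep_eq)
qed

lemma mderiv_commute: "mderiv i (mderiv j f) = mderiv j (mderiv i f)"
proof (cases "i = j")
  case False
  show ?thesis
    by (rule mfps_eqI) (use False in \<open>simp add: mcoeff_mderiv fun_upd_twist[OF False] algebra_simps\<close>)
qed simp

text \<open>With m' = m + e_i, the factor m'_i = a_i + (m'_i - a_i) splits the convolution at m'
  into the two products.\<close>

lemma mderiv_mult:
  fixes f g :: "('k::comm_ring_1, 'n::finite) mfps"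
  shows "mderiv i (f * g) = mderiv i f * g + f * mderiv i g"
proof (rule mfps_eqI)
  fix m :: "'n \<Rightarrow> nat"
  define m' where "m' = m(i := m i + 1)"
  define h where "h = (\<lambda>a. mcoeff f a * mcoeff g (\<lambda>k. m' k - a k))"
  have fin: "finite {a. a \<le> m'}" by (rule finite_exponents_le)
  have "mcoeff (mderiv i (f * g)) m = (\<Sum>a | a \<le> m'. of_nat (m' i) * h a)"
    by (simp add: mcoeff_mderiv times_mfps.rep_eq m'_def h_def sum_distrib_left)
  also have "\<dots> = (\<Sum>a | a \<le> m'. of_nat (a i) * h a + of_nat (m' i - a i) * h a)"
  proof (rule sum.cong)
    fix a assume "a \<in> {a. a \<le> m'}"
    then have "m' i = a i + (m' i - a i)" by (simp add: le_fun_def)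
    then have "(of_nat (m' i) :: 'k) = of_nat (a i) + of_nat (m' i - a i)" by (metis of_nat_add)
    then show "of_nat (m' i) * h a = of_nat (a i) * h a + of_nat (m' i - a i) * h a"
      by (simp add: distrib_right)
  qed simp
  also have "\<dots> = (\<Sum>a | a \<le> m'. of_nat (a i) * h a) + (\<Sum>a | a \<le> m'. of_nat (m' i - a i) * h a)"
    by (rule sum.distrib)
  \<comment> \<open>The weight kills the terms with \<open>a i = 0\<close>; lowering the exponent at
    i by one reindexes the others.\<close>
  also have "(\<Sum>a | a \<le> m'. of_nat (a i) * h a) = (\<Sum>a | a \<le> m' \<and> a i \<noteq> 0. of_nat (a i) * h a)"
    using fin by (intro sum.mono_neutral_right) auto
  also have "\<dots> = (\<Sum>b | b \<le> m. mcoeff (mderiv i f) b * mcoeff g (\<lambda>k. m k - b k))"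
  proof (rule sum.reindex_bij_witness[of _ "\<lambda>b. b(i := b i + 1)" "\<lambda>a. a(i := a i - 1)"])
    fix a assume a: "a \<in> {a. a \<le> m' \<and> a i \<noteq> 0}"
    show "(a(i := a i - 1))(i := (a(i := a i - 1)) i + 1) = a" using a by auto
    show "a(i := a i - 1) \<in> {b. b \<le> m}"
      using a by (auto simp: le_fun_def m'_def split: if_splits)
    have "(\<lambda>k. m k - (a(i := a i - 1)) k) = (\<lambda>k. m' k - a k)"
      using a by (auto simp: m'_def fun_eq_iff)
    then show "mcoeff (mderiv i f) (a(i := a i - 1)) * mcoeff g (\<lambda>k. m k - (a(i := a i - 1)) k)
        = of_nat (a i) * h a"
      using a by (simp add: h_def mcoeff_mderiv mult.assoc flip: of_nat_Suc)
  next
    fix b assume b: "b \<in> {b. b \<le> m}"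
    show "(b(i := b i + 1))(i := (b(i := b i + 1)) i - 1) = b" by auto
    show "b(i := b i + 1) \<in> {a. a \<le> m' \<and> a i \<noteq> 0}"
      using b by (auto simp: le_fun_def m'_def)
  qed
  also have "\<dots> = mcoeff (mderiv i f * g) m" by (simp add: times_mfps.rep_eq)
  \<comment> \<open>An exponent below m' but not below m has \<open>a i = m' i\<close>, hence weight
    0.\<close>
  also have "(\<Sum>a | a \<le> m'. of_nat (m' i - a i) * h a) = (\<Sum>a | a \<le> m. of_nat (m' i - a i) * h a)"
  proof (rule sum.mono_neutral_right[OF fin])
    show "{a. a \<le> m} \<subseteq> {a. a \<le> m'}" by (auto simp: le_fun_def m'_def le_SucI)
    have "a i = m' i" if "a \<le> m'" "\<not> a \<le> m" for a
    proof -
      obtain k where k: "\<not> a k \<le> m k" using \<open>\<not> a \<le> m\<close> by (auto simp: le_fun_def)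
      have ak: "a k \<le> m' k" using that(1) by (auto simp: le_fun_def)
      then have "k = i" using k by (auto simp: m'_def split: if_splits)
      then show ?thesis using k ak by (simp add: m'_def)
    qed
    then have "of_nat (m' i - a i) * h a = 0" if "a \<le> m'" "\<not> a \<le> m" for a
      using that by (metis diff_self_eq_0 mult_zero_left of_nat_0)
    then show "\<forall>a\<in>{a. a \<le> m'} - {a. a \<le> m}. of_nat (m' i - a i) * h a = 0" by blast
  qed
  also have "\<dots> = mcoeff (f * mderiv i g) m"
    unfolding times_mfps.rep_eq
  proof (rule sum.cong)
    fix a assume "a \<in> {a. a \<le> m}"
    then have le: "a k \<le> m k" for k by (simp add: le_fun_def)
    have "(\<lambda>k. m k - a k)(i := m i - a i + 1) = (\<lambda>k. m' k - a k)"
      using le[of i] by (auto simp: m'_def fun_eq_iff)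
    moreover have "m' i - a i = m i - a i + 1" using le[of i] by (simp add: m'_def)
    ultimately show "of_nat (m' i - a i) * h a = mcoeff f a * mcoeff (mderiv i g) (\<lambda>k. m k - a k)"
      by (simp add: h_def mcoeff_mderiv mult_ac)
  qed simp
  finally show "mcoeff (mderiv i (f * g)) m = mcoeff (mderiv i f * g + f * mderiv i g) m" by simp
qed

lemma deg_upd: "deg (m(i := m i + 1)) = deg m + 1"
proof -
  have "deg (m(i := m i + 1)) = (\<Sum>j\<in>UNIV. m j + (if j = i then 1 else 0))"
    by (rule sum.cong) auto
  then show ?thesis by (simp add: sum.distrib)
qed

lemma deg_diff:
  assumes "a \<le> m"
  shows "deg a + deg (\<lambda>i. m i - a i) = deg m"
  using assms by (simp add: le_fun_def flip: sum.distrib)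

lemma deg_eq_0_iff: "deg m = 0 \<longleftrightarrow> m = (\<lambda>_. 0)"
  by (auto simp: fun_eq_iff)

lemma deg_unit_exp: "deg (unit_exp i) = 1"
  by (simp add: unit_exp_def)

lemma deg_eq_1_iff: "deg m = 1 \<longleftrightarrow> (\<exists>i. m = unit_exp i)"
proof
  assume "deg m = 1"
  then obtain i where "m i = 1" "\<forall>j. i \<noteq> j \<longrightarrow> m j = 0"
    using sum_eq_1_iff[of UNIV m] by auto
  then have "m = unit_exp i" by (auto simp: unit_exp_def fun_eq_iff)
  then show "\<exists>i. m = unit_exp i" by blast
qed (auto simp: deg_unit_exp)

lemma unit_exp_eq_iff: "unit_exp i = unit_exp j \<longleftrightarrow> i = j"
  by (auto simp: unit_exp_def fun_eq_iff split: if_splits)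

subsection \<open>Order of vanishing and homogeneous parts\<close>

text \<open>Membership in the r-th power of the maximal ideal, the filtration for all
  degree-by-degree arguments.\<close>

definition vanishing :: "nat \<Rightarrow> ('k::comm_ring_1, 'n::finite) mfps \<Rightarrow> bool"
  where "vanishing r f \<longleftrightarrow> (\<forall>m. deg m < r \<longrightarrow> mcoeff f m = 0)"

definition homogeneous :: "nat \<Rightarrow> ('k::comm_ring_1, 'n::finite) mfps \<Rightarrow> bool"
  where "homogeneous r f \<longleftrightarrow> (\<forall>m. deg m \<noteq> r \<longrightarrow> mcoeff f m = 0)"

lift_definition hom_part :: "nat \<Rightarrow> ('k::comm_ring_1, 'n::finite) mfps \<Rightarrow> ('k, 'n) mfps"
  is "\<lambda>r f m. if (\<Sum>i\<in>UNIV. m i) = r then f m else 0" .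

lemma homogeneous_hom_part: "homogeneous r (hom_part r f)"
  by (simp add: homogeneous_def hom_part.rep_eq)

lemma homogeneous_imp_vanishing: "homogeneous r f \<Longrightarrow> vanishing r f"
  by (auto simp: homogeneous_def vanishing_def)

lemma vanishing_mono: "vanishing r f \<Longrightarrow> s \<le> r \<Longrightarrow> vanishing s f"
  by (auto simp: vanishing_def)

lemma vanishing_1_iff: "vanishing 1 f \<longleftrightarrow> value0 f = 0"
  by (auto simp: vanishing_def deg_eq_0_iff)

lemma vanishing_simps:
  "vanishing r 0" "vanishing r f \<Longrightarrow> vanishing r g \<Longrightarrow> vanishing r (f + g)"
  "vanishing r f \<Longrightarrow> vanishing r g \<Longrightarrow> vanishing r (f - g)"
  "vanishing r f \<Longrightarrow> vanishing r (- f)" "vanishing 0 f"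
  by (simp_all add: vanishing_def)

lemma vanishing_sum: "(\<And>i. i \<in> A \<Longrightarrow> vanishing r (f i)) \<Longrightarrow> vanishing r (\<Sum>i\<in>A. f i)"
  by (simp add: vanishing_def)

lemma vanishing_mult:
  fixes f g :: "('k::comm_ring_1, 'n::finite) mfps"
  assumes "vanishing r f" "vanishing s g"
  shows "vanishing (r + s) (f * g)"
  unfolding vanishing_def
proof (intro allI impI)
  fix m :: "'n \<Rightarrow> nat" assume m: "deg m < r + s"
  have "mcoeff f a * mcoeff g (\<lambda>i. m i - a i) = 0" if "a \<le> m" for a
  proof -
    have "deg a < r \<or> deg (\<lambda>i. m i - a i) < s" using deg_diff[OF that] m by linarith
    then show ?thesis using assms unfolding vanishing_def by auto
  qed
  then show "mcoeff (f * g) m = 0" by (simp add: times_mfps.rep_eq)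
qed

lemma vanishing_mderiv:
  assumes "vanishing (Suc r) f"
  shows "vanishing r (mderiv i f)"
  using assms deg_upd[of _ i] by (simp add: vanishing_def mcoeff_mderiv)

lemma vanishing_all_imp_0: "(\<And>r. vanishing r f) \<Longrightarrow> f = 0"
  by (rule mfps_eqI) (auto simp: vanishing_def)

lemma homogeneous_add: "homogeneous r f \<Longrightarrow> homogeneous r g \<Longrightarrow> homogeneous r (f + g)"
  by (simp add: homogeneous_def)

lemma homogeneous_minus: "homogeneous r f \<Longrightarrow> homogeneous r (- f)"
  by (simp add: homogeneous_def)

lemma homogeneous_sum: "(\<And>i. i \<in> A \<Longrightarrow> homogeneous r (f i)) \<Longrightarrow> homogeneous r (\<Sum>i\<in>A. f i)"
  by (simp add: homogeneous_def)

lemma homogeneous_mconst_mult: "homogeneous r f \<Longrightarrow> homogeneous r (mconst c * f)"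
  by (simp add: homogeneous_def)

lemma homogeneous_mult:
  fixes f g :: "('k::comm_ring_1, 'n::finite) mfps"
  assumes "homogeneous r f" "homogeneous s g"
  shows "homogeneous (r + s) (f * g)"
  unfolding homogeneous_def
proof (intro allI impI)
  fix m :: "'n \<Rightarrow> nat" assume m: "deg m \<noteq> r + s"
  have "mcoeff f a * mcoeff g (\<lambda>i. m i - a i) = 0" if "a \<le> m" for a
  proof -
    have "deg a \<noteq> r \<or> deg (\<lambda>i. m i - a i) \<noteq> s" using deg_diff[OF that] m by linarith
    then show ?thesis using assms unfolding homogeneous_def by auto
  qed
  then show "mcoeff (f * g) m = 0" by (simp add: times_mfps.rep_eq)
qed

lemma homogeneous_mderiv:
  assumes "homogeneous (Suc r) f"
  shows "homogeneous r (mderiv i f)"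
  using assms deg_upd[of _ i] by (simp add: homogeneous_def mcoeff_mderiv)

lemma homogeneous_mvar: "homogeneous 1 (mvar i)"
  by (auto simp: homogeneous_def mvar.rep_eq deg_unit_exp)

lemma homogeneous_linear_function: "homogeneous 1 (linear_function u)"
  unfolding linear_function_def
  by (intro homogeneous_sum homogeneous_mconst_mult homogeneous_mvar)

lemma vanishing_linear_part:
  assumes "value0 f = 0"
  shows "vanishing 2 (f - linear_part f)"
  unfolding vanishing_def
proof (intro allI impI)
  fix m :: "'b \<Rightarrow> nat" assume "deg m < 2"
  then have "deg m = 0 \<or> deg m = 1" by linarith
  then show "mcoeff (f - linear_part f) m = 0"
    using assms by (auto simp: deg_eq_0_iff linear_part.rep_eq simp del: sum_eq_0_iff)
qed

lemma linear_part_eq: "linear_part f = (\<Sum>k\<in>UNIV. mconst (mcoeff f (unit_exp k)) * mvar k)"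
proof (rule mfps_eqI)
  fix m :: "'b \<Rightarrow> nat"
  show "mcoeff (linear_part f) m = mcoeff (\<Sum>k\<in>UNIV. mconst (mcoeff f (unit_exp k)) * mvar k) m"
  proof (cases "deg m = 1")
    case True
    then obtain i where i: "m = unit_exp i" using deg_eq_1_iff by blast
    have "(\<Sum>k\<in>UNIV. mcoeff f (unit_exp k) * (if unit_exp i = unit_exp k then 1 else 0))
        = (\<Sum>k\<in>UNIV. if k = i then mcoeff f (unit_exp k) else 0)"
      by (rule sum.cong) (auto simp: unit_exp_eq_iff)
    then show ?thesis by (simp add: linear_part.rep_eq i deg_unit_exp mvar.rep_eq)
  next
    case False
    then have "m \<noteq> unit_exp k" for k using deg_unit_exp by metis
    then show ?thesis using False by (simp add: linear_part.rep_eq mvar.rep_eq)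
  qed
qed

lemma mcompose_linear_part:
  assumes "\<And>k. value0 (\<phi> k) = 0"
  shows "mcompose (linear_part f) \<phi> = (\<Sum>k\<in>UNIV. mconst (mcoeff f (unit_exp k)) * \<phi> k)"
proof (rule mfps_eqI)
  fix m :: "'a \<Rightarrow> nat"
  let ?t = "\<lambda>k. mcoeff (linear_part f) k * mcoeff (\<Prod>i\<in>UNIV. \<phi> i ^ k i) m"
  have lhs: "mcoeff (mcompose (linear_part f) \<phi>) m = (\<Sum>k | deg k \<le> deg m. ?t k)"
    by (simp add: mcompose_def Abs_mfps_inverse)
  have prod: "(\<Prod>i\<in>UNIV. \<phi> i ^ unit_exp k i) = \<phi> k" for k
  proof -
    have "(\<Prod>i\<in>UNIV. \<phi> i ^ unit_exp k i) = (\<Prod>i\<in>UNIV. if i = k then \<phi> i else 1)"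
      by (rule prod.cong) (auto simp: unit_exp_def)
    then show ?thesis by simp
  qed
  show "mcoeff (mcompose (linear_part f) \<phi>) m
      = mcoeff (\<Sum>k\<in>UNIV. mconst (mcoeff f (unit_exp k)) * \<phi> k) m"
  \<comment> \<open>At m = 0 the truncated sum defining \<open>mcompose\<close> contains no exponent
    of degree 1, so the identity rests on \<phi>(0) = 0. For every other m all of them
    occur.\<close>
  proof (cases "deg m = 0")
    case True
    then have m: "m = (\<lambda>_. 0)" by (simp only: deg_eq_0_iff)
    have "?t k = 0" if "deg k \<le> deg m" for k
      using that True by (simp add: linear_part.rep_eq del: sum_eq_0_iff)
    then show ?thesis unfolding lhs using assms by (simp add: m)
  next
    case False
    have "{k :: 'a \<Rightarrow> nat. deg k \<le> deg m} \<subseteq> {k. k \<le> (\<lambda>_. deg m)}"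
    proof (intro subsetI CollectI le_funI)
      fix k :: "'a \<Rightarrow> nat" and i assume "k \<in> {k. deg k \<le> deg m}"
      moreover have "k i \<le> deg k" by (rule member_le_sum) auto
      ultimately show "k i \<le> deg m" by simp
    qed
    then have "finite {k :: 'a \<Rightarrow> nat. deg k \<le> deg m}"
      by (rule finite_subset[OF _ finite_exponents_le])
    then have "(\<Sum>k | deg k \<le> deg m. ?t k) = (\<Sum>k\<in>range unit_exp. ?t k)"
    proof (rule sum.mono_neutral_right)
      show "range unit_exp \<subseteq> {k. deg k \<le> deg m}"
        using False by (auto simp: deg_unit_exp simp del: sum_eq_0_iff)
      show "\<forall>k\<in>{k. deg k \<le> deg m} - range unit_exp. ?t k = 0"
        using deg_eq_1_iff by (auto simp: linear_part.rep_eq)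
    qed
    also have "\<dots> = (\<Sum>k\<in>UNIV. ?t (unit_exp k))"
      by (rule sum.reindex_cong[of unit_exp]) (auto simp: inj_def unit_exp_eq_iff)
    also have "\<dots> = (\<Sum>k\<in>UNIV. mcoeff f (unit_exp k) * mcoeff (\<phi> k) m)"
      by (simp add: prod linear_part.rep_eq deg_unit_exp)
    finally show ?thesis unfolding lhs by simp
  qed
qed

subsection \<open>Vector fields\<close>

lemma vf_apply_simps [simp]:
  "vf_apply X (f + g) = vf_apply X f + vf_apply X g"
  "vf_apply X (f - g) = vf_apply X f - vf_apply X g"
  "vf_apply X (- f) = - vf_apply X f"
  "vf_apply X 0 = 0"
  by (simp_all add: vf_apply_def algebra_simps sum.distrib sum_subtractf sum_negf)

lemma vf_apply_mconst_mult [simp]: "vf_apply X (mconst c * f) = mconst c * vf_apply X f"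
  by (simp add: vf_apply_def sum_distrib_left mult.left_commute)

lemma vf_apply_sum [simp]: "vf_apply X (\<Sum>j\<in>A. f j) = (\<Sum>j\<in>A. vf_apply X (f j))"
  by (induction A rule: infinite_finite_induct) auto

lemma vf_apply_mult: "vf_apply X (f * g) = vf_apply X f * g + f * vf_apply X g"
  by (simp add: vf_apply_def mderiv_mult algebra_simps sum.distrib sum_distrib_left)

lemma vf_apply_diff_field: "vf_apply (\<lambda>i. X i - Y i) f = vf_apply X f - vf_apply Y f"
  by (simp add: vf_apply_def algebra_simps sum_subtractf)

lemma vf_apply_mvar: "vf_apply X (mvar i) = X i"
proof -
  have "vf_apply X (mvar i) = (\<Sum>j\<in>UNIV. if j = i then X i else 0)"
    unfolding vf_apply_def mderiv_mvar by (rule sum.cong) auto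
  then show ?thesis by simp
qed

lemma vf_apply_linear_function: "vf_apply X (linear_function u) = (\<Sum>i\<in>UNIV. mconst (u $ i) * X i)"
  by (simp add: linear_function_def vf_apply_mvar)

lemma vf_apply_euler: "mcoeff (vf_apply euler_vf f) m = of_nat (deg m) * mcoeff f m"
proof -
  have "mcoeff (mvar i * mderiv i f) m = of_nat (m i) * mcoeff f m" for i
    by (auto simp: mcoeff_mvar_mult mcoeff_mderiv simp flip: of_nat_Suc)
  then show ?thesis by (simp add: vf_apply_def euler_vf_def sum_distrib_right)
qed

lemma vanishing_vf_apply:
  assumes "\<And>i. value0 (X i) = 0" "vanishing r f"
  shows "vanishing r (vf_apply X f)"
proof (cases r)
  case (Suc s)
  have "vanishing (1 + s) (X i * mderiv i f)" for i
    using assms Suc by (intro vanishing_mult vanishing_mderiv) (auto simp: vanishing_1_iff simp del: One_nat_def)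
  then show ?thesis unfolding vf_apply_def Suc by (intro vanishing_sum) auto
qed (simp add: vanishing_simps)

text \<open>X minus its linear part has coefficients of order 2, while a derivative lowers the order
  by only 1. So the leading part of f sees nothing but the linear part of X.\<close>

lemma vanishing_vf_apply_linear_part:
  assumes "\<And>i. value0 (X i) = 0" "vanishing (Suc r) f"
  shows "vanishing (Suc (Suc r)) (vf_apply X f - vf_apply (vf_linear_part X) f)"
proof -
  have "vanishing (2 + r) ((X i - linear_part (X i)) * mderiv i f)" for i
    using assms by (intro vanishing_mult vanishing_mderiv vanishing_linear_part)
  then have "vanishing (2 + r) (vf_apply (\<lambda>i. X i - linear_part (X i)) f)"
    unfolding vf_apply_def by (intro vanishing_sum)
  then show ?thesis by (simp add: vf_apply_diff_field)
qed

text \<open>If the error Y f - f has order n + 2, its leading part is cancelled by a homogeneous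
  term s of degree n + 2. The nonlinear part of Y acts on s only in higher degree, so the new error
  has order n + 3. The solvability in each degree is left as a hypothesis because X and Z meet it
  for different reasons.\<close>

lemma eigenfunction_exists:
  fixes Y :: "('k::comm_ring_1, 'n::finite) vfield"
  assumes Y: "\<And>i. value0 (Y i) = 0"
    and surj: "\<And>r g. r \<ge> 2 \<Longrightarrow> homogeneous r g \<Longrightarrow>
      \<exists>f. homogeneous r f \<and> vf_apply (vf_linear_part Y) f - f = g"
    and f1: "homogeneous 1 f1" "vf_apply (vf_linear_part Y) f1 = f1"
  obtains f where "vanishing 2 (f - f1)" "vf_apply Y f = f"
proof -
  let ?L = "vf_apply (vf_linear_part Y)"
  define E where "E = (\<lambda>f. vf_apply Y f - f)"
  have E_add: "E (f + g) = E f + E g" for f g by (simp add: E_def)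
  have vE: "vanishing r (E f)" if "vanishing r f" for r f
    unfolding E_def using vanishing_vf_apply[of Y, OF Y that] that by (rule vanishing_simps(3))
  have "\<exists>s. homogeneous (n + 2) s \<and> ?L s - s = - hom_part (n + 2) (E f)" for n f
    by (rule surj) (auto intro!: homogeneous_minus homogeneous_hom_part)
  then obtain S where S: "\<And>n f. homogeneous (n + 2) (S n f)"
    "\<And>n f. ?L (S n f) - S n f = - hom_part (n + 2) (E f)" by metis
  define F where "F = rec_nat f1 (\<lambda>n f. f + S n f)"
  have F_0: "F 0 = f1" and F_Suc: "F (Suc n) = F n + S n (F n)" for n by (simp_all add: F_def)
  have EF: "vanishing (n + 2) (E (F n))" for n
  proof (induction n)
    case 0
    have "vanishing 1 f1" by (rule homogeneous_imp_vanishing[OF f1(1)])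
    then show ?case
      using vanishing_vf_apply_linear_part[of Y 0 f1, OF Y] f1(2) by (simp add: F_0 E_def numeral_2_eq_2)
  next
    case (Suc n)
    let ?s = "S n (F n)"
    have "vanishing (n + 2) ?s" by (rule homogeneous_imp_vanishing[OF S(1)])
    then have "vanishing (Suc n + 2) (vf_apply Y ?s - ?L ?s)"
      using vanishing_vf_apply_linear_part[of Y "Suc n" ?s, OF Y] by simp
    moreover have "vanishing (Suc n + 2) (E (F n) - hom_part (n + 2) (E (F n)))"
      using Suc by (auto simp: vanishing_def hom_part.rep_eq)
    moreover have "E (F (Suc n)) = (vf_apply Y ?s - ?L ?s) + (E (F n) - hom_part (n + 2) (E (F n)))"
      using S(2)[of n "F n"] by (simp add: F_Suc E_add) (simp add: E_def algebra_simps)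
    ultimately show ?case by (simp add: vanishing_simps)
  qed
  have F_le: "vanishing (n + 2) (F (n + k) - F n)" for n k
  proof (induction k)
    case (Suc k)
    have "vanishing (n + 2) (S (n + k) (F (n + k)))"
      by (rule vanishing_mono[OF homogeneous_imp_vanishing[OF S(1)]]) simp
    then have "vanishing (n + 2) ((F (n + k) - F n) + S (n + k) (F (n + k)))"
      using Suc by (intro vanishing_simps(2))
    then show ?case by (simp add: F_Suc algebra_simps)
  qed (simp add: vanishing_simps)
  \<comment> \<open>The limit of the approximations: from F d onwards the coefficients of degree d
    no longer change.\<close>
  define f where "f = Abs_mfps (\<lambda>m. mcoeff (F (deg m)) m)"
  have f: "mcoeff f m = mcoeff (F (deg m)) m" for m by (simp add: f_def Abs_mfps_inverse)
  have fF: "vanishing (n + 2) (f - F n)" for n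
    unfolding vanishing_def
  proof (intro allI impI)
    fix m :: "'n \<Rightarrow> nat" assume m: "deg m < n + 2"
    show "mcoeff (f - F n) m = 0"
    proof (cases "deg m \<le> n")
      case True
      then show ?thesis using F_le[of "deg m" "n - deg m"] by (simp add: vanishing_def f)
    next
      case False
      then have "deg m = n + 1" using m by simp
      then show ?thesis using F_le[of n 1] by (simp add: vanishing_def f)
    qed
  qed
  have "vanishing r (E f)" for r
  proof -
    have "E f = E (F r) + E (f - F r)" using E_add[of "F r" "f - F r"] by simp
    then have "vanishing (r + 2) (E f)" using EF vE[OF fF] by (simp add: vanishing_simps)
    then show ?thesis by (rule vanishing_mono) simp
  qed
  then have "E f = 0" by (rule vanishing_all_imp_0)
  then have "vf_apply Y f = f" by (simp add: E_def)
  moreover have "vanishing 2 (f - f1)" using fF[of 0] by (simp only: F_0 add_0)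
  ultimately show ?thesis using that by blast
qed

text \<open>In the lowest possible degree d = n + 2 the equation reads d f_m = f_m, and d - 1 is
  nonzero in characteristic 0; the order of f rises step by step.\<close>

lemma eigenfunction_unique:
  fixes Z :: "('k::field_char_0, 'n::finite) vfield"
  assumes Z: "\<And>i. value0 (Z i) = 0" "vf_linear_part Z = euler_vf"
    and f: "vanishing 2 f" "vf_apply Z f = f"
  shows "f = 0"
proof -
  have "vanishing (n + 2) f" for n
  proof (induction n)
    case 0
    show ?case using f(1) by (simp only: add_0)
  next
    case (Suc n)
    have v: "vanishing (n + 3) (f - vf_apply euler_vf f)"
      using vanishing_vf_apply_linear_part[of Z "Suc n" f, OF Z(1)] Suc f(2) Z(2)
      by (simp add: numeral_3_eq_3)
    show ?case
      unfolding vanishing_def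
    proof (intro allI impI)
      fix m :: "'n \<Rightarrow> nat" assume m: "deg m < Suc n + 2"
      show "mcoeff f m = 0"
      proof (cases "deg m < n + 2")
        case True
        then show ?thesis using Suc by (simp add: vanishing_def)
      next
        case False
        then have d: "deg m = n + 2" using m by simp
        then have "mcoeff f m - of_nat (n + 2) * mcoeff f m = 0"
          using v vf_apply_euler[of f m] by (simp add: vanishing_def)
        moreover have "of_nat (Suc n) * mcoeff f m = - (mcoeff f m - of_nat (n + 2) * mcoeff f m)"
          by (simp add: algebra_simps)
        ultimately have "of_nat (Suc n) * mcoeff f m = 0" by (simp only: minus_zero)
        then show ?thesis by (simp only: mult_eq_0_iff of_nat_neq_0 simp_thms)
      qed
    qed
  qed
  then have "vanishing r f" for r by (rule vanishing_mono[of "r + 2"]) simp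
  then show ?thesis by (rule vanishing_all_imp_0)
qed

text \<open>In degree r the operator to invert is multiplication by r - 1, which is nonzero for r
  \<ge> 2.\<close>

lemma euler_eigenfunction_exists:
  fixes Z :: "('k::field_char_0, 'n::finite) vfield"
  assumes Z: "\<And>i. value0 (Z i) = 0" "vf_linear_part Z = euler_vf" and f1: "homogeneous 1 f1"
  obtains f where "vanishing 2 (f - f1)" "vf_apply Z f = f"
proof (rule eigenfunction_exists[OF Z(1)])
  fix r :: nat and g :: "('k, 'n) mfps" assume r: "r \<ge> 2" and g: "homogeneous r g"
  let ?f = "mconst (1 / (of_nat r - 1)) * g"
  have "vf_apply euler_vf ?f - ?f = g"
  proof (rule mfps_eqI)
    fix m
    have ne: "of_nat r - (1 :: 'k) \<noteq> 0" using r of_nat_eq_1_iff[of r, where 'a = 'k] by auto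
    show "mcoeff (vf_apply euler_vf ?f - ?f) m = mcoeff g m"
    proof (cases "deg m = r")
      case True
      have "(of_nat r - 1) * (1 / (of_nat r - 1) * mcoeff g m) = mcoeff g m" using ne by simp
      then show ?thesis by (simp only: mcoeff_simps vf_apply_euler mcoeff_mconst_mult True left_diff_distrib mult_1_left)
    next
      case False
      then show ?thesis using g by (simp add: homogeneous_def vf_apply_euler del: vf_apply_simps)
    qed
  qed
  then show "\<exists>f. homogeneous r f \<and> vf_apply (vf_linear_part Z) f - f = g"
    using homogeneous_mconst_mult[OF g] unfolding Z(2) by blast
next
  have "vf_apply euler_vf f1 = f1"
  proof (rule mfps_eqI)
    fix m show "mcoeff (vf_apply euler_vf f1) m = mcoeff f1 m"
      using f1 by (cases "deg m = 1") (auto simp: vf_apply_euler homogeneous_def simp del: of_nat_sum)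
  qed
  then show "vf_apply (vf_linear_part Z) f1 = f1" by (simp only: Z(2))
qed (use f1 in auto)

subsection \<open>Poisson brackets\<close>

lemma poisson_bracket_simps:
  "poisson_bracket P (f + g) h = poisson_bracket P f h + poisson_bracket P g h"
  "poisson_bracket P h (f + g) = poisson_bracket P h f + poisson_bracket P h g"
  "poisson_bracket P (f - g) h = poisson_bracket P f h - poisson_bracket P g h"
  "poisson_bracket P h (f - g) = poisson_bracket P h f - poisson_bracket P h g"
  "poisson_bracket P 0 h = 0" "poisson_bracket P h 0 = 0"
  by (simp_all add: poisson_bracket_def algebra_simps sum.distrib sum_subtractf)

lemma poisson_bracket_skew:
  assumes "\<And>i j. P i j = - P j i"
  shows "poisson_bracket P f g = - poisson_bracket P g f"
proof -
  have "poisson_bracket P f g = (\<Sum>j\<in>UNIV. \<Sum>i\<in>UNIV. P i j * mderiv i f * mderiv j g)"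
    unfolding poisson_bracket_def by (rule sum.swap)
  also have "\<dots> = (\<Sum>j\<in>UNIV. \<Sum>i\<in>UNIV. - (P j i * mderiv j g * mderiv i f))"
    by (intro sum.cong refl, subst assms) (simp add: mult_ac)
  finally show ?thesis by (simp add: poisson_bracket_def sum_negf)
qed

lemma hamiltonian_vf_eq: "hamiltonian_vf P h j = (\<Sum>i\<in>UNIV. P i j * mderiv i h)"
proof -
  have "hamiltonian_vf P h j = (\<Sum>i\<in>UNIV. \<Sum>l\<in>UNIV. if l = j then P i j * mderiv i h else 0)"
    unfolding hamiltonian_vf_def poisson_bracket_def mderiv_mvar by (intro sum.cong refl) auto
  then show ?thesis by simp
qed

lemma poisson_bracket_hamiltonian: "poisson_bracket P h f = vf_apply (hamiltonian_vf P h) f"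
  unfolding vf_apply_def hamiltonian_vf_eq poisson_bracket_def
  by (subst sum.swap) (simp add: sum_distrib_right)

lemma poisson_bracket_mvar: "poisson_bracket P (mvar i) (mvar j) = P i j"
proof -
  have "poisson_bracket P (mvar i) (mvar j) = (\<Sum>l\<in>UNIV. if l = i then P i j else 0)"
    unfolding poisson_bracket_hamiltonian vf_apply_mvar hamiltonian_vf_eq mderiv_mvar
    by (intro sum.cong refl) auto
  then show ?thesis by simp
qed

text \<open>The failure of X to be a derivation of the bracket is its Lie derivative of P. In A the
  derivative falls on P, in B and C on a differential; B and C cancel against second derivatives
  from the other side. The derivatives of X there give D and F, which after renaming indices
  complete A to the Lie derivative.\<close>

lemma vf_apply_poisson_bracket:
  "vf_apply X (poisson_bracket P f g) =
    poisson_bracket P (vf_apply X f) g + poisson_bracket P f (vf_apply X g) +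
    (\<Sum>i\<in>UNIV. \<Sum>j\<in>UNIV. lie_derivative X P i j * mderiv i f * mderiv j g)"
proof -
  let ?S = "\<lambda>t. \<Sum>i\<in>UNIV. \<Sum>j\<in>UNIV. \<Sum>l\<in>UNIV. t i j l"
  define A where "A = ?S (\<lambda>i j l. X l * mderiv l (P i j) * mderiv i f * mderiv j g)"
  define B where "B = ?S (\<lambda>i j l. P i j * X l * mderiv l (mderiv i f) * mderiv j g)"
  define C where "C = ?S (\<lambda>i j l. P i j * X l * mderiv i f * mderiv l (mderiv j g))"
  define D where "D = ?S (\<lambda>i j l. P i j * mderiv i (X l) * mderiv l f * mderiv j g)"
  define F where "F = ?S (\<lambda>i j l. P i j * mderiv j (X l) * mderiv i f * mderiv l g)"
  have "vf_apply X (poisson_bracket P f g) = (\<Sum>i\<in>UNIV. \<Sum>j\<in>UNIV. vf_apply X (P i j * mderiv i f * mderiv j g))"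
    by (simp add: poisson_bracket_def)
  also have "\<dots> = A + B + C"
    unfolding A_def B_def C_def vf_apply_def
    by (simp add: mderiv_mult sum.distrib[symmetric] algebra_simps)
  finally have 1: "vf_apply X (poisson_bracket P f g) = A + B + C" .
  have 2: "poisson_bracket P (vf_apply X f) g = D + B"
    unfolding poisson_bracket_def B_def D_def vf_apply_def
    by (simp add: mderiv_mult sum_distrib_left sum_distrib_right sum.distrib[symmetric] algebra_simps
        mderiv_commute)
  have 3: "poisson_bracket P f (vf_apply X g) = F + C"
    unfolding poisson_bracket_def C_def F_def vf_apply_def
    by (simp add: mderiv_mult sum_distrib_left sum_distrib_right sum.distrib[symmetric] algebra_simps
        mderiv_commute)
  have D: "D = ?S (\<lambda>i j l. P l j * mderiv l (X i) * mderiv i f * mderiv j g)"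
  proof -
    have "D = (\<Sum>j\<in>UNIV. \<Sum>i\<in>UNIV. \<Sum>l\<in>UNIV. P i j * mderiv i (X l) * mderiv l f * mderiv j g)"
      unfolding D_def by (rule sum.swap)
    also have "\<dots> = (\<Sum>j\<in>UNIV. \<Sum>l\<in>UNIV. \<Sum>i\<in>UNIV. P i j * mderiv i (X l) * mderiv l f * mderiv j g)"
      by (rule sum.cong[OF refl]) (rule sum.swap)
    also have "\<dots> = (\<Sum>l\<in>UNIV. \<Sum>j\<in>UNIV. \<Sum>i\<in>UNIV. P i j * mderiv i (X l) * mderiv l f * mderiv j g)"
      by (rule sum.swap)
    finally show ?thesis .
  qed
  have F: "F = ?S (\<lambda>i j l. P i l * mderiv l (X j) * mderiv i f * mderiv j g)"
    unfolding F_def by (rule sum.cong[OF refl]) (rule sum.swap)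
  have "(\<Sum>i\<in>UNIV. \<Sum>j\<in>UNIV. lie_derivative X P i j * mderiv i f * mderiv j g) = A - D - F"
    unfolding D F A_def lie_derivative_def vf_apply_def
    by (simp add: sum_distrib_right sum_subtractf left_diff_distrib)
  then show ?thesis using 1 2 3 by simp
qed

lemma vf_apply_poisson_bracket_homogeneous:
  assumes "\<And>i j. lie_derivative X P i j = - P i j"
  shows "vf_apply X (poisson_bracket P f g) =
    poisson_bracket P (vf_apply X f) g + poisson_bracket P f (vf_apply X g) - poisson_bracket P f g"
  unfolding vf_apply_poisson_bracket by (simp add: assms poisson_bracket_def sum_negf)

subsection \<open>Linear coefficients\<close>

definition linear_coeffs :: "('k::comm_ring_1, 'n::finite) mfps \<Rightarrow> 'k ^ 'n"
  where "linear_coeffs f = (\<chi> m. mcoeff f (unit_exp m))"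

lemma linear_part_linear_coeffs: "linear_part f = linear_function (linear_coeffs f)"
  by (simp add: linear_part_eq linear_function_def linear_coeffs_def)

lemma linear_coeffs_simps:
  "linear_coeffs (f + g) = linear_coeffs f + linear_coeffs g"
  "linear_coeffs (f - g) = linear_coeffs f - linear_coeffs g"
  "linear_coeffs (- f) = - linear_coeffs f"
  "linear_coeffs 0 = 0"
  by (simp_all add: linear_coeffs_def vec_eq_iff)

lemma linear_function_simps:
  "linear_function (u + v) = linear_function u + linear_function v"
  "linear_function (u - v) = linear_function u - linear_function v"
  "linear_function (a *s u) = mconst a * linear_function u"
  by (simp_all add: linear_function_def mconst_simps algebra_simps sum.distrib sum_subtractf sum_distrib_left)

lemma linear_function_axis: "linear_function (axis i 1) = mvar i"
proof -
  have "linear_function (axis i 1) = (\<Sum>j\<in>UNIV. if j = i then mvar i else 0)"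
    unfolding linear_function_def by (rule sum.cong) (auto simp: axis_def mconst_simps)
  then show ?thesis by simp
qed

lemma linear_function_sum: "linear_function (\<Sum>j\<in>A. f j) = (\<Sum>j\<in>A. linear_function (f j))"
proof (induction A rule: infinite_finite_induct)
  case (insert x F)
  then show ?case by (simp add: linear_function_simps)
qed (simp_all add: linear_function_def mconst_simps)

lemma linear_coeffs_linear_function [simp]: "linear_coeffs (linear_function u) = u"
proof -
  have "(\<Sum>i\<in>UNIV. u $ i * (if unit_exp m = unit_exp i then 1 else 0))
      = (\<Sum>i\<in>UNIV. if i = m then u $ i else 0)" for m
    by (rule sum.cong) (auto simp: unit_exp_eq_iff)
  then show ?thesis by (simp add: linear_coeffs_def linear_function_def vec_eq_iff mvar.rep_eq)
qed

lemma linear_coeffs_mvar: "linear_coeffs (mvar i) = axis i 1"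
  by (metis linear_function_axis linear_coeffs_linear_function)

lemma linear_coeff_mult:
  assumes "value0 f = 0"
  shows "mcoeff (f * g) (unit_exp m) = mcoeff f (unit_exp m) * value0 g"
proof -
  have "vanishing 1 (g - mconst (value0 g))" by (simp add: vanishing_1_iff mconst.rep_eq del: One_nat_def)
  moreover have "vanishing 1 f" using assms by (simp add: vanishing_1_iff del: One_nat_def)
  ultimately have "vanishing (1 + 1) (f * (g - mconst (value0 g)))" by (intro vanishing_mult)
  then have "mcoeff (f * (g - mconst (value0 g))) (unit_exp m) = 0"
    using deg_unit_exp[of m] by (simp add: vanishing_def)
  moreover have "f * (g - mconst (value0 g)) = f * g - mconst (value0 g) * f"
    by (simp add: algebra_simps)
  ultimately have "mcoeff (f * g) (unit_exp m) - value0 g * mcoeff f (unit_exp m) = 0"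
    by (metis mcoeff_simps(3) mcoeff_mconst_mult)
  then show ?thesis by (simp add: mult.commute)
qed

lemma value0_mderiv: "value0 (mderiv i f) = mcoeff f (unit_exp i)"
proof -
  have "(\<lambda>_. 0)(i := 1) = unit_exp i" by (auto simp: unit_exp_def)
  then show ?thesis by (simp add: mcoeff_mderiv del: One_nat_def)
qed

lemma linear_coeff_vf_apply:
  assumes "\<And>i. value0 (X i) = 0"
  shows "mcoeff (vf_apply X f) (unit_exp m) = (\<Sum>l\<in>UNIV. mcoeff (X l) (unit_exp m) * mcoeff f (unit_exp l))"
  by (simp add: vf_apply_def linear_coeff_mult assms value0_mderiv)

lemma value0_mult:
  fixes f g :: "('k::comm_ring_1, 'n::finite) mfps"
  shows "value0 (f * g) = value0 f * value0 g"
proof -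
  have "{a :: 'n \<Rightarrow> nat. a \<le> (\<lambda>_. 0)} = {\<lambda>_. 0}" by (auto simp: le_fun_def)
  then show ?thesis by (simp add: times_mfps.rep_eq)
qed

lemma structure_const_linear_part: "structure_const (biv_linear_part P) i j k = mcoeff (P i j) (unit_exp k)"
  using deg_unit_exp[of k] by (simp add: structure_const_def linear_part.rep_eq)

text \<open>As P vanishes at 0, taking linear coefficients is a homomorphism from Poisson brackets
  to the Lie algebra of the linear part. All Lie-theoretic facts about P pass through it.\<close>

lemma linear_coeffs_poisson_bracket:
  fixes P :: "('k::field, 'n::finite) bivfield"
  assumes "\<And>i j. value0 (P i j) = 0"
  shows "linear_coeffs (poisson_bracket P f g)
    = lie_bracket (structure_const (biv_linear_part P)) (linear_coeffs f) (linear_coeffs g)"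
proof -
  have 1: "mcoeff (hamiltonian_vf P f l) (unit_exp m)
      = (\<Sum>i\<in>UNIV. mcoeff (P i l) (unit_exp m) * mcoeff f (unit_exp i))" for l m
    by (simp add: hamiltonian_vf_eq linear_coeff_mult assms value0_mderiv)
  have 2: "value0 (hamiltonian_vf P f l) = 0" for l
    by (simp add: hamiltonian_vf_eq value0_mult assms)
  have "mcoeff (poisson_bracket P f g) (unit_exp m) = (\<Sum>i\<in>UNIV. \<Sum>l\<in>UNIV.
      mcoeff (P i l) (unit_exp m) * mcoeff f (unit_exp i) * mcoeff g (unit_exp l))" for m
    unfolding poisson_bracket_hamiltonian linear_coeff_vf_apply[of "hamiltonian_vf P f", OF 2] 1
    by (subst sum.swap) (simp add: sum_distrib_right)
  then show ?thesis
    by (simp add: linear_coeffs_def lie_bracket_def vec_eq_iff structure_const_linear_part)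
qed

lemma vf_apply_linear_vf:
  fixes B :: "'k::field ^ 'n::finite \<Rightarrow> 'k ^ 'n"
  assumes B: "lin B" and Y: "\<And>i. Y i = linear_function (axis i 1 + B (axis i 1))"
  shows "vf_apply Y (linear_function u) = linear_function (u + B u)"
proof -
  have "vf_apply Y (linear_function u)
      = linear_function (\<Sum>i\<in>UNIV. u $ i *s axis i 1 + B (u $ i *s axis i 1))"
    by (simp add: vf_apply_linear_function Y linear_function_sum linear_function_simps
        lin_scale[OF B] algebra_simps)
  also have "(\<Sum>i\<in>UNIV. u $ i *s axis i 1 + B (u $ i *s axis i 1)) = u + B u"
    by (simp add: sum.distrib basis_expansion flip: vec.linear_sum[OF B])
  finally show ?thesis .
qed

subsection \<open>Diagonalizable linear vector fields\<close>

text \<open>Monomials in new linear coordinates span the polynomials of degree r. Euler's identity r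
  g = \<Sum> x_i \<partial>_i g reduces the degree, so no products of sums are expanded. The set S
  is arbitrary because the induction passes from S to the set of all f with x_i f in S.\<close>

lemma homogeneous_in_span:
  fixes \<xi> :: "'n::finite \<Rightarrow> ('k::field_char_0, 'n) mfps"
  assumes basis: "\<And>i. mvar i = (\<Sum>j\<in>UNIV. mconst (\<beta> i j) * \<xi> j)"
    and "0 \<in> S" "\<And>f g. f \<in> S \<Longrightarrow> g \<in> S \<Longrightarrow> f + g \<in> S" "\<And>c f. f \<in> S \<Longrightarrow> mconst c * f \<in> S"
    and "\<And>l. deg l = r \<Longrightarrow> (\<Prod>i\<in>UNIV. \<xi> i ^ l i) \<in> S" "homogeneous r g"
  shows "g \<in> S"
  using assms(2-)
proof (induction r arbitrary: S g)
  case 0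
  have "g = mconst (value0 g) * (\<Prod>i\<in>UNIV. \<xi> i ^ (\<lambda>_. 0) i)"
  proof (rule mfps_eqI)
    fix m
    show "mcoeff g m = mcoeff (mconst (value0 g) * (\<Prod>i\<in>UNIV. \<xi> i ^ (\<lambda>_. 0) i)) m"
      using 0(5) deg_eq_0_iff[of m] by (auto simp: homogeneous_def mconst.rep_eq simp del: sum_eq_0_iff)
  qed
  also have "\<dots> \<in> S" by (intro 0(3,4)) simp
  finally show ?case .
next
  case (Suc r)
  have sumS: "(\<Sum>i\<in>A. f i) \<in> S" if "\<And>i. f i \<in> S" for f and A :: "'n set"
    using that Suc.prems(1,2) by (induction A rule: infinite_finite_induct) auto
  have "mvar i * mderiv i g \<in> S" for i
  proof -
    define S' where "S' = {f. mvar i * f \<in> S}"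
    have "mderiv i g \<in> S'"
    proof (rule Suc.IH)
      show "0 \<in> S'" using Suc.prems(1) by (simp add: S'_def)
      show "f + h \<in> S'" if "f \<in> S'" "h \<in> S'" for f h
        using that Suc.prems(2) by (simp add: S'_def distrib_left)
      show "mconst c * f \<in> S'" if "f \<in> S'" for c f
        using that Suc.prems(3)[of "mvar i * f" c] by (simp add: S'_def mult.left_commute)
      show "homogeneous r (mderiv i g)" using Suc.prems(5) by (rule homogeneous_mderiv)
      fix l :: "'n \<Rightarrow> nat" assume l: "deg l = r"
      have "\<xi> j * (\<Prod>i\<in>UNIV. \<xi> i ^ l i) = (\<Prod>i\<in>UNIV. \<xi> i ^ (l(j := l j + 1)) i)" for j
      proof -
        have "(\<Prod>i\<in>UNIV. \<xi> i ^ (l(j := l j + 1)) i) = (\<Prod>i\<in>UNIV. (if i = j then \<xi> i else 1) * \<xi> i ^ l i)"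
          by (rule prod.cong) auto
        then show ?thesis by (simp add: prod.distrib)
      qed
      then have "\<xi> j * (\<Prod>i\<in>UNIV. \<xi> i ^ l i) \<in> S" for j
        using Suc.prems(4)[of "l(j := l j + 1)"] deg_upd[of l j] l by simp
      then have "(\<Sum>j\<in>UNIV. mconst (\<beta> i j) * (\<xi> j * (\<Prod>i\<in>UNIV. \<xi> i ^ l i))) \<in> S"
        by (intro sumS Suc.prems(3))
      then show "(\<Prod>i\<in>UNIV. \<xi> i ^ l i) \<in> S'"
        by (simp add: S'_def basis sum_distrib_right mult.assoc)
    qed
    then show ?thesis by (simp add: S'_def)
  qed
  then have "vf_apply euler_vf g \<in> S" unfolding vf_apply_def euler_vf_def by (intro sumS)
  then have "mconst (1 / of_nat (Suc r)) * vf_apply euler_vf g \<in> S" by (rule Suc.prems(3))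
  moreover have "mconst (1 / of_nat (Suc r)) * vf_apply euler_vf g = g"
  proof (rule mfps_eqI)
    fix m
    show "mcoeff (mconst (1 / of_nat (Suc r)) * vf_apply euler_vf g) m = mcoeff g m"
      using Suc.prems(5) of_nat_neq_0[of r, where 'a = 'k]
      by (cases "deg m = Suc r") (simp_all add: vf_apply_euler homogeneous_def del: of_nat_Suc of_nat_sum)
  qed
  ultimately show ?case by simp
qed

lemma vf_apply_eigen_prod:
  fixes \<xi> :: "'n::finite \<Rightarrow> ('k::comm_ring_1, 'n) mfps"
  assumes eig: "\<And>j. vf_apply Y (\<xi> j) = mconst (\<mu> j) * \<xi> j"
  shows "vf_apply Y (\<Prod>i\<in>A. \<xi> i ^ l i) = mconst (\<Sum>i\<in>A. of_nat (l i) * \<mu> i) * (\<Prod>i\<in>A. \<xi> i ^ l i)"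
proof -
  have one: "vf_apply Y 1 = 0" using vf_apply_mult[of Y 1 1] by simp
  have pow: "vf_apply Y (\<xi> j ^ n) = mconst (of_nat n * \<mu> j) * \<xi> j ^ n" for j n
    by (induction n) (simp_all add: one mconst_simps vf_apply_mult eig algebra_simps)
  show ?thesis
    by (induction A rule: infinite_finite_induct)
      (simp_all add: one mconst_simps vf_apply_mult pow algebra_simps)
qed

lemma homogeneous_prod:
  fixes \<xi> :: "'n::finite \<Rightarrow> ('k::comm_ring_1, 'n) mfps"
  assumes "\<And>j. homogeneous 1 (\<xi> j)" "finite A"
  shows "homogeneous (\<Sum>i\<in>A. l i) (\<Prod>i\<in>A. \<xi> i ^ l i)"
proof -
  have one: "homogeneous 0 (1 :: ('k, 'n) mfps)"
    using deg_eq_0_iff by (auto simp: homogeneous_def one_mfps.rep_eq)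
  have pow: "homogeneous n (\<xi> j ^ n)" for j n
    using homogeneous_mult[OF assms(1)] by (induction n) (auto simp: one)
  show ?thesis
    using assms(2) by induction (auto simp: one intro!: homogeneous_mult pow)
qed

text \<open>Y is a derivation, so a monomial in its eigenfunctions \<xi> is again one, with the
  eigenvalue \<Sum> l_i \<mu>_i; \<open>nonres\<close> makes Y - 1 invertible on it.\<close>

lemma diagonalizable_vf_surjective:
  fixes \<xi> :: "'n::finite \<Rightarrow> ('k::field_char_0, 'n) mfps"
  assumes eig: "\<And>j. vf_apply Y (\<xi> j) = mconst (\<mu> j) * \<xi> j" and hom: "\<And>j. homogeneous 1 (\<xi> j)"
    and basis: "\<And>i. mvar i = (\<Sum>j\<in>UNIV. mconst (\<beta> i j) * \<xi> j)"
    and nonres: "\<And>l. deg l = r \<Longrightarrow> (\<Sum>i\<in>UNIV. of_nat (l i) * \<mu> i) \<noteq> 1"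
    and g: "homogeneous r g"
  shows "\<exists>f. homogeneous r f \<and> vf_apply Y f - f = g"
proof -
  define S where "S = {g. \<exists>f. homogeneous r f \<and> vf_apply Y f - f = g}"
  have "g \<in> S"
  proof (rule homogeneous_in_span[OF basis _ _ _ _ g])
    show "0 \<in> S" unfolding S_def by (rule CollectI, rule exI[of _ 0]) (simp add: homogeneous_def)
    show "f + g \<in> S" if fg: "f \<in> S" "g \<in> S" for f g
    proof -
      obtain f' g' where "homogeneous r f'" "vf_apply Y f' - f' = f"
        "homogeneous r g'" "vf_apply Y g' - g' = g"
        using fg unfolding S_def by blast
      then show ?thesis
        unfolding S_def by (intro CollectI exI[of _ "f' + g'"]) (auto simp: homogeneous_add)
    qed
    show scale: "mconst c * f \<in> S" if f: "f \<in> S" for c f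
    proof -
      obtain f' where "homogeneous r f'" "vf_apply Y f' - f' = f"
        using f unfolding S_def by blast
      then show ?thesis
        unfolding S_def
        by (intro CollectI exI[of _ "mconst c * f'"]) (auto simp: homogeneous_mconst_mult right_diff_distrib)
    qed
    fix l :: "'n \<Rightarrow> nat" assume l: "deg l = r"
    let ?p = "\<Prod>i\<in>UNIV. \<xi> i ^ l i"
    define a where "a = (\<Sum>i\<in>UNIV. of_nat (l i) * \<mu> i) - 1"
    have a: "a \<noteq> 0" using nonres[OF l] by (simp add: a_def)
    have "vf_apply Y ?p - ?p = mconst a * ?p"
      unfolding vf_apply_eigen_prod[of Y \<xi>, OF eig] a_def mconst_simps by (simp add: left_diff_distrib)
    then have "mconst a * ?p \<in> S"
      using homogeneous_prod[of \<xi> UNIV l, OF hom] l unfolding S_def by auto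
    then have "mconst (1 / a) * (mconst a * ?p) \<in> S" by (rule scale)
    then show "?p \<in> S" using a by (simp add: mult.assoc[symmetric] mconst_simps flip: mconst_simps(4))
  qed
  then show ?thesis by (simp add: S_def)
qed

subsection \<open>Linearization\<close>

text \<open>A ground-linear left inverse of the embedding, such as \<open>Re\<close>. It sends a
  complex solution of a linear equation with coefficients in the ground field to a solution there;
  it is not asked to be multiplicative.\<close>

locale scalar_retraction = scalar_extension \<iota>
  for \<iota> :: "'k::field_char_0 \<Rightarrow> complex" +
  fixes \<rho> :: "complex \<Rightarrow> 'k"
  assumes retract_add: "\<rho> (z + w) = \<rho> z + \<rho> w"
    and retract_mult: "\<rho> (\<iota> a * z) = a * \<rho> z"
    and retract_one: "\<rho> 1 = 1"
begin

lemma retract_0: "\<rho> 0 = 0"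
  using retract_mult[of 0 0] by simp

lemma retract_sum: "\<rho> (\<Sum>i\<in>A. f i) = (\<Sum>i\<in>A. \<rho> (f i))"
  by (induction A rule: infinite_finite_induct) (auto simp: retract_0 retract_add)

lemma retract_ext: "\<rho> (\<iota> a) = a"
  using retract_mult[of a 1] by (simp add: retract_one)

lemma retract_diff: "\<rho> (z - w) = \<rho> z - \<rho> w"
  using retract_add[of "z - w" w] by simp

lemma retract_of_nat_mult: "\<rho> (of_nat n * z) = of_nat n * \<rho> z"
  using retract_mult[of "of_nat n" z] by (simp add: of_nat)

definition mfps_ext :: "('k, 'n) mfps \<Rightarrow> (complex, 'n) mfps"
  where "mfps_ext f = Abs_mfps (\<lambda>m. \<iota> (mcoeff f m))"

definition mfps_retract :: "(complex, 'n) mfps \<Rightarrow> ('k, 'n) mfps"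
  where "mfps_retract f = Abs_mfps (\<lambda>m. \<rho> (mcoeff f m))"

lemma mcoeff_mfps_ext [simp]: "mcoeff (mfps_ext f) m = \<iota> (mcoeff f m)"
  by (simp add: mfps_ext_def Abs_mfps_inverse)

lemma mcoeff_mfps_retract [simp]: "mcoeff (mfps_retract f) m = \<rho> (mcoeff f m)"
  by (simp add: mfps_retract_def Abs_mfps_inverse)

lemma mfps_retract_vf_apply:
  "mfps_retract (vf_apply (\<lambda>i. mfps_ext (X i)) f) = vf_apply X (mfps_retract f)"
proof (rule mfps_eqI)
  fix m
  have "mcoeff (mfps_retract (vf_apply (\<lambda>i. mfps_ext (X i)) f)) m = (\<Sum>i\<in>UNIV. \<Sum>a | a \<le> m.
      mcoeff (X i) a * \<rho> (mcoeff (mderiv i f) (\<lambda>k. m k - a k)))"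
    by (simp add: vf_apply_def times_mfps.rep_eq retract_sum retract_mult)
  also have "\<dots> = mcoeff (vf_apply X (mfps_retract f)) m"
    unfolding vf_apply_def mcoeff_sum times_mfps.rep_eq mcoeff_mderiv mcoeff_mfps_retract
      retract_of_nat_mult ..
  finally show "mcoeff (mfps_retract (vf_apply (\<lambda>i. mfps_ext (X i)) f)) m
      = mcoeff (vf_apply X (mfps_retract f)) m" .
qed

lemma mfps_ext_linear_function: "mfps_ext (linear_function u) = linear_function (vec_ext u)"
proof (rule mfps_eqI)
  fix m
  have "\<iota> (if b then 1 else 0) = (if b then 1 else 0)" for b by (simp add: one zero)
  then show "mcoeff (mfps_ext (linear_function u)) m = mcoeff (linear_function (vec_ext u)) m"
    by (simp add: linear_function_def sum mult mvar.rep_eq vec_ext_def)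
qed

text \<open>The weight vectors are eigenfunctions with the eigenvalues 1 + \<alpha>_i, the 1 coming
  from the Euler field. For a monomial of degree r, \<Sum> l_i (1 + \<alpha>_i) - 1 is exactly the
  nonresonance expression r - 1 + \<Sum> l_i \<alpha>_i.\<close>

lemma linear_vf_surjective:
  fixes c :: "'n::finite \<Rightarrow> 'n \<Rightarrow> 'n \<Rightarrow> 'k"
  assumes Y: "\<And>i. Y i = linear_function (axis i 1 + lie_bracket c h (axis i 1))"
    and b: "vec_basis b"
    and eig: "\<And>i. lie_bracket (\<lambda>i j k. \<iota> (c i j k)) (vec_ext h) (b i) = \<alpha> i *s b i"
    and nonres: "\<And>l :: 'n \<Rightarrow> nat. deg l = r \<Longrightarrow> of_nat r - 1 + (\<Sum>i\<in>UNIV. of_nat (l i) * \<alpha> i) \<noteq> 0"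
    and g: "homogeneous r g"
  shows "\<exists>f. homogeneous r f \<and> vf_apply Y f - f = g"
proof -
  let ?brC = "lie_bracket (\<lambda>i j k. \<iota> (c i j k))"
  define Y' where "Y' = (\<lambda>i. mfps_ext (Y i))"
  have Y': "Y' i = linear_function (axis i 1 + ?brC (vec_ext h) (axis i 1))" for i
    by (simp add: Y'_def Y mfps_ext_linear_function vec_ext_add vec_ext_axis vec_ext_lie_bracket)
  define \<xi> where "\<xi> = (\<lambda>j. linear_function (b j))"
  have "\<exists>\<beta>. mvar i = (\<Sum>j\<in>UNIV. mconst (\<beta> j) * \<xi> j)" for i
  proof -
    have "axis i 1 \<in> vec.span (range b)" using b by (simp add: vec_basis_def)
    then obtain u where "axis i 1 = (\<Sum>v\<in>range b. u v *s v)" by (auto simp: vec.span_finite)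
    then have "axis i 1 = (\<Sum>j\<in>UNIV. u (b j) *s b j)"
      using b by (simp add: vec_basis_def sum.reindex)
    then have "mvar i = (\<Sum>j\<in>UNIV. mconst (u (b j)) * \<xi> j)"
      by (simp add: \<xi>_def linear_function_sum linear_function_simps flip: linear_function_axis)
    then show ?thesis by (intro exI[of _ "\<lambda>j. u (b j)"])
  qed
  then obtain \<beta> where \<beta>: "\<And>i. mvar i = (\<Sum>j\<in>UNIV. mconst (\<beta> i j) * \<xi> j)" by metis
  have "\<exists>f. homogeneous r f \<and> vf_apply Y' f - f = mfps_ext g"
  proof (rule diagonalizable_vf_surjective[OF _ _ \<beta>])
    show "vf_apply Y' (\<xi> j) = mconst (1 + \<alpha> j) * \<xi> j" for j
      using vf_apply_linear_vf[OF lin_lie_bracket(1) Y'] eig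
      by (simp add: \<xi>_def linear_function_simps mconst_simps distrib_right)
    show "homogeneous 1 (\<xi> j)" for j unfolding \<xi>_def by (rule homogeneous_linear_function)
    show "(\<Sum>i\<in>UNIV. of_nat (l i) * (1 + \<alpha> i)) \<noteq> 1" if "deg l = r" for l
    proof
      assume "(\<Sum>i\<in>UNIV. of_nat (l i) * (1 + \<alpha> i)) = 1"
      moreover have "(\<Sum>i\<in>UNIV. of_nat (l i) * (1 + \<alpha> i)) = of_nat r + (\<Sum>i\<in>UNIV. of_nat (l i) * \<alpha> i)"
        by (simp add: distrib_left sum.distrib flip: that)
      ultimately show False using nonres[OF that] by (simp add: algebra_simps)
    qed
    show "homogeneous r (mfps_ext g)" using g by (simp add: homogeneous_def zero)
  qed
  then obtain f where f: "homogeneous r f" "vf_apply Y' f - f = mfps_ext g" by blast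
  have "homogeneous r (mfps_retract f)" using f(1) by (simp add: homogeneous_def retract_0)
  moreover have "vf_apply Y (mfps_retract f) - mfps_retract f = g"
  proof -
    have "mfps_retract (vf_apply Y' f - f) = g"
      unfolding f(2) by (rule mfps_eqI) (simp add: retract_ext)
    moreover have "mfps_retract (vf_apply Y' f - f) = mfps_retract (vf_apply Y' f) - mfps_retract f"
      by (rule mfps_eqI) (simp add: retract_diff)
    ultimately show ?thesis by (simp add: Y'_def mfps_retract_vf_apply)
  qed
  ultimately show ?thesis by blast
qed

end

section \<open>Formal homogeneous Poisson structures and their linear parts\<close>

lemma poisson_jacobi:
  assumes "poisson_structure P"
  shows "poisson_bracket P f (poisson_bracket P g h) =
    poisson_bracket P (poisson_bracket P f g) h + poisson_bracket P g (poisson_bracket P f h)"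
proof -
  have skew: "poisson_bracket P f g = - poisson_bracket P g f" for f g
    using assms unfolding poisson_structure_def by (intro poisson_bracket_skew) blast
  have minus: "poisson_bracket P f (- g) = - poisson_bracket P f g" for f g
    using poisson_bracket_simps(4)[of P f 0 g] by (simp add: poisson_bracket_simps)
  have "poisson_bracket P f (poisson_bracket P g h) + poisson_bracket P g (poisson_bracket P h f)
      + poisson_bracket P h (poisson_bracket P f g) = 0"
    using assms unfolding poisson_structure_def by blast
  moreover have "poisson_bracket P g (poisson_bracket P h f) = - poisson_bracket P g (poisson_bracket P f h)"
    by (subst skew[of h f]) (rule minus)
  moreover have "poisson_bracket P h (poisson_bracket P f g) = - poisson_bracket P (poisson_bracket P f g) h"
    by (rule skew)
  ultimately show ?thesis by (simp add: algebra_simps eq_neg_iff_add_eq_0)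
qed

lemma mfps_eq_minus_self:
  fixes f :: "('k::field_char_0, 'n::finite) mfps"
  assumes "f = - f"
  shows "f = 0"
proof (rule mfps_eqI)
  fix m
  have "mcoeff f m = - mcoeff f m" by (subst (1) assms) simp
  then show "mcoeff f m = mcoeff 0 m" by simp
qed

context
  fixes P :: "('k::field_char_0, 'n::finite) bivfield" and X :: "('k, 'n) vfield"
  assumes PX: "homogeneous_poisson P X"
    and P0: "\<And>i j. value0 (P i j) = 0" and X0: "\<And>i. value0 (X i) = 0"
begin

abbreviation (input) "linear_constants \<equiv> structure_const (biv_linear_part P)"
abbreviation (input) "linear_bracket \<equiv> lie_bracket linear_constants"

lemma poisson: "poisson_structure P" and lie_derivative: "lie_derivative X P i j = - P i j"
  using PX unfolding homogeneous_poisson_def by blast+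

lemma pb_skew: "poisson_bracket P f g = - poisson_bracket P g f"
  using poisson unfolding poisson_structure_def by (intro poisson_bracket_skew) blast

lemma pb_self: "poisson_bracket P f f = 0"
  using pb_skew by (rule mfps_eq_minus_self)

lemma linear_coeffs_pb: "linear_coeffs (poisson_bracket P f g) = linear_bracket (linear_coeffs f) (linear_coeffs g)"
  by (rule linear_coeffs_poisson_bracket[OF P0])

lemma linear_coeffs_biv: "linear_coeffs (P i j) = linear_bracket (axis i 1) (axis j 1)"
  using linear_coeffs_pb[of "mvar i" "mvar j"] by (simp add: poisson_bracket_mvar linear_coeffs_mvar)

text \<open>The Jacobi identity is given for P; linear coefficients of its instance at three
  coordinate functions yield the identity for the constants.\<close>

lemma lie_constants_linear_part: "lie_constants linear_constants"
proof -
  define c where "c = linear_constants"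
  have c: "c i j k = mcoeff (P i j) (unit_exp k)" for i j k
    unfolding c_def by (rule structure_const_linear_part)
  have skew: "P i j = - P j i" for i j
    using poisson unfolding poisson_structure_def by blast
  have "lie_constants c"
    unfolding lie_constants_def
  proof (intro conjI allI)
    fix i j k m
    show "c i i k = 0" using mfps_eq_minus_self[OF skew[of i i]] by (simp add: c)
    show "c i j k = - c j i k" using skew[of i j] by (simp add: c)
    have "linear_bracket (axis i 1) (linear_bracket (axis j 1) (axis k 1)) =
        linear_bracket (linear_bracket (axis i 1) (axis j 1)) (axis k 1) + linear_bracket (axis j 1) (linear_bracket (axis i 1) (axis k 1))"
      using arg_cong[OF poisson_jacobi[OF poisson, of "mvar i" "mvar j" "mvar k"], of linear_coeffs]
      by (simp only: linear_coeffs_pb linear_coeffs_simps linear_coeffs_mvar)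
    then show "(\<Sum>l\<in>UNIV. c j k l * c i l m) =
        (\<Sum>l\<in>UNIV. c i j l * c l k m) + (\<Sum>l\<in>UNIV. c i k l * c j l m)"
      by (simp add: lie_bracket_axis sum_axis vec_eq_iff mult.commute flip: c_def)
  qed
  then show ?thesis by (simp only: c_def)
qed

interpretation lie_algebra linear_bracket
  by (rule lie_algebra_lie_bracket[OF lie_constants_linear_part])

lemma vf_apply_pb:
  "vf_apply X (poisson_bracket P f g) =
    poisson_bracket P (vf_apply X f) g + poisson_bracket P f (vf_apply X g) - poisson_bracket P f g"
  by (rule vf_apply_poisson_bracket_homogeneous[OF lie_derivative])

text \<open>Brackets of linear functions under P need not be linear. As X vanishes at 0, they may be
  replaced by their linear parts before X is applied.\<close>

lemma linear_coeffs_vf_apply_cong: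
  assumes "linear_coeffs f = linear_coeffs g"
  shows "linear_coeffs (vf_apply X f) = linear_coeffs (vf_apply X g)"
  using assms by (simp add: linear_coeffs_def linear_coeff_vf_apply[of X, OF X0] vec_eq_iff)

text \<open>X{f,g} = {X f,g} + {f,X g} - {f,g} has one bracket too few for a derivation; subtracting
  the identity, the action of the Euler field on linear functions, removes the defect.\<close>

lemma derivation_linear_part:
  "derivation (\<lambda>u. linear_coeffs (vf_apply X (linear_function u)) - u)"
  unfolding derivation_def
proof (intro conjI allI)
  let ?M = "\<lambda>u. linear_coeffs (vf_apply X (linear_function u))"
  have M_scale: "?M (a *s u) = a *s ?M u" for a u
    by (simp add: linear_function_simps) (simp add: linear_coeffs_def vec_eq_iff)
  show "lin (\<lambda>u. ?M u - u)"
    unfolding lin_iff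
    by (simp add: M_scale vec.scale_right_diff_distrib) (simp add: linear_function_simps linear_coeffs_simps)
  fix u v :: "'k ^ 'n"
  let ?u = "linear_function u" and ?v = "linear_function v"
  have "?M (linear_bracket u v) = linear_coeffs (vf_apply X (poisson_bracket P ?u ?v))"
    by (rule linear_coeffs_vf_apply_cong) (simp add: linear_coeffs_pb)
  also have "\<dots> = linear_bracket (?M u) v + linear_bracket u (?M v) - linear_bracket u v"
    by (simp add: vf_apply_pb linear_coeffs_simps linear_coeffs_pb)
  finally show "?M (linear_bracket u v) - linear_bracket u v = linear_bracket (?M u - u) v + linear_bracket u (?M v - v)"
    by (simp add: br_left br_right)
qed

lemma hamiltonian_vf_linear_part:
  "hamiltonian_vf (biv_linear_part P) (linear_function h) i = linear_function (linear_bracket h (axis i 1))"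
proof -
  have "mderiv a (linear_function h) = mconst (h $ a)" for a
  proof -
    have "mderiv a (linear_function h) = (\<Sum>i\<in>UNIV. if i = a then mconst (h $ a) else 0)"
      unfolding linear_function_def mderiv_sum mderiv_mconst_mult mderiv_mvar by (rule sum.cong) auto
    then show ?thesis by simp
  qed
  then have "hamiltonian_vf (biv_linear_part P) (linear_function h) i
      = (\<Sum>a\<in>UNIV. linear_part (P a i) * mconst (h $ a))"
    by (simp only: hamiltonian_vf_eq)
  also have "\<dots> = (\<Sum>a\<in>UNIV. linear_function (linear_bracket (axis a 1) (axis i 1)) * mconst (h $ a))"
    by (intro sum.cong refl arg_cong2[of _ _ _ _ times])
      (rule trans[OF linear_part_linear_coeffs arg_cong[OF linear_coeffs_biv, of linear_function]])
  also have "\<dots> = linear_function (\<Sum>a\<in>UNIV. h $ a *s linear_bracket (axis a 1) (axis i 1))"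
    unfolding linear_function_sum linear_function_simps by (rule sum.cong[OF refl mult.commute])
  also have "(\<Sum>a\<in>UNIV. h $ a *s linear_bracket (axis a 1) (axis i 1)) = linear_bracket (\<Sum>a\<in>UNIV. h $ a *s axis a 1) (axis i 1)"
    by (simp add: vec.linear_sum[OF lin_br_left] br_left)
  finally show ?thesis by (simp add: basis_expansion)
qed

lemma linear_vf_eq_iff:
  "linear_part (X i) = euler_vf i + hamiltonian_vf (biv_linear_part P) (linear_function h) i
    \<longleftrightarrow> linear_coeffs (X i) = axis i 1 + linear_bracket h (axis i 1)"
proof -
  have "euler_vf i + hamiltonian_vf (biv_linear_part P) (linear_function h) i
      = linear_function (axis i 1 + linear_bracket h (axis i 1))"
    by (simp add: hamiltonian_vf_linear_part linear_function_simps linear_function_axis euler_vf_def)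
  moreover have "linear_part (X i) = linear_function (linear_coeffs (X i))"
    by (rule linear_part_linear_coeffs)
  ultimately show ?thesis by (metis linear_coeffs_linear_function)
qed

text \<open>Resolves the definite description in \<open>hamiltonian_element\<close>: existence is
  innerness of the preceding derivation, uniqueness is triviality of the centre.\<close>

lemma hamiltonian_element_eq:
  assumes "killing_radical = {0}"
  shows "linear_coeffs (X i) = axis i 1 +
    linear_bracket (hamiltonian_element (biv_linear_part P) (vf_linear_part X)) (axis i 1)"
proof -
  let ?P = "\<lambda>h. \<forall>i. linear_coeffs (X i) = axis i 1 + linear_bracket h (axis i 1)"
  obtain h where h: "(\<lambda>u. linear_coeffs (vf_apply X (linear_function u)) - u) = linear_bracket h"
    by (rule derivation_inner[OF assms derivation_linear_part])
  have ex: "?P h"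
  proof
    fix i
    have "linear_coeffs (X i) - axis i 1 = linear_bracket h (axis i 1)"
      using fun_cong[OF h, of "axis i 1"] by (simp add: linear_function_axis vf_apply_mvar)
    then show "linear_coeffs (X i) = axis i 1 + linear_bracket h (axis i 1)" by (simp add: algebra_simps)
  qed
  have "h' = h" if "?P h'" for h'
  proof -
    have "linear_bracket (h' - h) (axis i 1) = 0" for i
      using ex that by (simp add: br_left)
    moreover have "vec.subspace {v. linear_bracket (h' - h) v = 0}"
      by (simp add: vec.subspace_def br_right)
    ultimately have "linear_bracket (h' - h) v = 0" for v
      using subspace_contains_axes[of "{v. linear_bracket (h' - h) v = 0}" v] by blast
    then have "h' - h = 0" by (rule ad_inj_of_killing[OF assms])
    then show ?thesis by simp
  qed
  then have "hamiltonian_element (biv_linear_part P) (vf_linear_part X) = h"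
    unfolding hamiltonian_element_def linear_vf_eq_iff using ex by (rule the_equality[rotated])
  then show ?thesis using ex by simp
qed

lemma linearization_of_eigenfunction:
  assumes h: "\<And>i. linear_coeffs (X i) = axis i 1 + linear_bracket h (axis i 1)"
    and H: "vanishing 2 (H - linear_function h)" "vf_apply X H = H"
  shows "\<exists>\<phi>. formal_diffeo \<phi> \<and>
    sends_biv \<phi> P (biv_linear_part P) \<and> sends_vf \<phi> X (vf_linear_part X)"
proof -
  define Z where "Z = (\<lambda>i. X i - hamiltonian_vf P H i)"
  have Z: "vf_apply Z f = vf_apply X f - poisson_bracket P H f" for f
    by (simp add: Z_def vf_apply_diff_field poisson_bracket_hamiltonian)
  have lc_eq: "linear_coeffs f = linear_coeffs g" if "vanishing 2 (f - g)" for f g :: "('k, 'n) mfps"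
  proof -
    have "mcoeff f (unit_exp i) = mcoeff g (unit_exp i)" for i
      using that[unfolded vanishing_def, rule_format, of "unit_exp i"] deg_unit_exp[of i] by simp
    then show ?thesis by (simp add: linear_coeffs_def)
  qed
  have v0_eq: "value0 f = value0 g" if "vanishing 2 (f - g)" for f g :: "('k, 'n) mfps"
    using that by (simp add: vanishing_def)
  have van2: "vanishing 2 f" if "value0 f = 0" "linear_coeffs f = 0" for f :: "('k, 'n) mfps"
    using vanishing_linear_part[OF that(1)] that(2) unfolding linear_part_linear_coeffs
    by (simp add: linear_function_def mconst_simps)
  have lc_H: "linear_coeffs H = h" using lc_eq[OF H(1)] by simp
  have Z0: "value0 (Z i) = 0" for i
    by (simp add: Z_def X0 hamiltonian_vf_eq value0_mult P0)
  have Z1: "vf_linear_part Z = euler_vf"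
  proof
    fix i
    have "linear_coeffs (Z i) = axis i 1"
      by (simp add: Z_def linear_coeffs_simps h hamiltonian_vf_def linear_coeffs_pb lc_H linear_coeffs_mvar)
    then show "linear_part (Z i) = euler_vf i"
      by (simp add: linear_part_linear_coeffs linear_function_axis euler_vf_def)
  qed
  have "\<exists>\<phi>. vanishing 2 (\<phi> - mvar i) \<and> vf_apply Z \<phi> = \<phi>" for i
    using euler_eigenfunction_exists[of Z "mvar i", OF Z0 Z1 homogeneous_mvar] by metis
  then obtain \<phi> where \<phi>: "\<And>i. vanishing 2 (\<phi> i - mvar i)" "\<And>i. vf_apply Z (\<phi> i) = \<phi> i" by metis
  have \<phi>0: "value0 (\<phi> i) = 0" for i
  proof -
    have "vanishing 1 (mvar i)" by (rule homogeneous_imp_vanishing[OF homogeneous_mvar])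
    then show ?thesis using v0_eq[OF \<phi>(1)[of i]] by (simp add: vanishing_1_iff del: One_nat_def)
  qed
  have lc_\<phi>: "linear_coeffs (\<phi> i) = axis i 1" for i
    using lc_eq[OF \<phi>(1)[of i]] by (simp add: linear_coeffs_mvar)
  define \<Phi> where "\<Phi> = (\<lambda>u. \<Sum>k\<in>UNIV. mconst (u $ k) * \<phi> k)"
  have lc_\<Phi>: "linear_coeffs (\<Phi> u) = u" for u
  proof -
    have "linear_coeffs (\<Phi> u) = (\<Sum>k\<in>UNIV. u $ k *s linear_coeffs (\<phi> k))"
      by (simp add: \<Phi>_def linear_coeffs_def vec_eq_iff)
    then show ?thesis by (simp add: lc_\<phi> basis_expansion)
  qed
  \<comment> \<open>Rigidity in usable form: to identify an eigenfunction of Z it is enough to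
    compute its linear coefficients.\<close>
  have eig_\<Phi>: "f = \<Phi> (linear_coeffs f)" if "vf_apply Z f = f" "value0 f = 0" for f
  proof -
    have "f - \<Phi> (linear_coeffs f) = 0"
    proof (rule eigenfunction_unique[OF Z0 Z1])
      show "vanishing 2 (f - \<Phi> (linear_coeffs f))"
        by (rule van2) (simp_all add: that(2) linear_coeffs_simps lc_\<Phi>, simp add: \<Phi>_def \<phi>0)
      show "vf_apply Z (f - \<Phi> (linear_coeffs f)) = f - \<Phi> (linear_coeffs f)"
        using that(1) by (simp add: \<Phi>_def \<phi>(2))
    qed
    then show ?thesis by simp
  qed
  have \<Phi>_add: "\<Phi> (u + v) = \<Phi> u + \<Phi> v" for u v
    by (simp add: \<Phi>_def mconst_simps distrib_right sum.distrib)
  have \<Phi>_axis: "\<Phi> (axis i 1) = \<phi> i" for i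
    using eig_\<Phi>[OF \<phi>(2) \<phi>0, of i] by (simp add: lc_\<phi>)
  have compose: "mcompose (linear_part f) \<phi> = \<Phi> (linear_coeffs f)" for f
    by (simp add: mcompose_linear_part \<phi>0 \<Phi>_def linear_coeffs_def)
  have pb0: "value0 (poisson_bracket P f g) = 0" for f g
    by (simp add: poisson_bracket_def value0_mult P0)
  have eig_pb: "poisson_bracket P f g = \<Phi> (linear_bracket (linear_coeffs f) (linear_coeffs g))"
    if "vf_apply Z f = f" "vf_apply Z g = g" for f g
  proof -
    \<comment> \<open>The term -{f,g} comes from X; subtracting {H, -} changes nothing because it is
      a derivation of the bracket by Jacobi.\<close>
    have "vf_apply Z (poisson_bracket P f g)
        = poisson_bracket P (vf_apply Z f) g + poisson_bracket P f (vf_apply Z g) - poisson_bracket P f g"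
      unfolding Z vf_apply_pb poisson_jacobi[OF poisson, of H f g] by (simp add: poisson_bracket_simps)
    then have "vf_apply Z (poisson_bracket P f g) = poisson_bracket P f g" using that by simp
    then show ?thesis using eig_\<Phi>[OF _ pb0] by (simp only: linear_coeffs_pb)
  qed
  \<comment> \<open>{H,H} = 0, so H is an eigenfunction of Z too. Thus {H, \<phi>_i} is covered by
    \<open>eig_pb\<close>, and X \<phi>_i = \<phi>_i + {H, \<phi>_i} is linear in the
    \<phi>_k.\<close>
  have ZH: "vf_apply Z H = H" by (simp add: Z H(2) pb_self)
  have "sends_biv \<phi> P (biv_linear_part P)"
    unfolding sends_biv_def by (simp add: compose eig_pb \<phi>(2) lc_\<phi> linear_coeffs_biv)
  moreover have "sends_vf \<phi> X (vf_linear_part X)"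
    unfolding sends_vf_def compose
  proof
    fix i
    have "vf_apply X (\<phi> i) = \<phi> i + poisson_bracket P H (\<phi> i)"
      using Z[of "\<phi> i"] \<phi>(2)[of i] by (simp add: algebra_simps)
    then show "vf_apply X (\<phi> i) = \<Phi> (linear_coeffs (X i))"
      by (simp add: h \<Phi>_add \<Phi>_axis eig_pb ZH \<phi>(2) lc_\<phi> lc_H)
  qed
  moreover have "formal_diffeo \<phi>"
  proof -
    have "mcoeff (\<phi> i) (unit_exp j) = axis i 1 $ j" for i j
      by (simp flip: lc_\<phi>) (simp add: linear_coeffs_def)
    then have "(\<chi> i j. mcoeff (\<phi> i) (unit_exp j)) = (mat 1 :: 'k ^ 'n ^ 'n)"
      by (simp add: vec_eq_iff mat_def axis_def)
    moreover have "invertible (mat 1 :: 'k ^ 'n ^ 'n)"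
      unfolding invertible_def by (rule exI[of _ "mat 1"]) (simp add: matrix_mul_lid)
    ultimately show ?thesis by (simp add: formal_diffeo_def \<phi>0)
  qed
  ultimately show ?thesis by blast
qed

end

lemma (in scalar_retraction) linearization_exists:
  fixes P :: "('k, 'n::finite) bivfield" and X :: "('k, 'n) vfield"
  assumes PX: "homogeneous_poisson P X"
    and P0: "\<And>i j. value0 (P i j) = 0" and X0: "\<And>i. value0 (X i) = 0"
    and ss: "lie_semisimple (lie_bracket (structure_const (biv_linear_part P)))"
    and nonres: "semisimple_nonresonant \<iota> (biv_linear_part P) (vf_linear_part X)"
  shows "\<exists>\<phi>. formal_diffeo \<phi> \<and>
    sends_biv \<phi> P (biv_linear_part P) \<and> sends_vf \<phi> X (vf_linear_part X)"
proof -
  define c where "c = structure_const (biv_linear_part P)"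
  define h where "h = hamiltonian_element (biv_linear_part P) (vf_linear_part X)"
  have c: "lie_constants c" unfolding c_def by (rule lie_constants_linear_part[OF PX P0 X0])
  interpret lie_algebra "lie_bracket c" by (rule lie_algebra_lie_bracket[OF c])
  have rad: "killing_radical = {0}"
    using killing_radical_trivial[OF c] ss by (simp add: c_def)
  have h: "linear_coeffs (X i) = axis i 1 + lie_bracket c h (axis i 1)" for i
    unfolding c_def h_def using rad by (intro hamiltonian_element_eq[OF PX P0 X0]) (simp add: c_def)
  have "\<exists>B b \<alpha>. cartan_subalgebra (lie_bracket (\<lambda>i j k. \<iota> (c i j k))) B \<and> vec_ext h \<in> B \<and>
      weight_basis (lie_bracket (\<lambda>i j k. \<iota> (c i j k))) B b \<alpha> \<and>
      (\<forall>r\<ge>2. \<forall>l :: 'n \<Rightarrow> nat. (\<Sum>i\<in>UNIV. l i) = r \<longrightarrow>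
        of_nat r - 1 + (\<Sum>i\<in>UNIV. of_nat (l i) * \<alpha> i (vec_ext h)) \<noteq> 0)"
    using nonres unfolding semisimple_nonresonant_def Let_def c_def[symmetric] h_def[symmetric]
      vec_ext_def[symmetric] by (rule conjunct2)
  then obtain B b \<alpha> where B: "vec_ext h \<in> B"
    and wb: "weight_basis (lie_bracket (\<lambda>i j k. \<iota> (c i j k))) B b \<alpha>"
    and nr: "\<And>r l. r \<ge> 2 \<Longrightarrow> (\<Sum>i\<in>UNIV. l i) = r \<Longrightarrow>
      of_nat r - 1 + (\<Sum>i\<in>UNIV. of_nat (l i) * \<alpha> i (vec_ext h)) \<noteq> 0"
    by blast
  have lin_X: "linear_part (X i) = linear_function (axis i 1 + lie_bracket c h (axis i 1))" for i
    by (simp add: linear_part_linear_coeffs h)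
  obtain H where H: "vanishing 2 (H - linear_function h)" "vf_apply X H = H"
  proof (rule eigenfunction_exists[of X "linear_function h"])
    show "value0 (X i) = 0" for i by (rule X0)
    show "homogeneous 1 (linear_function h)" by (rule homogeneous_linear_function)
    \<comment> \<open>The iteration may start at h_1: the Euler field fixes it and [h_1, h_1] =
      0.\<close>
    show "vf_apply (vf_linear_part X) (linear_function h) = linear_function h"
      using vf_apply_linear_vf[OF lin_lie_bracket(1), of "vf_linear_part X" c h h] lin_X alternating by simp
    show "\<exists>f. homogeneous r f \<and> vf_apply (vf_linear_part X) f - f = g"
      if "r \<ge> 2" "homogeneous r g" for r g
    proof (rule linear_vf_surjective[OF lin_X, of b])
      show "vec_basis b" using wb by (simp add: weight_basis_def)
      show "lie_bracket (\<lambda>i j k. \<iota> (c i j k)) (vec_ext h) (b i) = \<alpha> i (vec_ext h) *s b i" for i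
        using wb B by (simp add: weight_basis_def)
      show "of_nat r - 1 + (\<Sum>i\<in>UNIV. of_nat (l i) * \<alpha> i (vec_ext h)) \<noteq> 0" if "deg l = r" for l
        by (rule nr[OF \<open>r \<ge> 2\<close> that])
    qed (rule that(2))
  qed
  show ?thesis
    using h H unfolding c_def by (rule linearization_of_eigenfunction[OF PX P0 X0])
qed

theorem theoremA:
  shows "(\<forall>(P :: (real, 'n::finite) bivfield) (X :: (real, 'n) vfield).
            homogeneous_poisson P X \<and>
            (\<forall>i j. value0 (P i j) = 0) \<and> (\<forall>i. value0 (X i) = 0) \<and>
            lie_semisimple (lie_bracket (structure_const (biv_linear_part P))) \<and>
            semisimple_nonresonant complex_of_real (biv_linear_part P) (vf_linear_part X) \<longrightarrow>
            (\<exists>\<phi>. formal_diffeo \<phi> \<and>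
                 sends_biv \<phi> P (biv_linear_part P) \<and> sends_vf \<phi> X (vf_linear_part X))) \<and>
         (\<forall>(P :: (complex, 'n) bivfield) (X :: (complex, 'n) vfield).
            homogeneous_poisson P X \<and>
            (\<forall>i j. value0 (P i j) = 0) \<and> (\<forall>i. value0 (X i) = 0) \<and>
            lie_semisimple (lie_bracket (structure_const (biv_linear_part P))) \<and>
            semisimple_nonresonant id (biv_linear_part P) (vf_linear_part X) \<longrightarrow>
            (\<exists>\<phi>. formal_diffeo \<phi> \<and>
                 sends_biv \<phi> P (biv_linear_part P) \<and> sends_vf \<phi> X (vf_linear_part X)))"
proof (intro conjI allI impI; elim conjE)
  \<comment> \<open>\<open>Re\<close> is real-linear and restricts to the identity on the reals, as
    the retraction requires.\<close>
  interpret scalar_retraction complex_of_real Re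
    by unfold_locales auto
  fix P :: "(real, 'n) bivfield" and X :: "(real, 'n) vfield"
  assume "homogeneous_poisson P X" "\<forall>i j. value0 (P i j) = 0" "\<forall>i. value0 (X i) = 0"
    "lie_semisimple (lie_bracket (structure_const (biv_linear_part P)))"
    "semisimple_nonresonant complex_of_real (biv_linear_part P) (vf_linear_part X)"
  then show "\<exists>\<phi>. formal_diffeo \<phi> \<and>
      sends_biv \<phi> P (biv_linear_part P) \<and> sends_vf \<phi> X (vf_linear_part X)"
    by (intro linearization_exists) blast+
next
  interpret scalar_retraction "id :: complex \<Rightarrow> complex" id
    by unfold_locales auto
  fix P :: "(complex, 'n) bivfield" and X :: "(complex, 'n) vfield"
  assume "homogeneous_poisson P X" "\<forall>i j. value0 (P i j) = 0" "\<forall>i. value0 (X i) = 0"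
    "lie_semisimple (lie_bracket (structure_const (biv_linear_part P)))"
    "semisimple_nonresonant id (biv_linear_part P) (vf_linear_part X)"
  then show "\<exists>\<phi>. formal_diffeo \<phi> \<and>
      sends_biv \<phi> P (biv_linear_part P) \<and> sends_vf \<phi> X (vf_linear_part X)"
    by (intro linearization_exists) blast+
qed

end
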